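(* Let $n$ be a positive integer and let $g:\mathbb{N}^n\to\mathbb{Q}$ be a function. Consider the following three properties: (A) $g$ is a Presburger counting function; (B) $g$ is a piecewise quasi-polynomial; (C) $\sum_{\mathbf{p}\in\mathbb{N}^n} g(\mathbf{p})\,\mathbf{x}^{\mathbf{p}}$ is a rational generating function. Then (A) implies (B), and (B) holds if and only if (C) holds.
   Context: Notation: $\mathbb{N}=\{0,1,2,\ldots\}$; bold letters denote vectors; $\mathbf{x}^{\mathbf{p}}=x_1^{p_1}\cdots x_n^{p_n}$. A Presburger formula is a first-order formula in the language of addition, evaluated over the natural numbers $\mathbb{N}$ (all variables, free and quantified, range over $\mathbb{N}$). Equivalently, it is a Boolean combination of linear equalities and inequalities with integer coefficients and integer constant terms, with some of the variables quantified by $\exists$ or $\forall$ (nested arbitrarily). Given a Presburger formula $F(\mathbf{c},\mathbf{p})$ with free variables $\mathbf{c}=(c_1,\ldots,c_d)$ (counted variables) and $\mathbf{p}=(p_1,\ldots,p_n)$ (parameter variables), its Presburger counting function is $g_F(\mathbf{p})=\#\{\mathbf{c}\in\mathbb{N}^d : F(\mathbf{c},\mathbf{p})\}$. Only formulas for which $g_F(\mathbf{p})$ is finite for all $\mathbf{p}\in\mathbb{N}^n$ are considered. A function $g$ is a Presburger counting function if $g=g_F$ for some such $F$ (with any number $d$ of counted variables). A quasi-polynomial (over $\mathbb{Q}$) is a function $g:\mathbb{N}^n\to\mathbb{Q}$ such that there exist an $n$-dimensional lattice (i.e. full-rank subgroup) $\Lambda\subseteq\mathbb{Z}^n$ and polynomials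 $q_{\bar\lambda}(\mathbf{p})\in\mathbb{Q}[\mathbf{p}]$, one for each coset $\bar\lambda\in\mathbb{Z}^n/\Lambda$, such that $g(\mathbf{p})=q_{\bar\lambda}(\mathbf{p})$ for all $\mathbf{p}\in\bar\lambda\cap\mathbb{N}^n$. A rational polyhedron in $\mathbb{R}^n$ is the solution set of a finite system of (non-strict) linear inequalities with rational coefficients and rational constant terms. A piecewise quasi-polynomial is a function $g:\mathbb{N}^n\to\mathbb{Q}$ such that there exist a finite partition $\bigcup_i(P_i\cap\mathbb{N}^n)$ of $\mathbb{N}^n$ with $P_i$ rational polyhedra (which may not all be full-dimensional) and quasi-polynomials $g_i$ such that $g(\mathbf{p})=g_i(\mathbf{p})$ for all $\mathbf{p}\in P_i\cap\mathbb{N}^n$. A rational generating function is a function that can be written in the form $\dfrac{q(\mathbf{x})}{(1-\mathbf{x}^{\mathbf{b}_1})\cdots(1-\mathbf{x}^{\mathbf{b}_k})}$, where $q(\mathbf{x})\in\mathbb{Q}[\mathbf{x}]$ is a polynomial and $\mathbf{b}_i\in\mathbb{N}^n\setminus\{\mathbf{0}\}$; a formal power series is said to be a rational generating function if it equals the power series expansion of such an expression (each $1/(1-\mathbf{x}^{\mathbf{b}_i})$ being expanded as $1+\mathbf{x}^{\mathbf{b}_i}+\mathbf{x}^{2\mathbf{b}_i}+\cdots$). *)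

theory Defs
  imports "HOL-Analysis.Analysis" "HOL-Library.Poly_Mapping"
begin

definition map_vec :: "('a \<Rightarrow> 'b) \<Rightarrow> 'a ^ 'n \<Rightarrow> 'b ^ 'n" where
  "map_vec f v = (\<chi> i. f (v $ i))"


section \<open>Presburger counting functions\<close>

text \<open>Integer coefficients and constants are allowed, so terms denote integers, while all
  variables, free or bound, range over the natural numbers.\<close>

datatype 'v lin_term =
    Const int
  | Var 'v
  | Add "'v lin_term" "'v lin_term"
  | Scale int "'v lin_term"

datatype 'v presburger =
    Equal "'v lin_term" "'v lin_term"
  | LessEq "'v lin_term" "'v lin_term"
  | Neg "'v presburger"
  | Conj "'v presburger" "'v presburger"
  | Disj "'v presburger" "'v presburger"
  | Exists 'v "'v presburger"
  | Forall 'v "'v presburger"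

primrec term_val :: "('v \<Rightarrow> nat) \<Rightarrow> 'v lin_term \<Rightarrow> int" where
  "term_val e (Const k) = k"
| "term_val e (Var v) = int (e v)"
| "term_val e (Add s t) = term_val e s + term_val e t"
| "term_val e (Scale k t) = k * term_val e t"

primrec holds :: "('v \<Rightarrow> nat) \<Rightarrow> 'v presburger \<Rightarrow> bool" where
  "holds e (Equal s t) \<longleftrightarrow> term_val e s = term_val e t"
| "holds e (LessEq s t) \<longleftrightarrow> term_val e s \<le> term_val e t"
| "holds e (Neg F) \<longleftrightarrow> \<not> holds e F"
| "holds e (Conj F G) \<longleftrightarrow> holds e F \<and> holds e G"
| "holds e (Disj F G) \<longleftrightarrow> holds e F \<or> holds e G"
| "holds e (Exists v F) \<longleftrightarrow> (\<exists>k. holds (e(v := k)) F)"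
| "holds e (Forall v F) \<longleftrightarrow> (\<forall>k. holds (e(v := k)) F)"

primrec term_vars :: "'v lin_term \<Rightarrow> 'v set" where
  "term_vars (Const k) = {}"
| "term_vars (Var v) = {v}"
| "term_vars (Add s t) = term_vars s \<union> term_vars t"
| "term_vars (Scale k t) = term_vars t"

primrec free_vars :: "'v presburger \<Rightarrow> 'v set" where
  "free_vars (Equal s t) = term_vars s \<union> term_vars t"
| "free_vars (LessEq s t) = term_vars s \<union> term_vars t"
| "free_vars (Neg F) = free_vars F"
| "free_vars (Conj F G) = free_vars F \<union> free_vars G"
| "free_vars (Disj F G) = free_vars F \<union> free_vars G"
| "free_vars (Exists v F) = free_vars F - {v}"
| "free_vars (Forall v F) = free_vars F - {v}"

text \<open>The variables are \<open>Inl i\<close> for the parameters \<open>p\<^sub>i\<close> and \<open>Inr j\<close> with \<open>j < d\<close> for the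
  counted variables \<open>c\<^sub>j\<close>; the remaining \<open>Inr j\<close> can only occur bound.\<close>

definition solutions :: "nat \<Rightarrow> ('n + nat) presburger \<Rightarrow> nat ^ 'n \<Rightarrow> (nat \<Rightarrow> nat) set" where
  "solutions d F p = {c \<in> {..<d} \<rightarrow>\<^sub>E UNIV. holds (case_sum (($) p) c) F}"

definition presburger_counting_function :: "(nat ^ 'n \<Rightarrow> rat) \<Rightarrow> bool" where
  "presburger_counting_function g \<longleftrightarrow>
     (\<exists>d F. free_vars F \<subseteq> range Inl \<union> Inr ` {..<d} \<and>
            (\<forall>p. finite (solutions d F p)) \<and>
            (\<forall>p. g p = of_nat (card (solutions d F p))))"


section \<open>Piecewise quasi-polynomials\<close>

text \<open>Multivariate polynomials map exponent vectors to coefficients.\<close>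

type_synonym ('a, 'n) mpoly = "(nat ^ 'n) \<Rightarrow>\<^sub>0 'a"

definition mpoly_eval :: "('a::comm_semiring_1, 'n::finite) mpoly \<Rightarrow> 'a ^ 'n \<Rightarrow> 'a" where
  "mpoly_eval q x =
     (\<Sum>m\<in>Poly_Mapping.keys q. Poly_Mapping.lookup q m * (\<Prod>i\<in>UNIV. (x $ i) ^ (m $ i)))"

text \<open>The rank of a subgroup of \<open>\<int>\<^sup>n\<close> is the dimension of its real span.\<close>

definition full_rank_lattice :: "(int ^ 'n) set \<Rightarrow> bool" where
  "full_rank_lattice L \<longleftrightarrow>
     0 \<in> L \<and> (\<forall>x\<in>L. \<forall>y\<in>L. x - y \<in> L) \<and>
     dim (map_vec real_of_int ` L) = CARD('n)"

definition cosets :: "(int ^ 'n) set \<Rightarrow> (int ^ 'n) set set" where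
  "cosets L = range (\<lambda>v. (+) v ` L)"

definition quasi_polynomial :: "(nat ^ 'n \<Rightarrow> rat) \<Rightarrow> bool" where
  "quasi_polynomial g \<longleftrightarrow>
     (\<exists>L (q :: (int ^ 'n) set \<Rightarrow> (rat, 'n) mpoly).
        full_rank_lattice L \<and>
        (\<forall>C\<in>cosets L. \<forall>p. map_vec int p \<in> C \<longrightarrow> g p = mpoly_eval (q C) (map_vec of_nat p)))"

definition rational_polyhedron :: "(real ^ 'n) set \<Rightarrow> bool" where
  "rational_polyhedron P \<longleftrightarrow>
     (\<exists>S :: ((rat ^ 'n) \<times> rat) set.
        finite S \<and> P = {x. \<forall>(a, b)\<in>S. map_vec of_rat a \<bullet> x \<le> of_rat b})"

definition nat_points :: "(real ^ 'n) set \<Rightarrow> (nat ^ 'n) set" where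
  "nat_points P = {p. map_vec real p \<in> P}"

text \<open>Some of the pieces may contain no natural points; dropping these gives a partition into
  nonempty sets.\<close>

definition piecewise_quasi_polynomial :: "(nat ^ 'n \<Rightarrow> rat) \<Rightarrow> bool" where
  "piecewise_quasi_polynomial g \<longleftrightarrow>
     (\<exists>(k::nat) P h.
        (\<forall>i<k. rational_polyhedron (P i)) \<and>
        (\<forall>i<k. quasi_polynomial (h i)) \<and>
        disjoint_family_on (\<lambda>i. nat_points (P i)) {..<k} \<and>
        (\<Union>i<k. nat_points (P i)) = UNIV \<and>
        (\<forall>i<k. \<forall>p\<in>nat_points (P i). g p = h i p))"


section \<open>Rational generating functions\<close>

text \<open>A formal power series is identified with its family of coefficients: the function \<open>g\<close>
  stands for the sum of \<open>g p x\<^sup>p\<close> over all \<open>p\<close>.\<close>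

type_synonym ('a, 'n) mfps = "nat ^ 'n \<Rightarrow> 'a"

definition mfps_mult :: "('a::comm_semiring_1, 'n::finite) mfps \<Rightarrow> ('a, 'n) mfps \<Rightarrow> ('a, 'n) mfps" where
  "mfps_mult f h = (\<lambda>p. \<Sum>(a, b) | a + b = p. f a * h b)"

lemma finite_mfps_mult_index: "finite {(a, b). a + b = (p :: nat ^ 'n)}"
proof (rule finite_subset)
  let ?A = "vec_lambda ` (UNIV \<rightarrow>\<^sub>E {..Max (range (($) p))}) :: (nat ^ 'n) set"
  have *: "a \<in> ?A" if "\<And>i. a $ i \<le> p $ i" for a :: "nat ^ 'n"
  proof (rule image_eqI)
    show "a = vec_lambda (($) a)" by simp
    show "($) a \<in> UNIV \<rightarrow>\<^sub>E {..Max (range (($) p))}"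
      using order_trans[OF that Max_ge] by (auto simp: PiE_iff)
  qed
  have "a \<in> ?A \<and> b \<in> ?A" if "a + b = p" for a b
    by (intro conjI *) (simp_all flip: that)
  then show "{(a, b). a + b = p} \<subseteq> ?A \<times> ?A"
    by blast
  show "finite (?A \<times> ?A)"
    by (intro finite_cartesian_product finite_imageI finite_PiE) auto
qed

text \<open>The expansion \<open>1 + x\<^sup>b + x\<^sup>2\<^sup>b + \<dots>\<close> of \<open>1 / (1 - x\<^sup>b)\<close>, for \<open>b \<noteq> 0\<close>.\<close>

definition geom_series :: "nat ^ 'n::finite \<Rightarrow> ('a::comm_semiring_1, 'n) mfps" where
  "geom_series b = (\<lambda>p. if \<exists>k. p = k *s b then 1 else 0)"

definition rational_generating_function :: "(rat, 'n::finite) mfps \<Rightarrow> bool" where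
  "rational_generating_function g \<longleftrightarrow>
     (\<exists>(q :: (rat, 'n) mpoly) bs.
        0 \<notin> set bs \<and>
        g = foldr (\<lambda>b. mfps_mult (geom_series b)) bs (Poly_Mapping.lookup q))"

end

theory Submission
  imports Defs
begin

text \<open>
  All three classes of functions are compared with a fourth one, the \<^emph>\<open>constructible\<close> functions:
  the algebra generated by the coordinates, the indicators of half-spaces \<open>0 \<le> l\<close> and of congruences
  \<open>m dvd l\<close>, and the rational constants.  For each constructible function there are finitely
  many half-spaces such that it is quasi-polynomial on every cell that they cut out, so that it is a
  piecewise quasi-polynomial; conversely the indicators of rational polyhedra and of residue classes
  are constructible, and every lattice of full rank contains some \<open>M \<int>\<^sup>n\<close> (\<open>full_rank_lattice_multiples\<close>), so that piecewise
  quasi-polynomials are constructible.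

  The main property of constructible functions is that they can be summed over a variable
  (\<open>constructible_Sum_any\<close>).  The partial sums \<open>f 0 + \<dots> + f (n - 1)\<close> are constructible in \<open>n\<close> and the
  remaining variables, because a half-space condition on the summation variable only moves the upper
  limit to the floor of a rational linear form, and without such conditions the power sum formulas apply
  (\<open>sum_upto_constructible\<close>).  Beyond a linear bound \<open>N\<close> in the other variables all signs are fixed
  and \<open>f\<close> is a polynomial on each residue class of the summation variable; if only finitely many
  summands are nonzero, these polynomials vanish, and the full sum is the partial sum up to \<open>N\<close>.

  A Presburger formula defines a set with constructible indicator by quantifier elimination
  (\<open>definable_Ex\<close>), and counting its solutions means summing the indicator over the counted variables
  one after the other.  This gives (A) \<open>\<Longrightarrow>\<close> (B).  Multiplying a power series by \<open>1 / (1 - x\<^sup>b)\<close>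
  replaces its coefficient at \<open>p\<close> by the sum of the coefficients at \<open>p - k b\<close> over all \<open>k\<close>, again a
  sum over one variable; so the coefficients of a rational generating function are constructible,
  which gives (C) \<open>\<Longrightarrow>\<close> (B).

  For (B) \<open>\<Longrightarrow>\<close> (C) it is shown that rational generating functions stay rational when their
  coefficients are multiplied by a constructible function; applied to the constant function 1 this
  is the claim.  Multiplication by \<open>p\<^sub>i\<close> is the derivation \<open>x\<^sub>i \<partial>/\<partial>x\<^sub>i\<close>.  For indicators it suffices to
  treat a series \<open>x\<^sup>m / ((1 - x\<^sup>b\<^sub>1) \<dots> (1 - x\<^sup>b\<^sub>k))\<close>, which enumerates, with multiplicities, the points of a
  translated cone.  If the linear
  form \<open>w\<close> of a half-space is nonnegative on all generators \<open>b\<^sub>i\<close>, only finitely many multiples of the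
  generators with \<open>w b\<^sub>i > 0\<close> have to be removed.  The general case is reduced to this one and its
  mirror image by the procedure of Elliott and MacMahon: the identity
  \<open>1 / ((1 - u) (1 - v)) = (1 / (1 - u) + 1 / (1 - v) - 1) / (1 - u v)\<close>
  replaces two generators on which \<open>w\<close> has opposite values by their sum, on which \<open>w\<close> vanishes, and at
  most one of them.  The values become opposite when the generators are replaced by suitable
  multiples, which cuts the cone into finitely many translates of a smaller one.  Replacing the
  generators by their multiples by \<open>m\<close> also settles the congruences modulo \<open>m\<close>.
\<close>

section \<open>Linear forms, definable predicates and constructible functions\<close>

inductive_set linear_forms :: "(('v \<Rightarrow> nat) \<Rightarrow> int) set" where
  linear_const: "(\<lambda>e. c) \<in> linear_forms"
| linear_var: "(\<lambda>e. int (e v)) \<in> linear_forms"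
| linear_add: "l \<in> linear_forms \<Longrightarrow> l' \<in> linear_forms \<Longrightarrow> (\<lambda>e. l e + l' e) \<in> linear_forms"
| linear_scale: "l \<in> linear_forms \<Longrightarrow> (\<lambda>e. c * l e) \<in> linear_forms"

text \<open>The sets definable in Presburger arithmetic, described without quantifiers. Closure under
  quantifiers is \<open>definable_Ex\<close>.\<close>

inductive definable :: "(('v \<Rightarrow> nat) \<Rightarrow> bool) \<Rightarrow> bool" where
  definable_nonneg: "l \<in> linear_forms \<Longrightarrow> definable (\<lambda>e. 0 \<le> l e)"
| definable_dvd: "l \<in> linear_forms \<Longrightarrow> m > 0 \<Longrightarrow> definable (\<lambda>e. m dvd l e)"
| definable_not: "definable P \<Longrightarrow> definable (\<lambda>e. \<not> P e)"
| definable_conj: "definable P \<Longrightarrow> definable Q \<Longrightarrow> definable (\<lambda>e. P e \<and> Q e)"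

inductive constructible :: "(('v \<Rightarrow> nat) \<Rightarrow> rat) \<Rightarrow> bool" where
  constructible_const: "constructible (\<lambda>e. c)"
| constructible_linear: "l \<in> linear_forms \<Longrightarrow> constructible (\<lambda>e. of_int (l e))"
| constructible_of_bool: "definable P \<Longrightarrow> constructible (\<lambda>e. of_bool (P e))"
| constructible_add: "constructible f \<Longrightarrow> constructible g \<Longrightarrow> constructible (\<lambda>e. f e + g e)"
| constructible_mult: "constructible f \<Longrightarrow> constructible g \<Longrightarrow> constructible (\<lambda>e. f e * g e)"

lemma linear_uminus: "l \<in> linear_forms \<Longrightarrow> (\<lambda>e. - l e) \<in> linear_forms"
  using linear_scale[of l "-1"] by simp

lemma linear_diff:
  "l \<in> linear_forms \<Longrightarrow> l' \<in> linear_forms \<Longrightarrow> (\<lambda>e. l e - l' e) \<in> linear_forms"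
  using linear_add[OF _ linear_uminus] by force

lemma linear_scale_right: "l \<in> linear_forms \<Longrightarrow> (\<lambda>e. l e * c) \<in> linear_forms"
  using linear_scale[of l c] by (simp add: mult.commute)

lemma linear_sum:
  "(\<And>i. i \<in> I \<Longrightarrow> l i \<in> linear_forms) \<Longrightarrow> (\<lambda>e. \<Sum>i\<in>I. l i e) \<in> linear_forms"
  by (induction I rule: infinite_finite_induct) (auto intro: linear_const linear_add)

lemmas linear_intros = linear_const linear_var linear_add linear_diff linear_uminus linear_scale
  linear_scale_right linear_sum

lemma definable_le:
  "l \<in> linear_forms \<Longrightarrow> l' \<in> linear_forms \<Longrightarrow> definable (\<lambda>e. l e \<le> l' e)"
  using definable_nonneg[OF linear_diff, of l' l] by simp

lemma definable_eq:
  assumes "l \<in> linear_forms" "l' \<in> linear_forms"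
  shows "definable (\<lambda>e. l e = l' e)"
  using definable_conj[OF definable_le[OF assms] definable_le[OF assms(2,1)]]
  by (simp add: eq_iff)

lemma definable_const: "definable (\<lambda>e. b)"
  using definable_nonneg[OF linear_const, of "if b then 0 else -1"] by (cases b) simp_all

lemma definable_disj: "definable P \<Longrightarrow> definable Q \<Longrightarrow> definable (\<lambda>e. P e \<or> Q e)"
  using definable_not[OF definable_conj[OF definable_not definable_not]] by force

lemma definable_Ball:
  assumes "finite I" "\<And>i. i \<in> I \<Longrightarrow> definable (P i)"
  shows "definable (\<lambda>e. \<forall>i\<in>I. P i e)"
  using assms by (induction I) (auto intro: definable_const definable_conj)

lemma definable_Bex:
  assumes "finite I" "\<And>i. i \<in> I \<Longrightarrow> definable (P i)"
  shows "definable (\<lambda>e. \<exists>i\<in>I. P i e)"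
  using assms by (induction I) (auto intro: definable_const definable_disj)

lemma definable_If:
  "definable Q \<Longrightarrow> definable A \<Longrightarrow> definable B \<Longrightarrow> definable (\<lambda>e. if Q e then A e else B e)"
  using definable_disj[OF definable_conj[of Q A] definable_conj[OF definable_not[of Q], of B]]
  by (simp add: if_bool_eq_disj)

lemma constructible_sum:
  "(\<And>i. i \<in> I \<Longrightarrow> constructible (f i)) \<Longrightarrow> constructible (\<lambda>e. \<Sum>i\<in>I. f i e)"
  by (induction I rule: infinite_finite_induct)
    (auto intro: constructible_const constructible_add)

lemma constructible_diff:
  assumes "constructible f" "constructible g" shows "constructible (\<lambda>e. f e - g e)"
  using constructible_add[OF assms(1) constructible_mult[OF constructible_const[of "-1"] assms(2)]]
  by simp

lemma constructible_If:
  assumes "definable Q" "constructible f" "constructible g"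
  shows "constructible (\<lambda>e. if Q e then f e else g e)"
proof -
  have "(\<lambda>e. if Q e then f e else g e) =
      (\<lambda>e. of_bool (Q e) * f e + of_bool (\<not> Q e) * g e)"
    by auto
  with assms show ?thesis
    by (auto intro!: constructible_add constructible_mult constructible_of_bool definable_not)
qed

lemma constructible_poly:
  assumes "constructible f" shows "constructible (\<lambda>e. poly p (f e))"
  by (induction p)
    (simp_all add: constructible_const constructible_add[OF constructible_const]
      constructible_mult[OF assms])

lemma mod_eq_iff_dvd:
  fixes x r m :: int
  assumes "0 \<le> r" "r < m"
  shows "x mod m = r \<longleftrightarrow> m dvd x - r"
  using assms by (metis mod_eq_dvd_iff mod_pos_pos_trivial)

lemma definable_mod_eq:
  assumes "l \<in> linear_forms" "m > 0"
  shows "definable (\<lambda>e. l e mod m = r)"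
proof (cases "0 \<le> r \<and> r < m")
  case True
  then have "(\<lambda>e. l e mod m = r) = (\<lambda>e. m dvd l e - r)"
    by (simp add: mod_eq_iff_dvd)
  then show ?thesis
    using assms by (auto intro!: definable_dvd linear_diff linear_const)
next
  case False
  then have "(\<lambda>e. l e mod m = r) = (\<lambda>e. False)"
    using assms(2) by (auto simp: fun_eq_iff)
  then show ?thesis
    by (simp add: definable_const)
qed

text \<open>Division with remainder is reduced to finitely many linear cases by fixing the remainder.\<close>

lemma definable_cases_mod:
  assumes l: "l \<in> linear_forms" and m: "m > 0" and P: "\<And>r. definable (P r)"
  shows "definable (\<lambda>e. P (l e mod m) e)"
proof -
  have "(\<lambda>e. P (l e mod m) e) = (\<lambda>e. \<exists>r\<in>{0..<m}. l e mod m = r \<and> P r e)"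
    using m by auto
  moreover have "definable (\<lambda>e. \<exists>r\<in>{0..<m}. l e mod m = r \<and> P r e)"
    by (intro definable_Bex definable_conj definable_mod_eq l m P finite_atLeastLessThan_int)
  ultimately show ?thesis by simp
qed

lemma constructible_cases_mod:
  assumes l: "l \<in> linear_forms" and m: "m > 0" and f: "\<And>r. constructible (f r)"
  shows "constructible (\<lambda>e. f (l e mod m) e)"
proof -
  have "(\<lambda>e. f (l e mod m) e) = (\<lambda>e. \<Sum>r\<in>{0..<m}. of_bool (l e mod m = r) * f r e)"
  proof
    fix e
    have "(\<Sum>r\<in>{0..<m}. of_bool (l e mod m = r) * f r e) =
        (\<Sum>r\<in>{0..<m}. if r = l e mod m then f r e else 0)"
      by (intro sum.cong) auto
    also have "\<dots> = f (l e mod m) e"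
      using m by (subst sum.delta) auto
    finally show "f (l e mod m) e = (\<Sum>r\<in>{0..<m}. of_bool (l e mod m = r) * f r e)" ..
  qed
  moreover have "constructible (\<lambda>e. \<Sum>r\<in>{0..<m}. of_bool (l e mod m = r) * f r e)"
    by (intro constructible_sum constructible_mult constructible_of_bool definable_mod_eq l m f)
  ultimately show ?thesis by (simp only:)
qed

section \<open>Substitution\<close>

text \<open>The substitutions that preserve definability and constructibility. It suffices to know this for the
  generators of the two classes; \<open>\<tau>\<close> itself need not be linear, only piecewise.\<close>

definition admissible :: "(('v \<Rightarrow> nat) \<Rightarrow> ('w \<Rightarrow> nat)) \<Rightarrow> bool" where
  "admissible \<tau> \<longleftrightarrow> (\<forall>l\<in>linear_forms. definable (\<lambda>e. 0 \<le> l (\<tau> e)) \<and>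
     (\<forall>m>0. definable (\<lambda>e. m dvd l (\<tau> e))) \<and> constructible (\<lambda>e. of_int (l (\<tau> e))))"

lemma definable_subst: "definable P \<Longrightarrow> admissible \<tau> \<Longrightarrow> definable (\<lambda>e. P (\<tau> e))"
proof (induction rule: definable.induct)
  case (definable_not P)
  then show ?case by (intro definable.definable_not) auto
next
  case (definable_conj P Q)
  then show ?case by (intro definable.definable_conj) auto
qed (simp_all add: admissible_def)

lemma constructible_subst: "constructible f \<Longrightarrow> admissible \<tau> \<Longrightarrow> constructible (\<lambda>e. f (\<tau> e))"
proof (induction rule: constructible.induct)
  case (constructible_linear l)
  then show ?case by (simp add: admissible_def)
next
  case (constructible_of_bool P)
  then show ?case
    using constructible.constructible_of_bool[OF definable_subst[of P \<tau>]] by simp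
next
  case (constructible_add f g)
  then show ?case by (intro constructible.constructible_add) auto
next
  case (constructible_mult f g)
  then show ?case by (intro constructible.constructible_mult) auto
qed (rule constructible_const)

lemma admissible_linear:
  assumes "\<And>v. (\<lambda>e. int (\<tau> e v)) \<in> linear_forms"
  shows "admissible \<tau>"
proof -
  have "(\<lambda>e. l (\<tau> e)) \<in> linear_forms" if "l \<in> linear_forms" for l
    using that by induction (auto intro: linear_intros assms)
  then show ?thesis
    by (auto simp: admissible_def intro: definable.intros constructible.intros)
qed

lemma admissible_If:
  assumes "definable Q" "admissible \<tau>" "admissible \<tau>'"
  shows "admissible (\<lambda>e. if Q e then \<tau> e else \<tau>' e)"
  unfolding admissible_def
proof (intro ballI conjI allI impI)
  fix l :: "('b \<Rightarrow> nat) \<Rightarrow> int" and m :: int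
  assume l: "l \<in> linear_forms"
  have "(\<lambda>e. 0 \<le> l (if Q e then \<tau> e else \<tau>' e)) = (\<lambda>e. if Q e then 0 \<le> l (\<tau> e) else 0 \<le> l (\<tau>' e))"
    by auto
  then show "definable (\<lambda>e. 0 \<le> l (if Q e then \<tau> e else \<tau>' e))"
    using definable_If[OF assms(1)] assms(2,3) l by (simp add: admissible_def)
  have "(\<lambda>e. rat_of_int (l (if Q e then \<tau> e else \<tau>' e))) =
      (\<lambda>e. if Q e then of_int (l (\<tau> e)) else of_int (l (\<tau>' e)))"
    by auto
  then show "constructible (\<lambda>e. of_int (l (if Q e then \<tau> e else \<tau>' e)))"
    using constructible_If[OF assms(1)] assms(2,3) l by (simp add: admissible_def)
  assume "0 < m"
  moreover have "(\<lambda>e. m dvd l (if Q e then \<tau> e else \<tau>' e)) = (\<lambda>e. if Q e then m dvd l (\<tau> e) else m dvd l (\<tau>' e))"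
    by auto
  ultimately show "definable (\<lambda>e. m dvd l (if Q e then \<tau> e else \<tau>' e))"
    using definable_If[OF assms(1)] assms(2,3) l by (simp add: admissible_def)
qed

text \<open>The shape in which linear forms enter all arguments about a single variable \<open>v\<close>.\<close>

lemma linear_decompose:
  assumes "l \<in> linear_forms"
  obtains l0 b where "l0 \<in> linear_forms" "\<And>e x. l (e(v := x)) = l0 e + b * int x"
    "\<And>e x. l0 (e(v := x)) = l0 e"
proof -
  have "\<exists>l0\<in>linear_forms. \<exists>b. (\<forall>e x. l (e(v := x)) = l0 e + b * int x) \<and> (\<forall>e x. l0 (e(v := x)) = l0 e)"
    using assms
  proof induction
    case (linear_const c)
    then show ?case by (intro bexI[of _ "\<lambda>_. c"] exI[of _ 0]) (auto intro: linear_intros)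
  next
    case (linear_var w)
    show ?case
    proof (cases "w = v")
      case True
      then show ?thesis by (intro bexI[of _ "\<lambda>_. 0"] exI[of _ 1]) (auto intro: linear_intros)
    next
      case False
      then show ?thesis by (intro bexI[of _ "\<lambda>e. int (e w)"] exI[of _ 0]) (auto intro: linear_intros)
    qed
  next
    case (linear_add l l')
    then obtain l0 b l0' b' where "l0 \<in> linear_forms" "l0' \<in> linear_forms"
      "\<forall>e x. l (e(v := x)) = l0 e + b * int x" "\<forall>e x. l0 (e(v := x)) = l0 e"
      "\<forall>e x. l' (e(v := x)) = l0' e + b' * int x" "\<forall>e x. l0' (e(v := x)) = l0' e"
      by blast
    then show ?case
      by (intro bexI[of _ "\<lambda>e. l0 e + l0' e"] exI[of _ "b + b'"]) 
        (simp_all add: distrib_right linear_forms.linear_add del: fun_upd_apply)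
  next
    case (linear_scale l c)
    then obtain l0 b where "l0 \<in> linear_forms"
      "\<forall>e x. l (e(v := x)) = l0 e + b * int x" "\<forall>e x. l0 (e(v := x)) = l0 e"
      by blast
    then show ?case
      by (intro bexI[of _ "\<lambda>e. c * l0 e"] exI[of _ "c * b"])
        (simp_all add: distrib_left mult.assoc linear_forms.linear_scale del: fun_upd_apply)
  qed
  then show ?thesis using that by blast
qed

lemma admissible_update_const: "admissible (\<lambda>e. e(v := c))"
proof (rule admissible_linear)
  show "(\<lambda>e. int ((e(v := c)) w)) \<in> linear_forms" for w
    by (cases "w = v") (auto intro: linear_intros)
qed

text \<open>After substituting \<open>\<lfloor>l / m\<rfloor>\<close> for a variable in \<open>k\<close>, multiplying by \<open>m\<close> gives the linear form
  \<open>m k0 + b (l - r)\<close>, where \<open>r\<close> is the remainder of \<open>l\<close> modulo \<open>m\<close>; there are only finitely many \<open>r\<close>.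
  For \<open>l < 0\<close> the truncation to natural numbers substitutes 0.\<close>

lemma admissible_update_div:
  assumes l: "l \<in> linear_forms" and m: "m > 0"
  shows "admissible (\<lambda>e. e(v := nat (l e div m)))"
proof -
  let ?\<tau> = "\<lambda>e. if 0 \<le> l e then e(v := nat (l e div m)) else e(v := 0)"
  have eq: "(\<lambda>e. e(v := nat (l e div m))) = ?\<tau>"
    using m by (auto simp: fun_eq_iff not_le pos_imp_zdiv_neg_iff[of m "l _"] intro: less_imp_le)
  have "definable (\<lambda>e. 0 \<le> k (?\<tau> e)) \<and> (\<forall>n>0. definable (\<lambda>e. n dvd k (?\<tau> e))) \<and>
    constructible (\<lambda>e. of_int (k (?\<tau> e)))" if kl: "k \<in> linear_forms" for k
  proof -
    obtain k0 b where k0: "k0 \<in> linear_forms" and k: "\<And>e x. k (e(v := x)) = k0 e + b * int x"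
      using linear_decompose[OF kl, of v] by metis
    let ?s = "\<lambda>e r. m * k0 e + b * (l e - r)"
    have s: "m * k (e(v := nat (l e div m))) = ?s e (l e mod m)" if "0 \<le> l e" for e
      using that m by (simp add: k pos_imp_zdiv_nonneg_iff algebra_simps minus_mod_eq_mult_div)
    have s_lin: "(\<lambda>e. ?s e r) \<in> linear_forms" for r
      by (intro linear_intros k0 l)
    have "0 \<le> k (?\<tau> e) \<longleftrightarrow> (if 0 \<le> l e then 0 \<le> ?s e (l e mod m) else 0 \<le> k0 e)" for e
      using s[of e] m by (auto simp: k zero_le_mult_iff simp flip: s)
    then have 1: "definable (\<lambda>e. 0 \<le> k (?\<tau> e))"
      by (simp only:) (intro definable_If definable_cases_mod[where P = "\<lambda>r e. 0 \<le> ?s e r"]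
        definable_nonneg l k0 m s_lin)
    have "n dvd k (?\<tau> e) \<longleftrightarrow> (if 0 \<le> l e then m * n dvd ?s e (l e mod m) else n dvd k0 e)" for e n
      using m by (auto simp: k simp flip: s)
    then have 2: "definable (\<lambda>e. n dvd k (?\<tau> e))" if "n > 0" for n
      using that m
      by (simp only:) (intro definable_If definable_cases_mod[where P = "\<lambda>r e. m * n dvd ?s e r"]
        definable_nonneg definable_dvd l k0 s_lin; simp)
    have "rat_of_int (k (?\<tau> e)) =
        (if 0 \<le> l e then 1 / of_int m * of_int (?s e (l e mod m)) else of_int (k0 e))" for e
      using m by (auto simp: k simp flip: s)
    then have "constructible (\<lambda>e. of_int (k (?\<tau> e)))"
      by (simp only:) (intro constructible_If constructible_mult constructible_const
        constructible_cases_mod[where f = "\<lambda>r e. of_int (?s e r)"] constructible_linear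
        definable_nonneg l k0 m s_lin)
    with 1 2 show ?thesis by blast
  qed
  then show ?thesis
    unfolding eq admissible_def by blast
qed

section \<open>Quantifier elimination\<close>

lemma int_le_div_iff:
  fixes k c m :: int
  assumes "m > 0"
  shows "k \<le> c div m \<longleftrightarrow> k * m \<le> c"
proof
  assume "k \<le> c div m"
  then have "k * m \<le> c div m * m"
    using assms by (intro mult_right_mono) auto
  also have "\<dots> \<le> c"
    using pos_mod_sign[OF assms, of c] minus_mod_eq_div_mult[of c m] by linarith
  finally show "k * m \<le> c" .
next
  assume "k * m \<le> c"
  from zdiv_mono1[OF this assms] assms show "k \<le> c div m" by simp
qed

lemma linear_nonneg_threshold:
  fixes b c :: int
  shows "b > 0 \<Longrightarrow> 0 \<le> c + b * k \<longleftrightarrow> (- c - 1) div b < k"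
    and "b < 0 \<Longrightarrow> 0 \<le> c + b * k \<longleftrightarrow> k \<le> c div (- b)"
  using int_le_div_iff[of b k "- c - 1"] int_le_div_iff[of "- b" k c]
  by (auto simp: not_le[symmetric] algebra_simps)

text \<open>The elements \<open>(l, m)\<close> of \<open>B\<close> stand for the points \<open>\<lfloor>l e / m\<rfloor>\<close> where a predicate may change
  its truth value.\<close>

definition boundary_free :: "nat \<Rightarrow> ((('v \<Rightarrow> nat) \<Rightarrow> int) \<times> int) set \<Rightarrow> ('v \<Rightarrow> nat) \<Rightarrow> nat \<Rightarrow> bool" where
  "boundary_free M B e k \<longleftrightarrow> (\<forall>(l, m)\<in>B. \<not> (int k \<le> l e div m \<and> l e div m < int (k + M)))"

text \<open>A half-space condition changes its truth value at most once along the \<open>v\<close>-axis, at the floor of a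
  rational linear form, and a congruence is periodic. For conjunctions the common period is the product of the
  periods: the larger step consists of small steps within the same boundary-free window.\<close>

lemma definable_boundaries:
  assumes "definable P"
  obtains M B where "M > 0" "finite B" "\<And>l m. (l, m) \<in> B \<Longrightarrow> l \<in> linear_forms \<and> m > 0"
    "\<And>e k. boundary_free M B e k \<Longrightarrow> P (e(v := k + M)) = P (e(v := k))"
proof -
  have "\<exists>M B. M > 0 \<and> finite B \<and> (\<forall>(l, m)\<in>B. l \<in> linear_forms \<and> m > 0) \<and>
    (\<forall>e k. boundary_free M B e k \<longrightarrow> P (e(v := k + M)) = P (e(v := k)))"
    using assms
  proof induction
    case (definable_nonneg l)
    then obtain l0 b where l0: "l0 \<in> linear_forms" and l: "\<And>e x. l (e(v := x)) = l0 e + b * int x"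
      using linear_decompose[OF definable_nonneg, of v] by metis
    consider "b = 0" | "b > 0" | "b < 0" by linarith
    then show ?case
    proof cases
      case 1
      then show ?thesis
        by (intro exI[of _ 1] exI[of _ "{}"]) (simp add: l del: fun_upd_apply)
    next
      case 2
      then show ?thesis
        by (intro exI[of _ 1] exI[of _ "{(\<lambda>e. - l0 e - 1, b)}"])
          (auto simp: l linear_nonneg_threshold boundary_free_def simp del: fun_upd_apply
            intro!: linear_intros l0)
    next
      case 3
      then show ?thesis
        by (intro exI[of _ 1] exI[of _ "{(l0, - b)}"])
          (auto simp: l linear_nonneg_threshold boundary_free_def simp del: fun_upd_apply
            intro!: linear_intros l0)
    qed
  next
    case (definable_dvd l m)
    then obtain l0 b where l: "\<And>e x. l (e(v := x)) = l0 e + b * int x"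
      using linear_decompose[OF definable_dvd(1), of v] by metis
    have "m dvd l (e(v := k + nat m)) \<longleftrightarrow> m dvd l (e(v := k))" for e k
      using definable_dvd(2) by (simp add: l distrib_left flip: add.assoc)
    then show ?case
      using definable_dvd(2) by (intro exI[of _ "nat m"] exI[of _ "{}"]) (auto simp del: fun_upd_apply)
  next
    case (definable_not P)
    then show ?case by (simp del: fun_upd_apply)
  next
    case (definable_conj P Q)
    then obtain M B M' B' where
      P: "M > 0" "finite B" "\<forall>(l, m)\<in>B. l \<in> linear_forms \<and> m > 0"
        "\<And>e k. boundary_free M B e k \<Longrightarrow> P (e(v := k + M)) = P (e(v := k))" and
      Q: "M' > 0" "finite B'" "\<forall>(l, m)\<in>B'. l \<in> linear_forms \<and> m > 0"
        "\<And>e k. boundary_free M' B' e k \<Longrightarrow> Q (e(v := k + M')) = Q (e(v := k))"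
      by metis
    have iter: "R (e(v := k + i * N)) = R (e(v := k))"
      if R: "\<And>e k. boundary_free N C e k \<Longrightarrow> R (e(v := k + N)) = R (e(v := k))"
        and free: "boundary_free (j * N) C e k" and "i \<le> j" for R N C e k i j
      using \<open>i \<le> j\<close>
    proof (induction i)
      case (Suc i)
      have "k + i * N + N \<le> k + j * N"
        using Suc.prems by (metis add.commute add_le_cancel_left mult_Suc mult_le_mono1 add.assoc)
      then have le: "int k \<le> int (k + i * N)" "int (k + i * N + N) \<le> int (k + j * N)"
        by (simp_all only: of_nat_le_iff le_add1)
      have "boundary_free N C e (k + i * N)"
        using free order_trans[OF le(1)] less_le_trans[OF _ le(2)]
        unfolding boundary_free_def split_def by blast
      from R[OF this] Suc show ?case by (simp add: ac_simps del: fun_upd_apply)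
    qed simp
    have "(P (e(v := k + M' * M)) \<and> Q (e(v := k + M' * M))) = (P (e(v := k)) \<and> Q (e(v := k)))"
      if "boundary_free (M' * M) (B \<union> B') e k" for e k
    proof -
      have "boundary_free (M' * M) B e k" "boundary_free (M * M') B' e k"
        using that by (auto simp: boundary_free_def mult.commute)
      then show ?thesis
        using iter[of M B P M' e k M'] iter[of M' B' Q M e k M] P(4) Q(4)
        by (simp add: mult.commute del: fun_upd_apply)
    qed
    then show ?case
      using P Q by (intro exI[of _ "M' * M"] exI[of _ "B \<union> B'"]) (auto simp del: fun_upd_apply)
  qed
  then show ?thesis using that by blast
qed

text \<open>This is the idea of Cooper's algorithm. The least witness \<open>k\<close> is smaller than the period \<open>M\<close>, or else
  \<open>k - M\<close> is not a witness, so that a boundary lies in the window \<open>[k - M, k)\<close>. Hence only finitely many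
  candidates have to be tried: the numbers below \<open>M\<close>, and the boundaries shifted by at most \<open>M\<close>.\<close>

lemma definable_Ex:
  assumes "definable P"
  shows "definable (\<lambda>e. \<exists>k. P (e(v := k)))"
proof -
  obtain M B where M: "M > 0" and B: "finite B" "\<And>l m. (l, m) \<in> B \<Longrightarrow> l \<in> linear_forms \<and> m > 0"
    and per: "\<And>e k. boundary_free M B e k \<Longrightarrow> P (e(v := k + M)) = P (e(v := k))"
    using definable_boundaries[OF assms] by metis
  let ?w = "\<lambda>(l, m) j e. nat ((l e + int j * m) div m)"
  have "(\<exists>k. P (e(v := k))) \<longleftrightarrow>
      (\<exists>k\<in>{..<M}. P (e(v := k))) \<or> (\<exists>b\<in>B. \<exists>j\<in>{..M}. P (e(v := ?w b j e)))" (is "?L = ?R") for e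
  proof
    assume ?L
    define k where "k = (LEAST k. P (e(v := k)))"
    have k: "P (e(v := k))"
      unfolding k_def using \<open>?L\<close> by (metis LeastI_ex)
    have least: "\<not> P (e(v := k'))" if "k' < k" for k'
      using that not_less_Least unfolding k_def by blast
    show ?R
    proof (cases "k < M")
      case False
      then have "\<not> P (e(v := k - M))" using M by (intro least) auto
      moreover have "P (e(v := k - M + M))" using k False by simp
      ultimately have "\<not> boundary_free M B e (k - M)" using per by blast
      then obtain l m where lm: "(l, m) \<in> B" and
        "int (k - M) \<le> l e div m" "l e div m < int (k - M + M)"
        by (auto simp: boundary_free_def)
      then have "\<exists>j\<le>M. int k = l e div m + int j"
        using False by (intro exI[of _ "nat (int k - l e div m)"]) auto
      then obtain j where j: "j \<le> M" "int k = l e div m + int j" by blast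
      have "?w (l, m) j e = k"
        using j B(2)[OF lm] by simp
      with k lm j show ?thesis by (intro disjI2 bexI[of _ "(l, m)"] bexI[of _ j]) auto
    qed (use k in auto)
  qed auto
  moreover have "definable (\<lambda>e. (\<exists>k\<in>{..<M}. P (e(v := k))) \<or> (\<exists>b\<in>B. \<exists>j\<in>{..M}. P (e(v := ?w b j e))))"
  proof (intro definable_disj definable_Bex B(1) finite_lessThan finite_atMost)
    show "definable (\<lambda>e. P (e(v := k)))" for k
      by (rule definable_subst[OF assms admissible_update_const])
    fix b j assume "b \<in> B"
    moreover obtain l m where "b = (l, m)" by force
    ultimately have "admissible (\<lambda>e. e(v := ?w b j e))"
      using B(2)[of l m] admissible_update_div[of "\<lambda>e. l e + int j * m" m v]
      by (simp add: linear_intros del: div_mult_self1 fun_upd_apply)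
    then show "definable (\<lambda>e. P (e(v := ?w b j e)))"
      by (rule definable_subst[OF assms])
  qed
  ultimately show ?thesis by (simp only:)
qed

lemma linear_term_val: "(\<lambda>e. term_val e t) \<in> linear_forms"
  by (induction t) (auto intro: linear_forms.intros)

lemma definable_holds: "definable (\<lambda>e. holds e F)"
proof (induction F)
  case (Forall v F)
  then show ?case
    using definable_not[OF definable_Ex[OF definable_not[OF Forall]]] by (simp del: fun_upd_apply)
next
  case (Exists v F)
  then show ?case using definable_Ex[OF Exists] by (simp del: fun_upd_apply)
qed (auto intro: definable_eq definable_le definable_not definable_conj definable_disj linear_term_val)

section \<open>Summation over one variable\<close>

text \<open>Summing \<open>(t + 1)\<^bsup>k+1\<^esup> - t\<^bsup>k+1\<^esup>\<close> over \<open>t\<close> telescopes, while the binomial theorem expresses the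
  summands by powers of exponent at most \<open>k\<close>.\<close>

lemma sum_powers_poly: "\<exists>q :: rat poly. \<forall>n. (\<Sum>t<n. of_nat t ^ k) = poly q (of_nat n)"
proof (induction k rule: less_induct)
  case (less k)
  then have "\<forall>i. \<exists>q :: rat poly. i < k \<longrightarrow> (\<forall>n. (\<Sum>t<n. of_nat t ^ i) = poly q (of_nat n))"
    by blast
  then obtain q :: "nat \<Rightarrow> rat poly"
    where q: "\<And>i n. i < k \<Longrightarrow> (\<Sum>t<n. of_nat t ^ i) = poly (q i) (of_nat n)"
    by metis
  \<comment> \<open>Solving the telescoped identity for the sum of the \<open>k\<close>-th powers.\<close>
  let ?Q = "smult (1 / of_nat (Suc k)) (monom 1 (Suc k) - (\<Sum>i<k. smult (of_nat (Suc k choose i)) (q i)))"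
  have "(\<Sum>t<n. of_nat t ^ k) = poly ?Q (of_nat n)" for n
  proof -
    have "(of_nat n :: rat) ^ Suc k = (\<Sum>t<n. of_nat (Suc t) ^ Suc k - of_nat t ^ Suc k)"
      by (subst sum_lessThan_telescope) simp
    also have "\<dots> = (\<Sum>t<n. \<Sum>i\<le>k. of_nat (Suc k choose i) * of_nat t ^ i)"
    proof (rule sum.cong)
      fix t
      have "(of_nat (Suc t) :: rat) ^ Suc k = (\<Sum>i\<le>Suc k. of_nat (Suc k choose i) * of_nat t ^ i)"
        using binomial_ring[of "of_nat t :: rat" 1 "Suc k"] by (simp add: add.commute)
      then show "of_nat (Suc t) ^ Suc k - of_nat t ^ Suc k =
          (\<Sum>i\<le>k. of_nat (Suc k choose i) * (of_nat t :: rat) ^ i)"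
        by simp
    qed simp
    also have "\<dots> = (\<Sum>i\<le>k. of_nat (Suc k choose i) * (\<Sum>t<n. of_nat t ^ i))"
      by (subst sum.swap) (simp add: sum_distrib_left)
    also have "\<dots> = (\<Sum>i<k. of_nat (Suc k choose i) * (\<Sum>t<n. of_nat t ^ i)) +
        of_nat (Suc k) * (\<Sum>t<n. of_nat t ^ k)"
      by (simp add: lessThan_Suc_atMost[symmetric])
    also have "(\<Sum>i<k. of_nat (Suc k choose i) * (\<Sum>t<n. of_nat t ^ i)) =
        (\<Sum>i<k. of_nat (Suc k choose i) * poly (q i) (of_nat n))"
      by (intro sum.cong) (auto simp: q)
    finally have "of_nat (Suc k) * (\<Sum>t<n. of_nat t ^ k) =
        (of_nat n :: rat) ^ Suc k - (\<Sum>i<k. of_nat (Suc k choose i) * poly (q i) (of_nat n))"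
      by simp
    then show ?thesis
      by (simp add: poly_sum poly_monom eq_divide_eq mult.commute del: of_nat_Suc)
  qed
  then show ?case by blast
qed

lemma sum_poly_poly:
  fixes p :: "rat poly"
  shows "\<exists>q. \<forall>n. (\<Sum>t<n. poly p (of_nat t)) = poly q (of_nat n)"
proof -
  obtain s :: "nat \<Rightarrow> rat poly" where s: "\<And>k n. (\<Sum>t<n. of_nat t ^ k) = poly (s k) (of_nat n)"
    using sum_powers_poly by metis
  have "(\<Sum>t<n. poly p (of_nat t)) = poly (\<Sum>i\<le>degree p. smult (coeff p i) (s i)) (of_nat n)" for n
    unfolding poly_altdef[of p] by (subst sum.swap) (simp add: poly_sum s flip: sum_distrib_left)
  then show ?thesis by blast
qed

text \<open>The number of \<open>t\<close> with \<open>t M + r < n\<close> is \<open>\<lfloor>(n + M - 1 - r) / M\<rfloor>\<close>; the summands are polynomial in \<open>t\<close>.\<close>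

lemma sum_residue_class_poly:
  assumes "r < M"
  obtains q :: "rat poly" where
    "\<And>n. (\<Sum>k<n. of_nat k ^ j * of_bool (k mod M = r)) = poly q (of_nat ((n + (M - 1 - r)) div M))"
proof -
  obtain q :: "rat poly" where
    q: "\<And>n. (\<Sum>t<n. poly ([:of_nat r, of_nat M:] ^ j) (of_nat t)) = poly q (of_nat n)"
    using sum_poly_poly by metis
  have "(\<Sum>k<n. of_nat k ^ j * of_bool (k mod M = r)) = poly q (of_nat ((n + (M - 1 - r)) div M))" for n
  proof -
    let ?T = "(n + (M - 1 - r)) div M"
    have T: "t < ?T \<longleftrightarrow> t * M + r < n" for t
    proof -
      have "t < ?T \<longleftrightarrow> Suc t * M \<le> n + (M - 1 - r)"
        using assms less_eq_div_iff_mult_less_eq[of M "Suc t" "n + (M - 1 - r)"]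
        by (simp only: Suc_le_eq)
      then show ?thesis using assms by auto
    qed
    have *: "{k\<in>{..<n}. k mod M = r} = (\<lambda>t. t * M + r) ` {..<?T}"
    proof (intro equalityI subsetI)
      fix k assume k: "k \<in> {k\<in>{..<n}. k mod M = r}"
      then have "k div M * M + r = k" using div_mult_mod_eq[of k M] by simp
      with k T[of "k div M"] show "k \<in> (\<lambda>t. t * M + r) ` {..<?T}"
        by (intro image_eqI[of _ _ "k div M"]) auto
    next
      fix k assume "k \<in> (\<lambda>t. t * M + r) ` {..<?T}"
      then obtain t where "k = t * M + r" "t < ?T" by blast
      then show "k \<in> {k\<in>{..<n}. k mod M = r}"
        using assms T[of t] by simp
    qed
    have "(\<Sum>k<n. of_nat k ^ j * of_bool (k mod M = r)) =
        (\<Sum>k\<in>{k\<in>{..<n}. k mod M = r}. (of_nat k :: rat) ^ j)"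
      by (rule sum.mono_neutral_cong_right) auto
    also have "\<dots> = (\<Sum>t<?T. of_nat (t * M + r) ^ j)"
      unfolding * using assms by (subst sum.reindex) (simp_all add: inj_on_def)
    also have "\<dots> = poly q (of_nat ?T)"
      by (simp add: algebra_simps flip: q)
    finally show ?thesis .
  qed
  then show ?thesis using that by blast
qed

text \<open>The variable \<open>v\<close> serves both as summation variable and, in the result, as upper limit, so that no
  fresh variable is needed and the limit can be changed by substitution.\<close>

definition sum_upto :: "'v \<Rightarrow> (('v \<Rightarrow> nat) \<Rightarrow> rat) \<Rightarrow> ('v \<Rightarrow> nat) \<Rightarrow> rat" where
  "sum_upto v f e = (\<Sum>k<e v. f (e(v := k)))"

text \<open>A presentation of the constructible functions tailored to summation over \<open>v\<close>: half-space conditions,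
  which shift the limits of summation, are imposed last, on sums of monomials in \<open>v\<close> over residue
  classes with coefficients independent of \<open>v\<close>.\<close>

inductive summable_form :: "'v \<Rightarrow> (('v \<Rightarrow> nat) \<Rightarrow> rat) \<Rightarrow> bool" for v where
  summable_base: "M > 0 \<Longrightarrow> summable_form v (\<lambda>e. of_nat (e v) ^ j * of_bool (e v mod M = r))"
| summable_indep: "constructible h \<Longrightarrow> (\<And>e x. h (e(v := x)) = h e) \<Longrightarrow> summable_form v g \<Longrightarrow>
    summable_form v (\<lambda>e. h e * g e)"
| summable_nonneg: "l \<in> linear_forms \<Longrightarrow> summable_form v g \<Longrightarrow>
    summable_form v (\<lambda>e. of_bool (0 \<le> l e) * g e)"
| summable_add: "summable_form v f \<Longrightarrow> summable_form v g \<Longrightarrow> summable_form v (\<lambda>e. f e + g e)"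

lemma summable_scale: "summable_form v g \<Longrightarrow> summable_form v (\<lambda>e. c * g e)"
  by (rule summable_indep[OF constructible_const]) simp_all

lemma summable_zero: "summable_form v (\<lambda>e. 0)"
  using summable_scale[OF summable_base[of 1 v 0 0], of 0] by simp

lemma summable_sum:
  "(\<And>i. i \<in> I \<Longrightarrow> summable_form v (g i)) \<Longrightarrow> summable_form v (\<lambda>e. \<Sum>i\<in>I. g i e)"
  by (induction I rule: infinite_finite_induct) (auto intro: summable_zero summable_add)

lemma summable_mult_var: "summable_form v g \<Longrightarrow> summable_form v (\<lambda>e. of_nat (e v) * g e)"
proof (induction rule: summable_form.induct)
  case (summable_base M j r)
  then show ?case using summable_form.summable_base[of M v "Suc j" r] by (simp add: ac_simps)
next
  case (summable_indep h g)
  then show ?case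
    using summable_form.summable_indep[OF summable_indep(1,2,4)] by (simp add: mult.left_commute)
next
  case (summable_nonneg l g)
  then show ?case
    using summable_form.summable_nonneg[OF summable_nonneg(1,3)] by (simp add: mult.left_commute)
next
  case (summable_add f g)
  then show ?case
    using summable_form.summable_add[OF summable_add(3,4)] by (simp add: distrib_left)
qed

lemma linear_decompose_at:
  assumes "l \<in> linear_forms"
  obtains l0 b where "l0 \<in> linear_forms" "\<And>e. l e = l0 e + b * int (e v)"
    "\<And>e x. l0 (e(v := x)) = l0 e"
  using linear_decompose[OF assms, of v] by (metis fun_upd_triv)

lemma summable_mult_linear:
  assumes "l \<in> linear_forms" "summable_form v g"
  shows "summable_form v (\<lambda>e. of_int (l e) * g e)"
proof -
  obtain l0 b where l0: "l0 \<in> linear_forms" "\<And>e. l e = l0 e + b * int (e v)"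
    "\<And>e x. l0 (e(v := x)) = l0 e"
    using linear_decompose_at[OF assms(1)] by metis
  have "summable_form v (\<lambda>e. of_int (l0 e) * g e + of_int b * (of_nat (e v) * g e))"
    by (intro summable_add summable_scale summable_mult_var summable_indep
        constructible_linear assms l0(1)) (simp add: l0(3))
  then show ?thesis by (simp add: l0(2) algebra_simps)
qed

text \<open>Only the base case requires work: on the residue classes of \<open>v\<close> modulo \<open>M m\<close>, the condition \<open>m dvd l\<close>
  no longer depends on \<open>v\<close>.\<close>

lemma summable_mult_dvd:
  assumes "summable_form v g" "l \<in> linear_forms" "m > 0"
  shows "summable_form v (\<lambda>e. of_bool (m dvd l e) * g e)"
  using assms(1)
proof induction
  case (summable_base M j r)
  obtain l0 b where l0: "l0 \<in> linear_forms" "\<And>e. l e = l0 e + b * int (e v)"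
    "\<And>e x. l0 (e(v := x)) = l0 e"
    using linear_decompose_at[OF assms(2)] by metis
  \<comment> \<open>The residue of the variable modulo \<open>N\<close> determines both its residue modulo \<open>M\<close> and \<open>b v\<close> modulo \<open>m\<close>.\<close>
  define N where "N = M * nat m"
  have N: "N > 0" using summable_base assms(3) by (simp add: N_def)
  have cong: "of_bool (m dvd l e) * (of_nat (e v) ^ j * of_bool (e v mod M = r)) =
      (\<Sum>s<N. of_bool (m dvd l0 e + b * int s) *
        (of_bool (s mod M = r) * (of_nat (e v) ^ j * of_bool (e v mod N = s) :: rat)))" for e
  proof -
    have "(\<Sum>s<N. of_bool (m dvd l0 e + b * int s) *
          (of_bool (s mod M = r) * (of_nat (e v) ^ j * of_bool (e v mod N = s) :: rat))) =
        (\<Sum>s<N. if s = e v mod N then of_bool (m dvd l0 e + b * int s) *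
          (of_bool (s mod M = r) * of_nat (e v) ^ j) else 0)"
      by (intro sum.cong) auto
    also have "\<dots> = of_bool (m dvd l0 e + b * int (e v mod N)) *
          (of_bool (e v mod N mod M = r) * of_nat (e v) ^ j)"
      using N by (subst sum.delta) auto
    also have "e v mod N mod M = e v mod M"
      by (simp add: N_def mod_mod_cancel)
    also have "m dvd l0 e + b * int (e v mod N) \<longleftrightarrow> m dvd l e"
    proof -
      have "m dvd int N" using assms(3) by (simp add: N_def)
      then have "m dvd int (e v) - int (e v mod N)"
        by (metis dvd_trans minus_mod_eq_mult_div dvd_triv_left of_nat_mod)
      then have "m dvd b * (int (e v) - int (e v mod N))" by simp
      moreover have "l e = l0 e + b * int (e v mod N) + b * (int (e v) - int (e v mod N))"
        by (simp add: l0(2) algebra_simps)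
      ultimately show ?thesis by (metis dvd_add_left_iff)
    qed
    finally show ?thesis by (simp only: ac_simps)
  qed
  have "summable_form v (\<lambda>e. \<Sum>s<N. of_bool (m dvd l0 e + b * int s) *
        (of_bool (s mod M = r) * (of_nat (e v) ^ j * of_bool (e v mod N = s) :: rat)))"
    using N by (intro summable_sum summable_indep summable_scale summable_form.summable_base
      constructible_of_bool definable_dvd linear_add linear_const l0 assms)
      (simp_all add: l0(3))
  then show ?case by (simp only: cong)
next
  case (summable_indep h g)
  then show ?case
    using summable_form.summable_indep[OF summable_indep(1,2,4)] by (simp add: mult.left_commute)
next
  case (summable_nonneg l g)
  then show ?case
    using summable_form.summable_nonneg[OF summable_nonneg(1,3)] by (simp add: mult.left_commute)
next
  case (summable_add f g)
  then show ?case
    using summable_form.summable_add[OF summable_add(3,4)] by (simp add: distrib_left)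
qed

lemma summable_mult_definable:
  "definable P \<Longrightarrow> summable_form v g \<Longrightarrow> summable_form v (\<lambda>e. of_bool (P e) * g e)"
proof (induction arbitrary: g rule: definable.induct)
  case (definable_nonneg l)
  then show ?case by (rule summable_nonneg)
next
  case (definable_dvd l m)
  then show ?case by (intro summable_mult_dvd)
next
  case (definable_not P)
  then have "summable_form v (\<lambda>e. g e + (- 1) * (of_bool (P e) * g e))"
    by (intro summable_add summable_scale) auto
  then show ?case by (simp add: of_bool_not_iff algebra_simps)
next
  case (definable_conj P Q)
  then have "summable_form v (\<lambda>e. of_bool (P e) * (of_bool (Q e) * g e))"
    by blast
  then show ?case by (simp add: of_bool_conj mult.assoc)
qed

text \<open>The summable forms are a module over the constructible functions; since they contain 1, all
  constructible functions are summable forms.\<close>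

lemma summable_mult_constructible:
  "constructible f \<Longrightarrow> summable_form v g \<Longrightarrow> summable_form v (\<lambda>e. f e * g e)"
proof (induction arbitrary: g rule: constructible.induct)
  case (constructible_add f f')
  then have "summable_form v (\<lambda>e. f e * g e + f' e * g e)"
    by (intro summable_add) auto
  then show ?case by (simp add: distrib_right)
next
  case (constructible_mult f f')
  then have "summable_form v (\<lambda>e. f e * (f' e * g e))"
    by blast
  then show ?case by (simp add: mult.assoc)
qed (auto intro: summable_scale summable_mult_linear summable_mult_definable)

lemma admissible_update_min:
  assumes "l \<in> linear_forms" "m > 0"
  shows "admissible (\<lambda>e. e(v := min (e v) (nat (l e div m))))"
proof -
  have "(\<lambda>e. e(v := min (e v) (nat (l e div m)))) =
      (\<lambda>e. if e v = 0 \<or> m * int (e v) \<le> l e then e(v := e v) else e(v := nat (l e div m)))"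
  proof
    fix e
    have "e v \<le> nat (l e div m) \<longleftrightarrow> e v = 0 \<or> m * int (e v) \<le> l e"
      using int_le_div_iff[OF assms(2), of "int (e v)" "l e"] by (auto simp: mult.commute le_nat_iff)
    then show "e(v := min (e v) (nat (l e div m))) =
      (if e v = 0 \<or> m * int (e v) \<le> l e then e(v := e v) else e(v := nat (l e div m)))"
      by (auto simp: min_def simp del: fun_upd_triv)
  qed
  then have "(\<lambda>e. e(v := min (e v) (nat (l e div m)))) =
      (\<lambda>e. if e v = 0 \<or> m * int (e v) \<le> l e then e else e(v := nat (l e div m)))"
    by (simp only: fun_upd_triv)
  moreover have "admissible (\<lambda>e. if e v = 0 \<or> m * int (e v) \<le> l e then e else e(v := nat (l e div m)))"
  proof (intro admissible_If admissible_update_div assms definable_disj definable_le linear_intros)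
    show "definable (\<lambda>e. e v = 0)"
      using definable_eq[OF linear_var[of v] linear_const[of 0]] by simp
    show "admissible (\<lambda>e. e)"
      by (rule admissible_linear) (rule linear_var)
  qed
  ultimately show ?thesis by (simp only:)
qed

text \<open>The condition \<open>0 \<le> l0 + b k\<close> on the summation variable \<open>k\<close> says that \<open>k\<close> is below (for \<open>b < 0\<close>) or not
  below (for \<open>b > 0\<close>) the floor of a rational linear form. Its effect on partial sums is therefore a
  substitution for the upper limit, followed in the second case by a subtraction.\<close>

lemma sum_upto_constructible:
  assumes "constructible f"
  shows "constructible (sum_upto v f)"
proof -
  have "summable_form v f"
    using summable_mult_constructible[OF assms summable_base[of 1 v 0 0]] by simp
  then show ?thesis
  proof induction
    case (summable_base M j r)
    show ?case
    proof (cases "r < M")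
      case True
      then obtain q :: "rat poly" where q: "\<And>n. (\<Sum>k<n. of_nat k ^ j * of_bool (k mod M = r)) =
          poly q (of_nat ((n + (M - 1 - r)) div M))"
        by (rule sum_residue_class_poly[where j = j]) blast
      have "admissible (\<lambda>e. e(v := nat ((int (e v) + int (M - 1 - r)) div int M)))"
        using summable_base by (intro admissible_update_div linear_intros) auto
      from constructible_subst[OF constructible_linear[OF linear_var[of v]] this]
      have "constructible (\<lambda>e. of_nat ((e v + (M - 1 - r)) div M))"
        by (simp flip: of_nat_add zdiv_int)
      from constructible_poly[OF this] show ?thesis
        by (simp add: sum_upto_def[abs_def] q)
    next
      case False
      then have "k mod M \<noteq> r" for k
        using summable_base by (metis mod_less_divisor)
      then show ?thesis by (simp add: sum_upto_def[abs_def] constructible_const)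
    qed
  next
    case (summable_indep h g)
    have "sum_upto v (\<lambda>e. h e * g e) = (\<lambda>e. h e * sum_upto v g e)"
      by (simp add: fun_eq_iff sum_upto_def summable_indep(2) sum_distrib_left)
    then show ?case using constructible_mult summable_indep by metis
  next
    case (summable_add f g)
    have "sum_upto v (\<lambda>e. f e + g e) = (\<lambda>e. sum_upto v f e + sum_upto v g e)"
      by (simp add: fun_eq_iff sum_upto_def sum.distrib)
    then show ?case using constructible_add summable_add by metis
  next
    case (summable_nonneg l g)
    then obtain l0 b where l0: "l0 \<in> linear_forms" "\<And>e x. l (e(v := x)) = l0 e + b * int x"
      "\<And>e x. l0 (e(v := x)) = l0 e"
      using linear_decompose[OF summable_nonneg(1), of v] by metis
    have cut: "constructible (\<lambda>e. sum_upto v g (e(v := min (e v) (nat (k e div m)))))"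
      if "k \<in> linear_forms" "m > 0" for k m
      by (rule constructible_subst[OF summable_nonneg(3) admissible_update_min[OF that]])
    have restrict: "(\<Sum>k<n. of_bool (k < t) * g (e(v := k))) = (\<Sum>k<min n t. g (e(v := k)))" for n t e
    proof -
      have "{k\<in>{..<n}. k < t} = {..<min n t}" by auto
      then show ?thesis
        by (simp add: of_bool_def if_distrib[of "\<lambda>x. x * _"] flip: sum.inter_filter cong: if_cong)
    qed
    consider "b = 0" | "b > 0" | "b < 0" by linarith
    then show ?case
    proof cases
      case 1
      then have "sum_upto v (\<lambda>e. of_bool (0 \<le> l e) * g e) = (\<lambda>e. of_bool (0 \<le> l0 e) * sum_upto v g e)"
        by (simp add: fun_eq_iff sum_upto_def l0 sum_distrib_left del: fun_upd_apply)
      then show ?thesis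
        using constructible_mult[OF constructible_of_bool[OF definable_nonneg[OF l0(1)]] summable_nonneg(3)]
        by (simp only:)
    next
      case 2
      have "of_bool (0 \<le> l (e(v := k))) = 1 - (of_bool (k < nat ((b - 1 - l0 e) div b)) :: rat)" for e k
      proof -
        have "(b - 1 - l0 e) div b = (- l0 e - 1) div b + 1"
          using 2 div_add_self2[of b "- l0 e - 1"] by (simp add: algebra_simps)
        then show ?thesis
          using linear_nonneg_threshold(1)[OF 2, of "l0 e" "int k"] by (auto simp: l0(2))
      qed
      then have "sum_upto v (\<lambda>e. of_bool (0 \<le> l e) * g e) =
          (\<lambda>e. sum_upto v g e - sum_upto v g (e(v := min (e v) (nat ((b - 1 - l0 e) div b)))))"
        by (simp add: fun_eq_iff sum_upto_def left_diff_distrib sum_subtractf restrict)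
      then show ?thesis
        using constructible_diff[OF summable_nonneg(3) cut] 2 l0(1) by (simp add: linear_intros)
    next
      case 3
      have "of_bool (0 \<le> l (e(v := k))) = (of_bool (k < nat ((l0 e - b) div (- b))) :: rat)" for e k
      proof -
        have "(l0 e - b) div (- b) = l0 e div (- b) + 1"
          using 3 div_add_self2[of "- b" "l0 e"] by (simp add: algebra_simps)
        then show ?thesis
          using linear_nonneg_threshold(2)[OF 3, of "l0 e" "int k"] by (auto simp: l0(2))
      qed
      then have "sum_upto v (\<lambda>e. of_bool (0 \<le> l e) * g e) =
          (\<lambda>e. sum_upto v g (e(v := min (e v) (nat ((l0 e - b) div (- b))))))"
        by (simp add: fun_eq_iff sum_upto_def restrict)
      then show ?thesis
        using cut[of "\<lambda>e. l0 e - b" "- b"] 3 l0(1) by (simp add: linear_intros)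
    qed
  qed
qed

section \<open>Sums with finite support\<close>

lemma linear_abs_bound:
  assumes "l \<in> linear_forms"
  shows "\<exists>l'\<in>linear_forms. \<forall>e. \<bar>l e\<bar> \<le> l' e"
  using assms
proof induction
  case (linear_const c)
  then show ?case by (intro bexI[of _ "\<lambda>e. \<bar>c\<bar>"]) (auto intro: linear_intros)
next
  case (linear_var w)
  then show ?case by (intro bexI[of _ "\<lambda>e. int (e w)"]) (auto intro: linear_intros)
next
  case (linear_add l k)
  then obtain l' k' where *: "l' \<in> linear_forms" "k' \<in> linear_forms"
    "\<And>e. \<bar>l e\<bar> \<le> l' e" "\<And>e. \<bar>k e\<bar> \<le> k' e"
    by blast
  have "\<bar>l e + k e\<bar> \<le> l' e + k' e" for e
    using *(3,4)[of e] by linarith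
  then show ?case using * by (intro bexI[of _ "\<lambda>e. l' e + k' e"]) (auto intro: linear_intros)
next
  case (linear_scale l c)
  then obtain l' where *: "l' \<in> linear_forms" "\<And>e. \<bar>l e\<bar> \<le> l' e"
    by blast
  have "\<bar>c * l e\<bar> \<le> \<bar>c\<bar> * l' e" for e
    by (simp add: abs_mult mult_left_mono *)
  then show ?case using * by (intro bexI[of _ "\<lambda>e. \<bar>c\<bar> * l' e"]) (auto intro: linear_intros)
qed

text \<open>For large values of \<open>v\<close> the sign of \<open>l0 + b v\<close> is the sign of \<open>b\<close>, or of \<open>l0\<close> if \<open>b = 0\<close>, so only
  congruence conditions on \<open>v\<close> remain.\<close>

lemma definable_tail:
  assumes "definable P"
  obtains N M where "N \<in> linear_forms" "M > 0" "\<And>e. 0 \<le> N e"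
    "\<And>e k k'. N e \<le> int k \<Longrightarrow> N e \<le> int k' \<Longrightarrow> k mod M = k' mod M \<Longrightarrow>
       P (e(v := k)) = P (e(v := k'))"
proof -
  have "\<exists>N\<in>linear_forms. \<exists>M>0. (\<forall>e. 0 \<le> N e) \<and> (\<forall>e k k'. N e \<le> int k \<longrightarrow> N e \<le> int k' \<longrightarrow>
      k mod M = k' mod M \<longrightarrow> P (e(v := k)) = P (e(v := k')))"
    using assms
  proof induction
    case (definable_nonneg l)
    then obtain l0 b where l0: "l0 \<in> linear_forms" "\<And>e x. l (e(v := x)) = l0 e + b * int x"
      using linear_decompose[OF definable_nonneg, of v] by metis
    obtain l' where l': "l' \<in> linear_forms" "\<And>e. \<bar>l0 e\<bar> \<le> l' e"
      using linear_abs_bound[OF l0(1)] by blast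
    have sign: "0 \<le> l (e(v := k)) \<longleftrightarrow> (if b = 0 then 0 \<le> l0 e else 0 < b)"
      if "l' e + 1 \<le> int k" for e k
    proof -
      have k: "\<bar>l0 e\<bar> < int k" using that l'(2)[of e] by linarith
      consider "b = 0" | "b > 0" | "b < 0" by linarith
      then show ?thesis
      proof cases
        case 2
        then have "int k * 1 \<le> int k * b" by (intro mult_left_mono) auto
        with 2 k show ?thesis by (simp add: l0 mult.commute del: fun_upd_apply)
      next
        case 3
        then have "int k * b \<le> int k * (- 1)" by (intro mult_left_mono) auto
        with 3 k show ?thesis by (simp add: l0 mult.commute del: fun_upd_apply)
      qed (simp add: l0 del: fun_upd_apply)
    qed
    have "0 \<le> l' e + 1" for e
      using l'(2)[of e] by linarith
    then show ?case
      using sign l' by (intro bexI[of _ "\<lambda>e. l' e + 1"] exI[of _ 1])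
        (auto intro: linear_intros simp del: fun_upd_apply)
  next
    case (definable_dvd l m)
    then obtain l0 b where l0: "l0 \<in> linear_forms" "\<And>e x. l (e(v := x)) = l0 e + b * int x"
      using linear_decompose[OF definable_dvd(1), of v] by metis
    have "m dvd l (e(v := k)) \<longleftrightarrow> m dvd l (e(v := k'))" if "k mod nat m = k' mod nat m" for e k k'
    proof -
      have "int k mod m = int k' mod m"
        using arg_cong[OF that, of int] definable_dvd(2) by (simp add: zmod_int)
      then have "m dvd b * (int k - int k')"
        by (simp add: mod_eq_dvd_iff)
      moreover have "l (e(v := k)) = l (e(v := k')) + b * (int k - int k')"
        by (simp add: l0 algebra_simps del: fun_upd_apply)
      ultimately show ?thesis by (metis dvd_add_left_iff)
    qed
    then show ?case
      using definable_dvd(2)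
      by (intro bexI[of _ "\<lambda>e. 0"] exI[of _ "nat m"] conjI allI impI linear_const) (blast | simp)+
  next
    case (definable_not P)
    then show ?case by (simp del: fun_upd_apply)
  next
    case (definable_conj P Q)
    from definable_conj.IH(1) obtain N M where
      P: "N \<in> linear_forms" "M > 0" "\<And>e. 0 \<le> N e"
        "\<And>e k k'. N e \<le> int k \<Longrightarrow> N e \<le> int k' \<Longrightarrow> k mod M = k' mod M \<Longrightarrow>
          P (e(v := k)) = P (e(v := k'))"
      by blast
    from definable_conj.IH(2) obtain N' M' where
      Q: "N' \<in> linear_forms" "M' > 0" "\<And>e. 0 \<le> N' e"
        "\<And>e k k'. N' e \<le> int k \<Longrightarrow> N' e \<le> int k' \<Longrightarrow> k mod M' = k' mod M' \<Longrightarrow>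
          Q (e(v := k)) = Q (e(v := k'))"
      by blast
    have "(P (e(v := k)) \<and> Q (e(v := k))) = (P (e(v := k')) \<and> Q (e(v := k')))"
      if "N e + N' e \<le> int k" "N e + N' e \<le> int k'" "k mod (M * M') = k' mod (M * M')" for e k k'
    proof -
      have "k mod M = k' mod M" "k mod M' = k' mod M'"
        using arg_cong[OF that(3), of "\<lambda>x. x mod M"] arg_cong[OF that(3), of "\<lambda>x. x mod M'"]
        by (simp_all add: mod_mod_cancel)
      then show ?thesis
        using P(4)[of e k k'] Q(4)[of e k k'] P(3)[of e] Q(3)[of e] that(1,2) by linarith
    qed
    then show ?case
      using P(1-3) Q(1-3) by (intro bexI[of _ "\<lambda>e. N e + N' e"] exI[of _ "M * M'"] conjI allI impI
        linear_forms.linear_add) (blast | simp)+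
  qed
  then show ?thesis using that by blast
qed

lemma constructible_tail:
  assumes "constructible f"
  obtains N M where "N \<in> linear_forms" "M > 0" "\<And>e. 0 \<le> N e"
    "\<And>e r. \<exists>q. \<forall>k. N e \<le> int k \<longrightarrow> k mod M = r \<longrightarrow> f (e(v := k)) = poly q (of_nat k)"
proof -
  have "\<exists>N\<in>linear_forms. \<exists>M>0. (\<forall>e. 0 \<le> N e) \<and> (\<forall>e r. \<exists>q. \<forall>k. N e \<le> int k \<longrightarrow>
      k mod M = r \<longrightarrow> f (e(v := k)) = poly q (of_nat k))"
    using assms
  proof induction
    case (constructible_const c)
    have "\<exists>q. \<forall>k. c = poly q (rat_of_nat k)"
      by (intro exI[of _ "[:c:]"]) simp
    then show ?case
      by (intro bexI[of _ "\<lambda>e. 0"] exI[of _ "1::nat"]) (auto intro: linear_intros)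
  next
    case (constructible_linear l)
    then obtain l0 b where l0: "l0 \<in> linear_forms" "\<And>e x. l (e(v := x)) = l0 e + b * int x"
      using linear_decompose[OF constructible_linear, of v] by metis
    have "\<exists>q. \<forall>k. of_int (l (e(v := k))) = poly q (rat_of_nat k)" for e
      by (intro exI[of _ "[:of_int (l0 e), of_int b:]"]) (simp add: l0 mult.commute del: fun_upd_apply)
    then show ?case
      by (intro bexI[of _ "\<lambda>e. 0"] exI[of _ "1::nat"]) (auto intro: linear_intros simp del: fun_upd_apply)
  next
    case (constructible_of_bool P)
    then obtain N M where
      P: "N \<in> linear_forms" "M > 0" "\<And>e. 0 \<le> N e"
        "\<And>e k k'. N e \<le> int k \<Longrightarrow> N e \<le> int k' \<Longrightarrow> k mod M = k' mod M \<Longrightarrow>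
          P (e(v := k)) = P (e(v := k'))"
      using definable_tail[of P v] by metis
    have "\<exists>q. \<forall>k. N e \<le> int k \<longrightarrow> k mod M = r \<longrightarrow> of_bool (P (e(v := k))) = poly q (rat_of_nat k)" for e r
    proof (intro exI allI impI)
      fix k assume k: "N e \<le> int k" "k mod M = r"
      let ?E = "\<exists>k'. N e \<le> int k' \<and> k' mod M = r \<and> P (e(v := k'))"
      have "P (e(v := k)) \<longleftrightarrow> ?E"
        using P(4) k by blast
      then show "of_bool (P (e(v := k))) = poly [:of_bool ?E:] (rat_of_nat k)"
        by (simp del: fun_upd_apply)
    qed
    then show ?case using P by blast
  next
    case (constructible_add f g)
    from constructible_add.IH(1) obtain N M where
      N: "N \<in> linear_forms" "M > 0" "\<And>e. 0 \<le> N e"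
        "\<And>e r. \<exists>q. \<forall>k. N e \<le> int k \<longrightarrow> k mod M = r \<longrightarrow> f (e(v := k)) = poly q (of_nat k)"
      by blast
    from constructible_add.IH(2) obtain N' M' where
      N': "N' \<in> linear_forms" "M' > 0" "\<And>e. 0 \<le> N' e"
        "\<And>e r. \<exists>q. \<forall>k. N' e \<le> int k \<longrightarrow> k mod M' = r \<longrightarrow> g (e(v := k)) = poly q (of_nat k)"
      by blast
    have "\<exists>q. \<forall>k. N e + N' e \<le> int k \<longrightarrow> k mod (M * M') = r \<longrightarrow>
        f (e(v := k)) + g (e(v := k)) = poly q (of_nat k)" for e r
    proof -
      obtain q q' where q: "\<And>k. N e \<le> int k \<Longrightarrow> k mod M = r mod M \<Longrightarrow> f (e(v := k)) = poly q (of_nat k)"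
        "\<And>k. N' e \<le> int k \<Longrightarrow> k mod M' = r mod M' \<Longrightarrow> g (e(v := k)) = poly q' (of_nat k)"
        using N(4) N'(4) by metis
      show ?thesis
      proof (intro exI[of _ "q + q'"] allI impI)
        fix k assume k: "N e + N' e \<le> int k" "k mod (M * M') = r"
        have "k mod M = r mod M" "k mod M' = r mod M'"
          unfolding k(2)[symmetric] by (simp_all add: mod_mod_cancel)
        then show "f (e(v := k)) + g (e(v := k)) = poly (q + q') (of_nat k)"
          using q k(1) N(3)[of e] N'(3)[of e] by (simp del: fun_upd_apply)
      qed
    qed
    then show ?case
      using N(1-3) N'(1-3) by (intro bexI[of _ "\<lambda>e. N e + N' e"] exI[of _ "M * M'"] conjI allI
        linear_forms.linear_add) (blast | simp)+
  next
    case (constructible_mult f g)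
    from constructible_mult.IH(1) obtain N M where
      N: "N \<in> linear_forms" "M > 0" "\<And>e. 0 \<le> N e"
        "\<And>e r. \<exists>q. \<forall>k. N e \<le> int k \<longrightarrow> k mod M = r \<longrightarrow> f (e(v := k)) = poly q (of_nat k)"
      by blast
    from constructible_mult.IH(2) obtain N' M' where
      N': "N' \<in> linear_forms" "M' > 0" "\<And>e. 0 \<le> N' e"
        "\<And>e r. \<exists>q. \<forall>k. N' e \<le> int k \<longrightarrow> k mod M' = r \<longrightarrow> g (e(v := k)) = poly q (of_nat k)"
      by blast
    have "\<exists>q. \<forall>k. N e + N' e \<le> int k \<longrightarrow> k mod (M * M') = r \<longrightarrow>
        f (e(v := k)) * g (e(v := k)) = poly q (of_nat k)" for e r
    proof -
      obtain q q' where q: "\<And>k. N e \<le> int k \<Longrightarrow> k mod M = r mod M \<Longrightarrow> f (e(v := k)) = poly q (of_nat k)"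
        "\<And>k. N' e \<le> int k \<Longrightarrow> k mod M' = r mod M' \<Longrightarrow> g (e(v := k)) = poly q' (of_nat k)"
        using N(4) N'(4) by metis
      show ?thesis
      proof (intro exI[of _ "q * q'"] allI impI)
        fix k assume k: "N e + N' e \<le> int k" "k mod (M * M') = r"
        have "k mod M = r mod M" "k mod M' = r mod M'"
          unfolding k(2)[symmetric] by (simp_all add: mod_mod_cancel)
        then show "f (e(v := k)) * g (e(v := k)) = poly (q * q') (of_nat k)"
          using q k(1) N(3)[of e] N'(3)[of e] by (simp del: fun_upd_apply)
      qed
    qed
    then show ?case
      using N(1-3) N'(1-3) by (intro bexI[of _ "\<lambda>e. N e + N' e"] exI[of _ "M * M'"] conjI allI
        linear_forms.linear_add) (blast | simp)+
  qed
  then show ?thesis using that by blast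
qed

text \<open>Beyond the bound \<open>N\<close> the function is a polynomial on each residue class. It has infinitely many
  zeros there, so it vanishes, and the sum is a partial sum with upper limit \<open>N\<close>.\<close>

lemma constructible_Sum_any:
  assumes f: "constructible f" and fin: "\<And>e. finite {k. f (e(v := k)) \<noteq> 0}"
  shows "constructible (\<lambda>e. Sum_any (\<lambda>k. f (e(v := k))))"
proof -
  obtain N M where N: "N \<in> linear_forms" "M > 0" "\<And>e. 0 \<le> N e" and
    q: "\<And>e r. \<exists>q. \<forall>k. N e \<le> int k \<longrightarrow> k mod M = r \<longrightarrow> f (e(v := k)) = poly q (of_nat k)"
    using constructible_tail[OF f, of v] by metis
  have zero: "f (e(v := k)) = 0" if k: "N e \<le> int k" for e k
  proof -
    obtain q where q: "\<And>k'. N e \<le> int k' \<Longrightarrow> k' mod M = k mod M \<Longrightarrow> f (e(v := k')) = poly q (of_nat k')"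
      using q by blast
    have *: "f (e(v := k + i * M)) = poly q (of_nat (k + i * M))" for i
      using k by (intro q) (auto intro: add_increasing2)
    have inj: "inj (\<lambda>i. k + i * M)"
      using N(2) by (intro injI) simp
    have "finite {i. f (e(v := k + i * M)) \<noteq> 0}"
      using finite_vimageI[OF fin[of e] inj] by (simp add: vimage_def)
    then have "infinite {i. f (e(v := k + i * M)) = 0}"
      using finite_Collect_not infinite_UNIV_nat by auto
    moreover have "inj_on (\<lambda>i. rat_of_nat (k + i * M)) {i. f (e(v := k + i * M)) = 0}"
      using N(2) by (intro inj_onI) simp
    ultimately have "infinite ((\<lambda>i. rat_of_nat (k + i * M)) ` {i. f (e(v := k + i * M)) = 0})"
      by (simp add: finite_image_iff)
    moreover have "(\<lambda>i. rat_of_nat (k + i * M)) ` {i. f (e(v := k + i * M)) = 0} \<subseteq> {x. poly q x = 0}"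
      using * by auto
    ultimately have "infinite {x. poly q x = 0}"
      using finite_subset by blast
    then have "q = 0" using poly_roots_finite by blast
    with *[of 0] show ?thesis by simp
  qed
  have "Sum_any (\<lambda>k. f (e(v := k))) = sum_upto v f (e(v := nat (N e div 1)))" for e
  proof -
    have "{k. f (e(v := k)) \<noteq> 0} \<subseteq> {..<nat (N e)}"
      using zero[of e] by (auto simp: not_le[symmetric] le_nat_iff)
    then have "Sum_any (\<lambda>k. f (e(v := k))) = (\<Sum>k<nat (N e). f (e(v := k)))"
      by (intro Sum_any.expand_superset) auto
    then show ?thesis by (simp add: sum_upto_def)
  qed
  then show ?thesis
    using constructible_subst[OF sum_upto_constructible[OF f] admissible_update_div[OF N(1), of 1 v]]
    by simp
qed

section \<open>Multiplication by monomials and geometric series\<close>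

text \<open>Multiplication of power series by \<open>x\<^sup>b\<close>, by \<open>1 / (1 - x\<^sup>b)\<close> and by \<open>1 - x\<^sup>b\<close>. Identities between products
  of geometric series are verified by cancelling factors \<open>1 - x\<^sup>b\<close>, see \<open>diff_mult_eqD\<close>.\<close>

definition monom_mult :: "nat ^ 'n::finite \<Rightarrow> (rat, 'n) mfps \<Rightarrow> (rat, 'n) mfps" where
  "monom_mult b f = (\<lambda>p. if b \<le> p then f (p - b) else 0)"

definition geom_mult :: "nat ^ 'n::finite \<Rightarrow> (rat, 'n) mfps \<Rightarrow> (rat, 'n) mfps" where
  "geom_mult b = mfps_mult (geom_series b)"

definition diff_mult :: "nat ^ 'n::finite \<Rightarrow> (rat, 'n) mfps \<Rightarrow> (rat, 'n) mfps" where
  "diff_mult b f = (\<lambda>p. f p - monom_mult b f p)"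

lemma vec_le_iff: "(a :: nat ^ 'n) \<le> p \<longleftrightarrow> (\<forall>i. a $ i \<le> p $ i)"
  by (simp add: less_eq_vec_def)

lemma vec_diff_simps:
  fixes a b p :: "nat ^ 'n"
  shows "a + b \<le> p \<longleftrightarrow> a \<le> p \<and> b \<le> p - a" "p - a - b = p - (a + b)" "a \<le> a + b" "a + b - a = b"
    "a \<le> p \<Longrightarrow> a + (p - a) = p" "0 \<le> p"
  by (auto simp: vec_le_iff vec_eq_iff) (metis add_leD1 | metis add.commute le_diff_conv2 add_leD1 | force)+

lemma geom_mult_eq_sum:
  assumes "b \<noteq> 0"
  shows "geom_mult b f p = (\<Sum>k | k *s b \<le> p. f (p - k *s b))"
proof -
  obtain i where i: "b $ i \<noteq> 0" using assms by (auto simp: vec_eq_iff)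
  have inj: "inj_on (\<lambda>k. (k *s b, p - k *s b)) A" for A
    using i by (intro inj_onI) (auto simp: vec_eq_iff)
  have "geom_mult b f p = (\<Sum>(a, c) | a + c = p. geom_series b a * f c)"
    by (simp add: geom_mult_def mfps_mult_def)
  also have "\<dots> = (\<Sum>(a, c)\<in>(\<lambda>k. (k *s b, p - k *s b)) ` {k. k *s b \<le> p}. f c)"
  proof (rule sum.mono_neutral_cong_right)
    show "finite {(a, c). a + c = p}" by (rule finite_mfps_mult_index)
    show "(\<lambda>k. (k *s b, p - k *s b)) ` {k. k *s b \<le> p} \<subseteq> {(a, c). a + c = p}"
      by (auto simp: vec_diff_simps)
    show "\<forall>x\<in>{(a, c). a + c = p} - (\<lambda>k. (k *s b, p - k *s b)) ` {k. k *s b \<le> p}.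
        (case x of (a, c) \<Rightarrow> geom_series b a * f c) = 0"
    proof
      fix x assume x: "x \<in> {(a, c). a + c = p} - (\<lambda>k. (k *s b, p - k *s b)) ` {k. k *s b \<le> p}"
      obtain a c where ac: "x = (a, c)" by force
      have "a \<noteq> k *s b" for k
      proof
        assume "a = k *s b"
        with x ac have "x = (k *s b, p - k *s b)" "k *s b \<le> p"
          by (auto simp: vec_diff_simps)
        with x show False by blast
      qed
      then show "(case x of (a, c) \<Rightarrow> geom_series b a * f c) = 0"
        by (simp add: ac geom_series_def)
    qed
  qed (auto simp: geom_series_def)
  also have "\<dots> = (\<Sum>k | k *s b \<le> p. f (p - k *s b))"
    by (subst sum.reindex[OF inj]) simp
  finally show ?thesis .
qed

lemma finite_multiples_le:
  fixes b p :: "nat ^ 'n"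
  assumes "b \<noteq> 0"
  shows "finite {k. k *s b \<le> p}"
proof -
  obtain i where i: "b $ i \<noteq> 0" using assms by (auto simp: vec_eq_iff)
  have "k \<le> p $ i" if "k *s b \<le> p" for k
  proof -
    have "k * 1 \<le> k * b $ i" using i by (intro mult_le_mono) auto
    also have "\<dots> \<le> p $ i" using that by (simp add: vec_le_iff)
    finally show ?thesis by simp
  qed
  then have "{k. k *s b \<le> p} \<subseteq> {..p $ i}" by blast
  then show ?thesis by (rule finite_subset) (rule finite_atMost)
qed

lemma geom_mult_unfold:
  assumes "b \<noteq> 0"
  shows "geom_mult b f p = f p + monom_mult b (geom_mult b f) p"
proof (cases "b \<le> p")
  case True
  have Suc: "Suc k *s b = b + k *s b" for k
    by (simp add: vec_eq_iff)
  have "k *s b \<le> p \<longleftrightarrow> k = 0 \<or> (\<exists>j. k = Suc j \<and> j *s b \<le> p - b)" for k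
    using True by (cases k) (simp_all only: Suc vec_diff_simps(1), simp_all add: vec_diff_simps(6))
  then have "{k. k *s b \<le> p} = insert 0 (Suc ` {k. k *s b \<le> p - b})"
    by blast
  then have "geom_mult b f p = f p + (\<Sum>k\<in>Suc ` {k. k *s b \<le> p - b}. f (p - k *s b))"
    using finite_multiples_le[OF assms] by (simp add: geom_mult_eq_sum[OF assms])
  also have "(\<Sum>k\<in>Suc ` {k. k *s b \<le> p - b}. f (p - k *s b)) = geom_mult b f (p - b)"
    by (subst sum.reindex) (simp_all add: geom_mult_eq_sum[OF assms] Suc vec_diff_simps)
  finally show ?thesis using True by (simp add: monom_mult_def)
next
  case False
  have "k = 0" if "k *s b \<le> p" for k
  proof (rule ccontr)
    assume "k \<noteq> 0"
    then have "b \<le> k *s b" by (auto simp: vec_le_iff)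
    with that False show False by (meson order_trans)
  qed
  then have "{k. k *s b \<le> p} = {0}"
    by (auto simp: vec_diff_simps)
  with False show ?thesis
    by (simp add: geom_mult_eq_sum[OF assms] monom_mult_def)
qed

lemma monom_mult_linear:
  "monom_mult b (\<lambda>p. f p + g p) = (\<lambda>p. monom_mult b f p + monom_mult b g p)"
  "monom_mult b (\<lambda>p. f p - g p) = (\<lambda>p. monom_mult b f p - monom_mult b g p)"
  "monom_mult b (\<lambda>p. c * f p) = (\<lambda>p. c * monom_mult b f p)"
  "monom_mult b (\<lambda>p. \<Sum>i\<in>I. h i p) = (\<lambda>p. \<Sum>i\<in>I. monom_mult b (h i) p)"
  by (auto simp: monom_mult_def)

lemma monom_mult_monom_mult: "monom_mult a (monom_mult b f) = monom_mult (a + b) f"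
  by (auto simp: monom_mult_def vec_diff_simps fun_eq_iff)

lemma monom_mult_zero: "monom_mult 0 f = f"
  by (simp add: monom_mult_def vec_diff_simps)

lemma diff_mult_linear:
  "diff_mult b (\<lambda>p. f p + g p) = (\<lambda>p. diff_mult b f p + diff_mult b g p)"
  "diff_mult b (\<lambda>p. f p - g p) = (\<lambda>p. diff_mult b f p - diff_mult b g p)"
  "diff_mult b (\<lambda>p. c * f p) = (\<lambda>p. c * diff_mult b f p)"
  "diff_mult b (\<lambda>p. \<Sum>i\<in>I. h i p) = (\<lambda>p. \<Sum>i\<in>I. diff_mult b (h i) p)"
  by (auto simp: diff_mult_def monom_mult_linear algebra_simps sum_subtractf)

lemma diff_mult_geom_mult: "b \<noteq> 0 \<Longrightarrow> diff_mult b (geom_mult b f) = f"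
  using geom_mult_unfold[of b f] by (simp add: diff_mult_def fun_eq_iff)

text \<open>If \<open>(1 - x\<^sup>b) f = (1 - x\<^sup>b) g\<close>, the coefficients of \<open>f\<close> and \<open>g\<close> at \<open>p\<close> differ as much as those at
  \<open>p - b\<close>, whose total degree is smaller.\<close>

lemma diff_mult_eqD:
  assumes "b \<noteq> 0" "diff_mult b f = diff_mult b g"
  shows "f = g"
proof
  fix p show "f p = g p"
  proof (induction "\<Sum>i\<in>UNIV. p $ i" arbitrary: p rule: less_induct)
    case less
    have "monom_mult b f p = monom_mult b g p"
    proof (cases "b \<le> p")
      case True
      obtain i where "b $ i \<noteq> 0" using assms(1) by (auto simp: vec_eq_iff)
      with True have "(\<Sum>i\<in>UNIV. (p - b) $ i) < (\<Sum>i\<in>UNIV. p $ i)"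
        by (intro sum_strict_mono_ex1) (auto simp: vec_le_iff intro!: bexI[of _ i] diff_less
          dest!: spec[of _ i])
      with True less show ?thesis by (simp add: monom_mult_def)
    qed (simp add: monom_mult_def)
    then show ?case
      using fun_cong[OF assms(2), of p] by (simp add: diff_mult_def)
  qed
qed

lemma geom_mult_diff_mult: "b \<noteq> 0 \<Longrightarrow> geom_mult b (diff_mult b f) = f"
  by (rule diff_mult_eqD[of b]) (simp_all add: diff_mult_geom_mult)

lemma monom_mult_diff_mult: "monom_mult a (diff_mult b f) = diff_mult b (monom_mult a f)"
  unfolding diff_mult_def monom_mult_linear monom_mult_monom_mult by (simp add: add.commute)

lemma diff_mult_commute: "diff_mult a (diff_mult b f) = diff_mult b (diff_mult a f)"
  by (subst (1 3) diff_mult_def) (simp add: monom_mult_diff_mult diff_mult_linear diff_mult_def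
    monom_mult_linear monom_mult_monom_mult add.commute fun_eq_iff)

lemma geom_mult_linear:
  assumes "b \<noteq> 0"
  shows "geom_mult b (\<lambda>p. f p + g p) = (\<lambda>p. geom_mult b f p + geom_mult b g p)"
  "geom_mult b (\<lambda>p. f p - g p) = (\<lambda>p. geom_mult b f p - geom_mult b g p)"
  "geom_mult b (\<lambda>p. c * f p) = (\<lambda>p. c * geom_mult b f p)"
  "geom_mult b (\<lambda>p. \<Sum>i\<in>I. h i p) = (\<lambda>p. \<Sum>i\<in>I. geom_mult b (h i) p)"
  by (rule diff_mult_eqD[OF assms]; simp add: diff_mult_linear diff_mult_geom_mult assms)+

lemma monom_mult_geom_mult:
  "b \<noteq> 0 \<Longrightarrow> monom_mult a (geom_mult b f) = geom_mult b (monom_mult a f)"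
  by (rule diff_mult_eqD[of b]) (simp_all add: diff_mult_geom_mult flip: monom_mult_diff_mult)

lemma geom_mult_commute:
  assumes "a \<noteq> 0" "b \<noteq> 0"
  shows "geom_mult a (geom_mult b f) = geom_mult b (geom_mult a f)"
proof (rule diff_mult_eqD[OF assms(1)], rule diff_mult_eqD[OF assms(2)])
  show "diff_mult b (diff_mult a (geom_mult a (geom_mult b f))) =
      diff_mult b (diff_mult a (geom_mult b (geom_mult a f)))"
    using assms by (subst (2) diff_mult_commute) (simp add: diff_mult_geom_mult)
qed

lemma monom_mult_geom_mult_self:
  "b \<noteq> 0 \<Longrightarrow> monom_mult b (geom_mult b f) = (\<lambda>p. geom_mult b f p - f p)"
  using geom_mult_unfold[of b f] by (simp add: fun_eq_iff)

text \<open>With \<open>u = x\<^sup>b\<close>, this is the finite geometric sum \<open>1 / (1 - u) = (1 + u + \<dots> + u\<^bsup>s-1\<^esup>) / (1 - u\<^sup>s)\<close>\<close>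

lemma geom_mult_multiple:
  assumes "b \<noteq> 0" "s > 0"
  shows "geom_mult b f = (\<lambda>p. \<Sum>i<s. monom_mult (i *s b) (geom_mult (s *s b) f) p)"
proof (rule diff_mult_eqD[OF assms(1)])
  let ?h = "geom_mult (s *s b) f"
  have sb: "s *s b \<noteq> 0" using assms by (auto simp: vec_eq_iff)
  have "diff_mult b (\<lambda>p. \<Sum>i<s. monom_mult (i *s b) ?h p) =
      (\<lambda>p. \<Sum>i<s. monom_mult (i *s b) ?h p - monom_mult (Suc i *s b) ?h p)"
  proof -
    have "Suc i *s b = b + i *s b" for i by (simp add: vec_eq_iff)
    then show ?thesis by (simp add: diff_mult_linear diff_mult_def monom_mult_monom_mult)
  qed
  also have "\<dots> = (\<lambda>p. ?h p - monom_mult (s *s b) ?h p)"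
    by (subst sum_lessThan_telescope') (simp add: monom_mult_zero)
  also have "\<dots> = diff_mult b (geom_mult b f)"
    using assms sb by (simp add: diff_mult_geom_mult monom_mult_geom_mult_self)
  finally show "diff_mult b (geom_mult b f) = diff_mult b (\<lambda>p. \<Sum>i<s. monom_mult (i *s b) ?h p)" ..
qed

text \<open>With \<open>u = x\<^sup>a\<close> and \<open>v = x\<^sup>b\<close>, this is the identity
  \<open>1 - u v = (1 - u) + (1 - v) - (1 - u) (1 - v)\<close> divided by \<open>(1 - u) (1 - v) (1 - u v)\<close>.\<close>

lemma elliott_identity:
  assumes "a \<noteq> 0" "b \<noteq> 0"
  shows "geom_mult a (geom_mult b f) =
    geom_mult (a + b) (\<lambda>p. geom_mult a f p + geom_mult b f p - f p)"
proof (rule diff_mult_eqD)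
  show ab: "a + b \<noteq> 0" using assms by (auto simp: vec_eq_iff)
  have "monom_mult (a + b) (geom_mult a (geom_mult b f)) =
      monom_mult a (geom_mult a (monom_mult b (geom_mult b f)))"
    using assms by (simp add: monom_mult_geom_mult flip: monom_mult_monom_mult)
  also have "\<dots> = (\<lambda>p. geom_mult a (geom_mult b f) p - geom_mult a f p - (geom_mult b f p - f p))"
    using assms by (simp add: monom_mult_geom_mult_self geom_mult_linear monom_mult_linear algebra_simps)
  finally have *: "monom_mult (a + b) (geom_mult a (geom_mult b f)) = \<dots>" .
  show "diff_mult (a + b) (geom_mult a (geom_mult b f)) =
    diff_mult (a + b) (geom_mult (a + b) (\<lambda>p. geom_mult a f p + geom_mult b f p - f p))"
    unfolding diff_mult_geom_mult[OF ab] by (subst diff_mult_def) (simp add: * fun_eq_iff)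
qed

section \<open>Closure properties of rational generating functions\<close>

abbreviation geom_mults :: "(nat ^ 'n::finite) list \<Rightarrow> (rat, 'n) mfps \<Rightarrow> (rat, 'n) mfps" where
  "geom_mults bs \<equiv> foldr geom_mult bs"

lemma rgf_iff:
  "rational_generating_function g \<longleftrightarrow>
    (\<exists>bs q. 0 \<notin> set bs \<and> finite {p. q p \<noteq> 0} \<and> g = geom_mults bs q)"
proof -
  have eq: "geom_mult = (\<lambda>b. mfps_mult (geom_series b))"
    by (simp add: fun_eq_iff geom_mult_def)
  show ?thesis
  proof
    assume "rational_generating_function g"
    then obtain q :: "(rat, 'a) mpoly" and bs where "0 \<notin> set bs" "g = geom_mults bs (Poly_Mapping.lookup q)"
      unfolding rational_generating_function_def eq by blast
    then show "\<exists>bs q. 0 \<notin> set bs \<and> finite {p. q p \<noteq> 0} \<and> g = geom_mults bs q"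
      using finite_lookup[of q] by blast
  next
    assume "\<exists>bs q. 0 \<notin> set bs \<and> finite {p. q p \<noteq> 0} \<and> g = geom_mults bs q"
    then obtain bs q where *: "0 \<notin> set bs" "finite {p. q p \<noteq> 0}" "g = geom_mults bs q"
      by blast
    then have "Poly_Mapping.lookup (Abs_poly_mapping q) = q"
      by (simp add: Abs_poly_mapping_inverse)
    with * show "rational_generating_function g"
      unfolding rational_generating_function_def eq[symmetric] by metis
  qed
qed

lemma monom_mult_geom_mults:
  "0 \<notin> set bs \<Longrightarrow> monom_mult a (geom_mults bs f) = geom_mults bs (monom_mult a f)"
  by (induction bs) (auto simp: monom_mult_geom_mult)

lemma geom_mult_geom_mults:
  "b \<noteq> 0 \<Longrightarrow> 0 \<notin> set bs \<Longrightarrow> geom_mult b (geom_mults bs f) = geom_mults bs (geom_mult b f)"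
  by (induction bs) (auto simp: geom_mult_commute[of b])

lemma geom_mults_commute:
  "0 \<notin> set bs \<Longrightarrow> 0 \<notin> set cs \<Longrightarrow> geom_mults bs (geom_mults cs f) = geom_mults cs (geom_mults bs f)"
  by (induction bs) (auto simp: geom_mult_geom_mults)

lemma geom_mults_middle:
  assumes "0 \<notin> set (bs @ b # cs)"
  shows "geom_mults (bs @ b # cs) f = geom_mults (b # bs @ cs) f"
  using assms geom_mult_geom_mults[of b bs "geom_mults cs f"] by simp

lemma geom_mults_linear:
  assumes "0 \<notin> set bs"
  shows "geom_mults bs (\<lambda>p. f p + g p) = (\<lambda>p. geom_mults bs f p + geom_mults bs g p)"
  "geom_mults bs (\<lambda>p. c * f p) = (\<lambda>p. c * geom_mults bs f p)"
  "geom_mults bs (\<lambda>p. \<Sum>i\<in>I. h i p) = (\<lambda>p. \<Sum>i\<in>I. geom_mults bs (h i) p)"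
  using assms by (induction bs) (auto simp: geom_mult_linear)

lemma finite_support_monom_mult:
  assumes "finite {p. f p \<noteq> 0}"
  shows "finite {p. monom_mult a f p \<noteq> 0}"
proof (rule finite_subset)
  show "{p. monom_mult a f p \<noteq> 0} \<subseteq> (+) a ` {p. f p \<noteq> 0}"
  proof
    fix p assume "p \<in> {p. monom_mult a f p \<noteq> 0}"
    then have "p = a + (p - a)" "f (p - a) \<noteq> 0"
      by (auto simp: monom_mult_def vec_diff_simps split: if_splits)
    then show "p \<in> (+) a ` {p. f p \<noteq> 0}" by blast
  qed
qed (use assms in simp)

lemma finite_support_diff_mult:
  assumes "finite {p. f p \<noteq> 0}"
  shows "finite {p. diff_mult a f p \<noteq> 0}"
  by (rule finite_subset[OF _ finite_UnI[OF assms finite_support_monom_mult[OF assms, of a]]])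
    (auto simp: diff_mult_def)

text \<open>Any factors can be added to a denominator: multiply the numerator by them as well. This is what brings
  two fractions to a common denominator.\<close>

lemma geom_mults_numerator:
  assumes "0 \<notin> set bs" "finite {p. q p \<noteq> 0}"
  shows "\<exists>r. finite {p. r p \<noteq> 0} \<and> q = geom_mults bs r"
  using assms
proof (induction bs arbitrary: q)
  case (Cons b bs)
  then obtain r where "finite {p. r p \<noteq> 0}" "diff_mult b q = geom_mults bs r"
    using finite_support_diff_mult[of q b] by force
  moreover from this have "q = geom_mults (b # bs) r"
    using Cons.prems geom_mult_diff_mult[of b q] by simp
  ultimately show ?case by blast
qed auto

lemma rgf_finite_support: "finite {p. q p \<noteq> 0} \<Longrightarrow> rational_generating_function q"
  unfolding rgf_iff by (intro exI[of _ "[]"] exI[of _ q]) auto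

lemma rgf_quotient:
  "0 \<notin> set bs \<Longrightarrow> finite {p. q p \<noteq> 0} \<Longrightarrow> rational_generating_function (geom_mults bs q)"
  unfolding rgf_iff by blast

lemma rgf_zero: "rational_generating_function (\<lambda>p. 0)"
  by (rule rgf_finite_support) simp

lemma rgf_geom_mult:
  "b \<noteq> 0 \<Longrightarrow> rational_generating_function f \<Longrightarrow> rational_generating_function (geom_mult b f)"
  unfolding rgf_iff by (metis foldr.simps(2) comp_apply list.set_intros set_ConsD)

lemma rgf_geom_mults:
  "0 \<notin> set bs \<Longrightarrow> rational_generating_function f \<Longrightarrow> rational_generating_function (geom_mults bs f)"
  by (induction bs) (auto intro: rgf_geom_mult)

lemma rgf_monom_mult:
  assumes "rational_generating_function f"
  shows "rational_generating_function (monom_mult a f)"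
proof -
  obtain bs q where "0 \<notin> set bs" "finite {p. q p \<noteq> 0}" "f = geom_mults bs q"
    using assms unfolding rgf_iff by blast
  then show ?thesis
    by (simp add: monom_mult_geom_mults rgf_quotient finite_support_monom_mult)
qed

lemma rgf_scale:
  assumes "rational_generating_function f"
  shows "rational_generating_function (\<lambda>p. c * f p)"
proof -
  obtain bs q where *: "0 \<notin> set bs" "finite {p. q p \<noteq> 0}" "f = geom_mults bs q"
    using assms unfolding rgf_iff by blast
  have "finite {p. c * q p \<noteq> 0}"
    by (rule finite_subset[OF _ *(2)]) auto
  with * show ?thesis
    by (simp add: rgf_quotient flip: geom_mults_linear)
qed

lemma rgf_add:
  assumes "rational_generating_function f" "rational_generating_function g"
  shows "rational_generating_function (\<lambda>p. f p + g p)"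
proof -
  obtain bs q cs r where bs: "0 \<notin> set bs" "finite {p. q p \<noteq> 0}" "f = geom_mults bs q"
    and cs: "0 \<notin> set cs" "finite {p. r p \<noteq> 0}" "g = geom_mults cs r"
    using assms unfolding rgf_iff by blast
  obtain q' r' where q': "finite {p. q' p \<noteq> 0}" "q = geom_mults cs q'"
    and r': "finite {p. r' p \<noteq> 0}" "r = geom_mults bs r'"
    using geom_mults_numerator bs cs by metis
  have "f = geom_mults bs (geom_mults cs q')" "g = geom_mults bs (geom_mults cs r')"
    using bs cs q' r' geom_mults_commute by auto
  then have "(\<lambda>p. f p + g p) = geom_mults bs (geom_mults cs (\<lambda>p. q' p + r' p))"
    using bs cs by (simp add: geom_mults_linear)
  moreover have "finite {p. q' p + r' p \<noteq> 0}"
    by (rule finite_subset[OF _ finite_UnI[OF q'(1) r'(1)]]) auto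
  ultimately show ?thesis
    using bs(1) cs(1) by (simp add: rgf_geom_mults rgf_quotient)
qed

lemma rgf_diff:
  assumes "rational_generating_function f" "rational_generating_function g"
  shows "rational_generating_function (\<lambda>p. f p - g p)"
  using rgf_add[OF assms(1) rgf_scale[OF assms(2), of "-1"]] by simp

lemma rgf_sum:
  "(\<And>i. i \<in> I \<Longrightarrow> rational_generating_function (f i)) \<Longrightarrow>
    rational_generating_function (\<lambda>p. \<Sum>i\<in>I. f i p)"
  by (induction I rule: infinite_finite_induct) (auto intro: rgf_zero rgf_add)

text \<open>The series \<open>x\<^sup>m / ((1 - x\<^sup>b\<^sub>1) \<dots> (1 - x\<^sup>b\<^sub>k))\<close>, which counts the representations of \<open>p\<close> as \<open>m\<close> plus a
  natural combination of the \<open>b\<^sub>i\<close>.\<close>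

definition cone_series :: "nat ^ 'n::finite \<Rightarrow> (nat ^ 'n) list \<Rightarrow> (rat, 'n) mfps" where
  "cone_series m bs = geom_mults bs (\<lambda>p. of_bool (p = m))"

lemma rgf_cone_series: "0 \<notin> set bs \<Longrightarrow> rational_generating_function (cone_series m bs)"
  unfolding cone_series_def by (rule rgf_geom_mults) (auto intro: rgf_finite_support)

lemma finite_support_expand:
  fixes q :: "'a \<Rightarrow> rat"
  assumes "finite {m. q m \<noteq> 0}"
  shows "(\<Sum>m | q m \<noteq> 0. q m * of_bool (p = m)) = q p"
proof -
  have "(\<Sum>m | q m \<noteq> 0. q m * of_bool (p = m)) = (\<Sum>m | q m \<noteq> 0. if m = p then q m else 0)"
    by (intro sum.cong) auto
  then show ?thesis using assms by (simp add: sum.delta)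
qed

text \<open>Rational generating functions are linear combinations of cone series, one for each monomial of the
  numerator.\<close>

lemma rgf_mult_by_cone_series:
  assumes cone: "\<And>m bs. 0 \<notin> set bs \<Longrightarrow> rational_generating_function (\<lambda>p. \<phi> p * cone_series m bs p)"
    and g: "rational_generating_function g"
  shows "rational_generating_function (\<lambda>p. \<phi> p * g p)"
proof -
  obtain bs q where *: "0 \<notin> set bs" "finite {p. q p \<noteq> 0}" "g = geom_mults bs q"
    using g unfolding rgf_iff by blast
  from *(2) have "q = (\<lambda>p. \<Sum>m | q m \<noteq> 0. q m * of_bool (p = m))"
    by (intro ext) (rule finite_support_expand[symmetric])
  then have "g = geom_mults bs (\<lambda>p. \<Sum>m | q m \<noteq> 0. q m * of_bool (p = m))"
    using *(3) by simp
  also have "\<dots> = (\<lambda>p. \<Sum>m | q m \<noteq> 0. q m * cone_series m bs p)"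
    using *(1) by (simp add: geom_mults_linear cone_series_def)
  finally have "(\<lambda>p. \<phi> p * g p) = (\<lambda>p. \<Sum>m | q m \<noteq> 0. q m * (\<phi> p * cone_series m bs p))"
    by (simp add: sum_distrib_left mult.left_commute)
  moreover have "rational_generating_function \<dots>"
    by (intro rgf_sum rgf_scale cone *(1))
  ultimately show ?thesis by simp
qed

lemma monom_mult_cone_series:
  assumes "0 \<notin> set bs"
  shows "monom_mult a (cone_series m bs) = cone_series (a + m) bs"
proof -
  have "monom_mult a (\<lambda>p. of_bool (p = m)) = (\<lambda>p. of_bool (p = a + m))"
    by (auto simp: fun_eq_iff monom_mult_def vec_diff_simps)
  with assms show ?thesis by (simp add: cone_series_def monom_mult_geom_mults)
qed

lemma cone_series_middle:
  "0 \<notin> set (bs @ b # cs) \<Longrightarrow> cone_series m (bs @ b # cs) = cone_series m (b # bs @ cs)"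
  unfolding cone_series_def by (rule geom_mults_middle)

lemma cone_series_unfold:
  assumes "0 \<notin> set (b # bs)"
  shows "cone_series m (b # bs) p = cone_series m bs p + cone_series (b + m) (b # bs) p"
  using geom_mult_unfold[of b "cone_series m bs" p] monom_mult_cone_series[of "b # bs" b m] assms
  by (simp add: cone_series_def)

lemma cone_series_multiple:
  assumes "0 \<notin> set (b # bs)" "s > 0"
  shows "cone_series m (b # bs) p = (\<Sum>i<s. cone_series (i *s b + m) ((s *s b) # bs) p)"
proof -
  have "0 \<notin> set ((s *s b) # bs)" using assms by (auto simp: vec_eq_iff)
  then have "monom_mult (i *s b) (geom_mult (s *s b) (cone_series m bs)) =
      cone_series (i *s b + m) ((s *s b) # bs)" for i
    using monom_mult_cone_series[of "(s *s b) # bs" "i *s b" m] by (simp add: cone_series_def)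
  then show ?thesis
    using geom_mult_multiple[of b s "cone_series m bs"] assms by (simp add: cone_series_def)
qed

lemma cone_series_split:
  assumes "0 \<notin> set (a # b # bs)"
  shows "cone_series m (a # b # bs) p =
    cone_series m ((a + b) # a # bs) p + cone_series m ((a + b) # b # bs) p - cone_series m ((a + b) # bs) p"
proof -
  have "a + b \<noteq> 0" using assms by (auto simp: vec_eq_iff)
  then show ?thesis
    using elliott_identity[of a b "cone_series m bs"] assms
    by (simp add: cone_series_def geom_mult_linear)
qed

text \<open>An invariant of the starting point \<open>m\<close> that is preserved by adding generators holds at all points that
  are reached.\<close>

lemma cone_series_support:
  assumes "cone_series m bs p \<noteq> 0" "0 \<notin> set bs" "Q m" "\<And>b p. b \<in> set bs \<Longrightarrow> Q p \<Longrightarrow> Q (b + p)"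
  shows "Q p"
  using assms
proof (induction bs arbitrary: p)
  case Nil
  then show ?case by (simp add: cone_series_def)
next
  case (Cons b bs)
  then have "geom_mult b (cone_series m bs) p \<noteq> 0"
    by (simp add: cone_series_def)
  then obtain k where k: "k *s b \<le> p" "cone_series m bs (p - k *s b) \<noteq> 0"
    using Cons.prems by (auto simp: geom_mult_eq_sum elim: sum.not_neutral_contains_not_neutral)
  have "Q (p - k *s b)"
    using Cons k by auto
  moreover have "Q (j *s b + r)" if "Q r" for j r
  proof (induction j)
    case 0
    have "0 *s b + r = r" by (simp add: vec_eq_iff)
    then show ?case using \<open>Q r\<close> by simp
  next
    case (Suc j)
    have "Suc j *s b + r = b + (j *s b + r)" by (simp add: vec_eq_iff)
    then show ?case using Suc Cons.prems(4)[of b "j *s b + r"] by simp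
  qed
  ultimately have "Q (k *s b + (p - k *s b))" by blast
  with k(1) show ?case by (simp add: vec_diff_simps)
qed

text \<open>Multiplication of the coefficients by \<open>p\<^sub>i\<close> is the derivation \<open>\<partial> = x\<^sub>i \<partial>/\<partial>x\<^sub>i\<close>. Applying it to
  \<open>(1 - x\<^sup>b) g = f\<close> gives \<open>(1 - x\<^sup>b) \<partial>g = \<partial>f + b\<^sub>i x\<^sup>b g\<close>.\<close>

lemma rgf_mult_coordinate:
  assumes "rational_generating_function g"
  shows "rational_generating_function (\<lambda>p. of_nat (p $ i) * g p)"
proof -
  obtain bs q where "0 \<notin> set bs" "finite {p. q p \<noteq> 0}" "g = geom_mults bs q"
    using assms unfolding rgf_iff by blast
  then show ?thesis
  proof (induction bs arbitrary: g)
    case Nil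
    then have "finite {p. of_nat (p $ i) * q p \<noteq> 0}"
      by (intro finite_subset[OF _ Nil(2)]) auto
    with Nil show ?case by (auto intro: rgf_finite_support)
  next
    case (Cons b bs)
    define f where "f = geom_mults bs q"
    have b: "b \<noteq> 0" and bs: "0 \<notin> set bs" using Cons.prems(1) by auto
    have g: "g = geom_mult b f" using Cons.prems by (simp add: f_def)
    have rgf_g: "rational_generating_function g"
      using rgf_quotient[OF Cons.prems(1,2)] Cons.prems(3) by simp
    let ?r = "\<lambda>p. of_nat (p $ i) * f p + of_nat (b $ i) * monom_mult b g p"
    have "(\<lambda>p. of_nat (p $ i) * g p) = geom_mult b ?r"
    proof (rule diff_mult_eqD[OF b])
      have "diff_mult b (\<lambda>p. of_nat (p $ i) * g p) = (\<lambda>p. of_nat (p $ i) * diff_mult b g p +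
          of_nat (b $ i) * monom_mult b g p)"
        by (auto simp: fun_eq_iff diff_mult_def monom_mult_def vec_le_iff algebra_simps of_nat_diff)
      also have "\<dots> = ?r"
        by (simp add: g diff_mult_geom_mult[OF b])
      finally show "diff_mult b (\<lambda>p. of_nat (p $ i) * g p) = diff_mult b (geom_mult b ?r)"
        by (simp add: diff_mult_geom_mult[OF b])
    qed
    moreover have "rational_generating_function ?r"
      using Cons bs f_def rgf_g by (intro rgf_add rgf_scale rgf_monom_mult) auto
    ultimately show ?case
      using rgf_geom_mult[OF b] by simp
  qed
qed

definition additive_form :: "(nat ^ 'n::finite \<Rightarrow> int) \<Rightarrow> bool" where
  "additive_form w \<longleftrightarrow> (\<forall>p q. w (p + q) = w p + w q)"

lemma additive_form_add: "additive_form w \<Longrightarrow> w (p + q) = w p + w q"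
  by (simp add: additive_form_def)

lemma additive_form_uminus: "additive_form w \<Longrightarrow> additive_form (\<lambda>p. - w p)"
  by (simp add: additive_form_def)

lemma additive_form_scale:
  assumes "additive_form w" shows "w (k *s p) = int k * w p"
proof (induction k)
  case 0
  have "0 *s p = 0" by (simp add: vec_eq_iff)
  then show ?case using additive_form_add[OF assms, of 0 0] by simp
next
  case (Suc k)
  have "Suc k *s p = p + k *s p" by (simp add: vec_eq_iff)
  then show ?case using Suc by (simp add: additive_form_add[OF assms] algebra_simps)
qed

text \<open>If \<open>w m < c\<close> and \<open>w b > 0\<close>, the cone starting at \<open>m\<close> splits into the cone without the generator \<open>b\<close>
  and the same cone starting at \<open>m + b\<close>. This ends when \<open>w m \<ge> c\<close>, and the half-space contains the whole
  cone, or when \<open>w\<close> vanishes on all generators, and it misses the cone.\<close>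

lemma rgf_half_space_nonneg:
  assumes w: "additive_form w" and "0 \<notin> set bs" "\<And>b. b \<in> set bs \<Longrightarrow> 0 \<le> w b"
  shows "rational_generating_function (\<lambda>p. of_bool (c \<le> w p) * cone_series m bs p)"
  using assms(2,3)
proof (induction "length bs + nat (c - w m)" arbitrary: bs m rule: less_induct)
  case less
  note add = additive_form_add[OF w]
  consider "c \<le> w m" | "w m < c" "\<forall>b\<in>set bs. w b = 0" | "w m < c" "\<exists>b\<in>set bs. w b > 0"
    using less.prems(2) by (meson linorder_not_le order_antisym)
  then show ?case
  proof cases
    case 1
    have "c \<le> w p" if "cone_series m bs p \<noteq> 0" for p
      using that less.prems(1) 1
      by (rule cone_series_support) (auto simp: add intro: add_increasing less.prems)
    then have "(\<lambda>p. of_bool (c \<le> w p) * cone_series m bs p) = cone_series m bs"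
      by (force simp: fun_eq_iff)
    with less.prems show ?thesis by (simp add: rgf_cone_series)
  next
    case 2
    have "w p < c" if "cone_series m bs p \<noteq> 0" for p
      using that less.prems(1) 2(1) by (rule cone_series_support) (use 2 in \<open>auto simp: add\<close>)
    then have "(\<lambda>p. of_bool (c \<le> w p) * cone_series m bs p) = (\<lambda>p. 0)"
      by (force simp: fun_eq_iff)
    then show ?thesis by (simp add: rgf_zero)
  next
    case 3
    then obtain b xs ys where b: "w b > 0" "bs = xs @ b # ys"
      by (metis in_set_conv_decomp)
    have 0: "0 \<notin> set (xs @ b # ys)" using less.prems b by simp
    have "cone_series m bs p = cone_series m (xs @ ys) p + cone_series (b + m) bs p" for p
      using cone_series_unfold[of b "xs @ ys" m p] cone_series_middle[OF 0] 0 b(2) by simp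
    moreover have "rational_generating_function (\<lambda>p. of_bool (c \<le> w p) * cone_series m (xs @ ys) p)"
      by (rule less.hyps) (use b less.prems in auto)
    moreover have "rational_generating_function (\<lambda>p. of_bool (c \<le> w p) * cone_series (b + m) bs p)"
      by (rule less.hyps) (use b less.prems 3(1) in \<open>auto simp: add\<close>)
    ultimately show ?thesis
      using rgf_add by (simp add: distrib_left)
  qed
qed

text \<open>The induction is on the number of generators on which \<open>w\<close> does not vanish. Let \<open>w a > 0 > w b\<close>. Passing
  to the multiples \<open>A = - w b a\<close> and \<open>B = w a b\<close> makes the values of \<open>w\<close> opposite; then \<open>w (A + B) = 0\<close>, and
  each of the three cones in Elliott's identity has fewer generators on which \<open>w\<close> does not vanish.\<close>

lemma rgf_half_space_cone_series:
  assumes w: "additive_form w" and "0 \<notin> set bs"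
  shows "rational_generating_function (\<lambda>p. of_bool (c \<le> w p) * cone_series m bs p)"
  using assms(2)
proof (induction "length (filter (\<lambda>b. w b \<noteq> 0) bs)" arbitrary: bs m rule: less_induct)
  case less
  consider "\<forall>b\<in>set bs. 0 \<le> w b" | "\<forall>b\<in>set bs. w b \<le> 0" |
    "\<exists>a\<in>set bs. \<exists>b\<in>set bs. w a > 0 \<and> w b < 0"
    by (meson not_le)
  then show ?case
  proof cases
    case 1
    then show ?thesis using rgf_half_space_nonneg[OF w less.prems] by blast
  next
    case 2
    then have "rational_generating_function (\<lambda>p. of_bool (1 - c \<le> - w p) * cone_series m bs p)"
      by (intro rgf_half_space_nonneg additive_form_uminus w less.prems) auto
    \<comment> \<open>\<open>c \<le> w p\<close> is the complement of \<open>1 - c \<le> - w p\<close>, for which the previous case applies.\<close>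
    from rgf_diff[OF rgf_cone_series[OF less.prems, of m] this]
    have "rational_generating_function
        (\<lambda>p. cone_series m bs p - of_bool (1 - c \<le> - w p) * cone_series m bs p)" .
    moreover have "cone_series m bs p - of_bool (1 - c \<le> - w p) * cone_series m bs p =
        of_bool (c \<le> w p) * cone_series m bs p" for p
      by auto
    ultimately show ?thesis by simp
  next
    case 3
    then obtain a b where ab: "a \<in> set bs" "b \<in> set bs" "w a > 0" "w b < 0" by blast
    obtain xs ys where 1: "bs = xs @ a # ys" using ab(1) by (metis in_set_conv_decomp)
    have "b \<in> set (xs @ ys)" using ab 1 by auto
    then obtain us vs where 2: "xs @ ys = us @ b # vs" by (metis in_set_conv_decomp)
    define R where "R = us @ vs"
    have R: "0 \<notin> set (a # b # R)"
      using less.prems arg_cong[OF 2, of set] unfolding 1 R_def by auto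
    have perm: "cone_series m bs = cone_series m (a # b # R)"
    proof -
      have "cone_series m bs = geom_mult a (cone_series m (us @ b # vs))"
        using cone_series_middle[of xs a ys m] less.prems unfolding 1 2 by (simp add: cone_series_def)
      also have "\<dots> = cone_series m (a # b # R)"
        using cone_series_middle[of us b vs m] R by (simp add: cone_series_def R_def)
      finally show ?thesis .
    qed
    \<comment> \<open>With these factors, \<open>w (s a) = - w (t b)\<close>.\<close>
    define s t where "s = nat (- w b)" and "t = nat (w a)"
    have st: "s > 0" "t > 0" using ab by (auto simp: s_def t_def)
    let ?A = "s *s a" and ?B = "t *s b"
    have nz: "0 \<notin> set (?A # ?B # R)" "0 \<notin> set (?A # b # R)" "?A + ?B \<noteq> 0"
      using R st by (auto simp: vec_eq_iff)
    have wA: "w ?A = w a * - w b" "w ?B = - (w a * - w b)"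
      using ab by (auto simp: additive_form_scale[OF w] s_def t_def)
    then have w0: "w (?A + ?B) = 0" by (simp add: additive_form_add[OF w])
    have "cone_series (i *s a + m) (?A # b # R) p =
        (\<Sum>j<t. cone_series (j *s b + (i *s a + m)) (?A # ?B # R) p)" for i p
    proof -
      have "cone_series n (?A # b # R) = cone_series n (b # ?A # R)" for n
        using cone_series_middle[of "[?A]" b R n] nz(2) by simp
      moreover have "cone_series n (?B # ?A # R) = cone_series n (?A # ?B # R)" for n
        using cone_series_middle[of "[?A]" ?B R n] nz(1) by simp
      moreover have "0 \<notin> set (b # ?A # R)" using nz(2) by auto
      ultimately show ?thesis
        using cone_series_multiple[OF _ st(2), of b "?A # R"] by simp
    qed
    then have eq: "cone_series m bs p =
      (\<Sum>i<s. \<Sum>j<t. cone_series (j *s b + (i *s a + m)) (?A # ?B # R) p)" for p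
      unfolding perm cone_series_multiple[OF R st(1)] by simp
    have count: "length (filter (\<lambda>b. w b \<noteq> 0) bs) = 2 + length (filter (\<lambda>b. w b \<noteq> 0) R)"
      using arg_cong[OF 2, of "\<lambda>xs. length (filter (\<lambda>b. w b \<noteq> 0) xs)"] ab
      unfolding 1 R_def by simp
    have "rational_generating_function (\<lambda>p. of_bool (c \<le> w p) * cone_series n (?A # ?B # R) p)" for n
    proof -
      have "rational_generating_function (\<lambda>p. of_bool (c \<le> w p) * cone_series n ((?A + ?B) # ?A # R) p)"
        "rational_generating_function (\<lambda>p. of_bool (c \<le> w p) * cone_series n ((?A + ?B) # ?B # R) p)"
        "rational_generating_function (\<lambda>p. of_bool (c \<le> w p) * cone_series n ((?A + ?B) # R) p)"
        using nz by (auto intro!: less.hyps simp: count w0)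
      from rgf_diff[OF rgf_add[OF this(1,2)] this(3)] show ?thesis
        unfolding cone_series_split[OF nz(1)] by (simp only: distrib_left right_diff_distrib)
    qed
    then show ?thesis
      unfolding eq sum_distrib_left by (intro rgf_sum)
  qed
qed

text \<open>After replacing the generators by multiples, \<open>w\<close> is constant modulo \<open>M\<close> on each of the resulting cones.\<close>

lemma rgf_dvd_cone_series:
  assumes w: "additive_form w" and "M > 0" and "0 \<notin> set bs"
  shows "rational_generating_function (\<lambda>p. of_bool (M dvd c + w p) * cone_series m bs p)"
  using assms(3)
proof (induction "length (filter (\<lambda>b. \<not> M dvd w b) bs)" arbitrary: bs m rule: less_induct)
  case less
  show ?case
  proof (cases "\<forall>b\<in>set bs. M dvd w b")
    case True
    have supp: "M dvd w p - w m" if "cone_series m bs p \<noteq> 0" for p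
      using that less.prems
    proof (rule cone_series_support)
      show "M dvd w (b + p) - w m" if "b \<in> set bs" "M dvd w p - w m" for b p
        using that True by (metis additive_form_add[OF w] add_diff_eq dvd_add)
    qed simp
    have "of_bool (M dvd c + w m) * cone_series m bs p =
        of_bool (M dvd c + w p) * cone_series m bs p" for p
    proof (cases "cone_series m bs p = 0")
      case False
      from dvd_add_left_iff[OF supp[OF this], of "c + w m"]
      have "M dvd c + w p \<longleftrightarrow> M dvd c + w m" by (simp add: algebra_simps)
      then show ?thesis by (simp only:)
    qed simp
    with rgf_scale[OF rgf_cone_series[OF less.prems], of "of_bool (M dvd c + w m)" m]
    show ?thesis by (simp only:)
  next
    case False
    then obtain b xs ys where b: "\<not> M dvd w b" "bs = xs @ b # ys"
      by (metis in_set_conv_decomp)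
    have 0: "0 \<notin> set (b # xs @ ys)" using less.prems b by auto
    let ?c = "nat M *s b"
    have eq: "cone_series m bs p = (\<Sum>i<nat M. cone_series (i *s b + m) (?c # xs @ ys) p)" for p
      using cone_series_middle[of xs b ys m] cone_series_multiple[OF 0, of "nat M"] less.prems b assms(2)
      by simp
    have "M dvd w ?c"
      using assms(2) by (simp add: additive_form_scale[OF w])
    then have "rational_generating_function
        (\<lambda>p. of_bool (M dvd c + w p) * cone_series n (?c # xs @ ys) p)" for n
      using 0 b assms(2) by (intro less.hyps) (auto simp: vec_eq_iff)
    then show ?thesis
      unfolding eq sum_distrib_left by (intro rgf_sum)
  qed
qed

text \<open>The variables are freed one at a time: allowing coordinate \<open>i\<close> to be nonzero multiplies the series by
  \<open>1 / (1 - x\<^sub>i)\<close>.\<close>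

lemma rgf_one: "rational_generating_function (\<lambda>p. 1)"
proof -
  have "finite I \<Longrightarrow> rational_generating_function (\<lambda>p :: nat ^ 'n. of_bool (\<forall>i. i \<notin> I \<longrightarrow> p $ i = 0))" for I
  proof (induction I rule: finite_induct)
    case empty
    have "{p :: nat ^ 'n. \<forall>i. p $ i = 0} = {0}" by (auto simp: vec_eq_iff)
    then show ?case by (intro rgf_finite_support) simp
  next
    case (insert i I)
    let ?f = "\<lambda>I (p :: nat ^ 'n). of_bool (\<forall>i. i \<notin> I \<longrightarrow> p $ i = 0) :: rat"
    let ?b = "axis i 1 :: nat ^ 'n"
    have b: "?b \<noteq> 0" by (simp add: axis_eq_0_iff)
    have le: "?b \<le> p \<longleftrightarrow> p $ i \<noteq> 0" for p :: "nat ^ 'n"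
      by (auto simp: vec_le_iff axis_def)
    have "?f (insert i I) = geom_mult ?b (?f I)"
    proof (rule diff_mult_eqD[OF b], unfold diff_mult_geom_mult[OF b])
      show "diff_mult ?b (?f (insert i I)) = ?f I"
      proof
        fix p :: "nat ^ 'n"
        have 1: "(\<forall>j. j \<notin> insert i I \<longrightarrow> (p - ?b) $ j = 0) \<longleftrightarrow> (\<forall>j. j \<notin> insert i I \<longrightarrow> p $ j = 0)"
          by (auto simp: axis_def)
        have 2: "(\<forall>j. j \<notin> I \<longrightarrow> p $ j = 0) \<longleftrightarrow> p $ i = 0 \<and> (\<forall>j. j \<notin> insert i I \<longrightarrow> p $ j = 0)"
          using insert.hyps(2) by (metis insert_iff)
        show "diff_mult ?b (?f (insert i I)) p = ?f I p"
          unfolding diff_mult_def monom_mult_def 1 le 2 by auto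
      qed
    qed
    with insert.IH b show ?case by (simp add: rgf_geom_mult)
  qed
  from this[of UNIV] show ?thesis by simp
qed

section \<open>Constructible functions of a vector\<close>

text \<open>Environments have further variables \<open>Inr j\<close> besides the parameters, over which sums can be formed; here
  they get the value 0.\<close>

definition param_env :: "nat ^ 'n \<Rightarrow> 'n + nat \<Rightarrow> nat" where
  "param_env p = case_sum (($) p) (\<lambda>_. 0)"

definition vec_constructible :: "(nat ^ 'n \<Rightarrow> rat) \<Rightarrow> bool" where
  "vec_constructible g \<longleftrightarrow> (\<exists>f. constructible f \<and> (\<forall>p. g p = f (param_env p)))"

lemma vec_constructible_const: "vec_constructible (\<lambda>p. c)"
  unfolding vec_constructible_def using constructible_const by blast

lemma vec_constructible_add:
  assumes "vec_constructible f" "vec_constructible g"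
  shows "vec_constructible (\<lambda>p. f p + g p)"
proof -
  obtain f' g' where "constructible f'" "\<forall>p. f p = f' (param_env p)"
    "constructible g'" "\<forall>p. g p = g' (param_env p)"
    using assms unfolding vec_constructible_def by blast
  then show ?thesis unfolding vec_constructible_def
    by (intro exI[of _ "\<lambda>e. f' e + g' e"]) (simp add: constructible_add)
qed

lemma vec_constructible_mult:
  assumes "vec_constructible f" "vec_constructible g"
  shows "vec_constructible (\<lambda>p. f p * g p)"
proof -
  obtain f' g' where "constructible f'" "\<forall>p. f p = f' (param_env p)"
    "constructible g'" "\<forall>p. g p = g' (param_env p)"
    using assms unfolding vec_constructible_def by blast
  then show ?thesis unfolding vec_constructible_def
    by (intro exI[of _ "\<lambda>e. f' e * g' e"]) (simp add: constructible_mult)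
qed

lemma vec_constructible_sum:
  "(\<And>i. i \<in> I \<Longrightarrow> vec_constructible (f i)) \<Longrightarrow> vec_constructible (\<lambda>p. \<Sum>i\<in>I. f i p)"
  by (induction I rule: infinite_finite_induct)
    (auto intro: vec_constructible_const vec_constructible_add)

lemma vec_constructible_prod:
  "(\<And>i. i \<in> I \<Longrightarrow> vec_constructible (f i)) \<Longrightarrow> vec_constructible (\<lambda>p. \<Prod>i\<in>I. f i p)"
  by (induction I rule: infinite_finite_induct)
    (auto intro: vec_constructible_const vec_constructible_mult)

lemma vec_constructible_power: "vec_constructible f \<Longrightarrow> vec_constructible (\<lambda>p. f p ^ k)"
  by (induction k) (auto intro: vec_constructible_const vec_constructible_mult)

lemma vec_constructible_coordinate: "vec_constructible (\<lambda>p. of_nat (p $ i))"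
  unfolding vec_constructible_def
  by (intro exI[of _ "\<lambda>e. of_int (int (e (Inl i)))"] conjI constructible_linear linear_var)
    (simp add: param_env_def)

lemma vec_constructible_of_bool:
  assumes "definable P" "\<And>p. Q p \<longleftrightarrow> P (param_env p)"
  shows "vec_constructible (\<lambda>p. of_bool (Q p))"
  unfolding vec_constructible_def
  by (intro exI[of _ "\<lambda>e. of_bool (P e)"] conjI constructible_of_bool assms(1)) (simp add: assms(2))

section \<open>Presburger counting functions are constructible\<close>

text \<open>Variables \<open>Inr j\<close> with \<open>j \<ge> d\<close> keep their value in \<open>e\<close>, so that the counted variables can be summed
  over one at a time, in an induction on \<open>d\<close>.\<close>

definition assign_counted :: "nat \<Rightarrow> ('n + nat \<Rightarrow> nat) \<Rightarrow> (nat \<Rightarrow> nat) \<Rightarrow> 'n + nat \<Rightarrow> nat" where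
  "assign_counted d e c = case_sum (\<lambda>i. e (Inl i)) (\<lambda>j. if j < d then c j else e (Inr j))"

lemma assign_counted_Suc:
  "assign_counted (Suc d) e (c(d := k)) = (assign_counted d e c)(Inr d := k)"
  by (auto simp: assign_counted_def fun_eq_iff split: sum.split)

text \<open>Fubini: the solutions for \<open>d + 1\<close> variables are pairs of an assignment to the first \<open>d\<close> variables and a
  value of the last one. All inner sums have finite support because their supports embed into the
  support of the whole sum.\<close>

lemma constructible_sum_counted:
  assumes "constructible f"
    and "\<And>e. finite {c \<in> {..<d} \<rightarrow>\<^sub>E UNIV. f (assign_counted d e c) \<noteq> 0}"
  shows "constructible (\<lambda>e. \<Sum>c | c \<in> {..<d} \<rightarrow>\<^sub>E UNIV \<and> f (assign_counted d e c) \<noteq> 0.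
    f (assign_counted d e c))"
  using assms
proof (induction d arbitrary: f)
  case 0
  have "assign_counted 0 e c = e" for e :: "'a + nat \<Rightarrow> nat" and c
    by (auto simp: assign_counted_def fun_eq_iff split: sum.split)
  moreover have "(\<Sum>c :: nat \<Rightarrow> nat | c = (\<lambda>_. undefined) \<and> f e \<noteq> 0. f e) = f e" for e
    by (cases "f e = 0") auto
  ultimately show ?case using 0 by (simp del: sum_constant)
next
  case (Suc d)
  let ?S = "\<lambda>d f e. {c \<in> {..<d} \<rightarrow>\<^sub>E UNIV. f (assign_counted d e c) \<noteq> 0}"
  let ?g = "\<lambda>e. Sum_any (\<lambda>k. f (e(Inr d := k)))"
  have PiE_Suc: "c(d := k) \<in> {..<Suc d} \<rightarrow>\<^sub>E UNIV" if "c \<in> {..<d} \<rightarrow>\<^sub>E UNIV" for c :: "nat \<Rightarrow> nat" and k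
    using that by (auto simp: PiE_iff extensional_def)
  have fin_k: "finite {k. f (e(Inr d := k)) \<noteq> 0}" for e
  proof -
    \<comment> \<open>The assignment that \<open>e\<close> itself makes to the first \<open>d\<close> variables.\<close>
    define c where "c = restrict (\<lambda>j. e (Inr j)) {..<d}"
    have c: "c \<in> {..<d} \<rightarrow>\<^sub>E UNIV" by (simp add: c_def)
    have e: "assign_counted d e c = e"
      by (auto simp: c_def assign_counted_def fun_eq_iff split: sum.split)
    have "(\<lambda>k. c(d := k)) ` {k. f (e(Inr d := k)) \<noteq> 0} \<subseteq> ?S (Suc d) f e"
    proof
      fix c' assume "c' \<in> (\<lambda>k. c(d := k)) ` {k. f (e(Inr d := k)) \<noteq> 0}"
      then obtain k where "c' = c(d := k)" "f (e(Inr d := k)) \<noteq> 0" by blast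
      then show "c' \<in> ?S (Suc d) f e"
        using PiE_Suc[OF c] assign_counted_Suc[of d e c k] e by simp
    qed
    then have "finite ((\<lambda>k. c(d := k)) ` {k. f (e(Inr d := k)) \<noteq> 0})"
      using Suc.prems(2) by (rule finite_subset)
    then show ?thesis
      by (rule finite_imageD) (auto simp: inj_on_def fun_eq_iff split: if_splits)
  qed
  have g: "constructible ?g"
    by (rule constructible_Sum_any[OF Suc.prems(1) fin_k])
  have sub: "?S d ?g e \<subseteq> (\<lambda>c. restrict c {..<d}) ` ?S (Suc d) f e" for e
  proof
    fix c assume c: "c \<in> ?S d ?g e"
    then obtain k where k: "f ((assign_counted d e c)(Inr d := k)) \<noteq> 0"
      by (auto elim: Sum_any.not_neutral_obtains_not_neutral)
    have "c(d := k) \<in> ?S (Suc d) f e"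
      using PiE_Suc c k by (simp add: assign_counted_Suc)
    moreover have "c = restrict (c(d := k)) {..<d}"
      using c by (auto simp: PiE_iff extensional_def fun_eq_iff restrict_def)
    ultimately show "c \<in> (\<lambda>c. restrict c {..<d}) ` ?S (Suc d) f e" by blast
  qed
  have fin_g: "finite (?S d ?g e)" for e
    using finite_subset[OF sub] Suc.prems(2) by blast
  have "(\<Sum>c\<in>?S (Suc d) f e. f (assign_counted (Suc d) e c)) =
      (\<Sum>c\<in>?S d ?g e. ?g (assign_counted d e c))" for e
  proof -
    let ?A = "(\<lambda>c. restrict c {..<d}) ` ?S (Suc d) f e"
    let ?K = "\<lambda>c. {k. f ((assign_counted d e c)(Inr d := k)) \<noteq> 0}"
    have finA: "finite ?A" using Suc.prems(2) by simp
    have A: "c \<in> {..<d} \<rightarrow>\<^sub>E UNIV" if "c \<in> ?A" for c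
      using that by auto
    have bij: "bij_betw (\<lambda>(c, k). c(d := k)) (Sigma ?A ?K) (?S (Suc d) f e)"
    proof (rule bij_betwI[of _ _ _ "\<lambda>c. (restrict c {..<d}, c d)"])
      show "(\<lambda>(c, k). c(d := k)) \<in> Sigma ?A ?K \<rightarrow> ?S (Suc d) f e"
      proof (rule Pi_I)
        fix x assume x: "x \<in> Sigma ?A ?K"
        then obtain c k where ck: "x = (c, k)" "c \<in> ?A" "k \<in> ?K c" by blast
        then show "(\<lambda>(c, k). c(d := k)) x \<in> ?S (Suc d) f e"
          using PiE_Suc[OF A[OF ck(2)]] by (simp only: assign_counted_Suc mem_Collect_eq prod.case simp_thms)
      qed
      have upd: "(restrict c {..<d})(d := c d) = c" if "c \<in> {..<Suc d} \<rightarrow>\<^sub>E UNIV" for c :: "nat \<Rightarrow> nat"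
        using that by (auto simp: PiE_iff extensional_def fun_eq_iff restrict_def)
      then have "f ((assign_counted d e (restrict c {..<d}))(Inr d := c d)) =
          f (assign_counted (Suc d) e c)" if "c \<in> {..<Suc d} \<rightarrow>\<^sub>E UNIV" for c
        using that assign_counted_Suc[of d e "restrict c {..<d}" "c d"] by simp
      then show "(\<lambda>c. (restrict c {..<d}, c d)) \<in> ?S (Suc d) f e \<rightarrow> Sigma ?A ?K"
        by (auto simp del: fun_upd_apply)
      show "(\<lambda>c. (restrict c {..<d}, c d)) ((\<lambda>(c, k). c(d := k)) x) = x" if "x \<in> Sigma ?A ?K" for x
        using that by (auto simp: PiE_iff extensional_def fun_eq_iff restrict_def)
      show "(\<lambda>(c, k). c(d := k)) (restrict c {..<d}, c d) = c" if "c \<in> ?S (Suc d) f e" for c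
        using that upd by simp
    qed
    have "(\<Sum>c\<in>?S (Suc d) f e. f (assign_counted (Suc d) e c)) =
        (\<Sum>(c, k)\<in>Sigma ?A ?K. f (assign_counted (Suc d) e (c(d := k))))"
      using sum.reindex_bij_betw[OF bij, of "\<lambda>c. f (assign_counted (Suc d) e c)"]
      by (simp add: case_prod_unfold)
    also have "\<dots> = (\<Sum>c\<in>?A. \<Sum>k\<in>?K c. f ((assign_counted d e c)(Inr d := k)))"
      using finA fin_k by (subst sum.Sigma) (auto simp: assign_counted_Suc)
    also have "\<dots> = (\<Sum>c\<in>?A. ?g (assign_counted d e c))"
      by (simp add: Sum_any.expand_set)
    also have "\<dots> = (\<Sum>c\<in>?S d ?g e. ?g (assign_counted d e c))"
      using finA sub A by (intro sum.mono_neutral_right) auto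
    finally show ?thesis .
  qed
  moreover have "constructible (\<lambda>e. \<Sum>c\<in>?S d ?g e. ?g (assign_counted d e c))"
    by (rule Suc.IH[OF g fin_g])
  ultimately show ?case by (simp only:)
qed

text \<open>The substitution \<open>\<tau>\<close> evaluates the formula as in the definition of solutions, where the assignments are
  undefined outside of the counted variables; this makes the finiteness of the solution sets available
  in all environments.\<close>

lemma presburger_counting_vec_constructible:
  assumes "presburger_counting_function g"
  shows "vec_constructible g"
proof -
  obtain d F where fin: "\<And>p. finite (solutions d F p)"
    and g: "\<And>p. g p = of_nat (card (solutions d F p))"
    using assms unfolding presburger_counting_function_def by blast
  define \<tau> :: "('a + nat \<Rightarrow> nat) \<Rightarrow> 'a + nat \<Rightarrow> nat"
    where "\<tau> e = case_sum (\<lambda>i. e (Inl i)) (\<lambda>j. if j < d then e (Inr j) else undefined)" for e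
  have "admissible \<tau>"
  proof (rule admissible_linear)
    show "(\<lambda>e. int (\<tau> e v)) \<in> linear_forms" for v
    proof (cases v)
      case (Inr j)
      then show ?thesis by (cases "j < d") (auto simp: \<tau>_def intro: linear_intros)
    qed (auto simp: \<tau>_def intro: linear_intros)
  qed
  then have f: "constructible (\<lambda>e. of_bool (holds (\<tau> e) F))"
    by (intro constructible_of_bool definable_subst[OF definable_holds])
  have \<tau>: "\<tau> (assign_counted d e c) = case_sum (($) (\<chi> i. e (Inl i))) c" if "c \<in> {..<d} \<rightarrow>\<^sub>E UNIV" for e c
    using that by (auto simp: \<tau>_def assign_counted_def fun_eq_iff PiE_iff extensional_def split: sum.split)
  have sol: "{c \<in> {..<d} \<rightarrow>\<^sub>E UNIV. of_bool (holds (\<tau> (assign_counted d e c)) F) \<noteq> (0::rat)} =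
      solutions d F (\<chi> i. e (Inl i))" for e
    using \<tau> by (auto simp: solutions_def)
  have "(\<Sum>c\<in>solutions d F (\<chi> i. e (Inl i)). of_bool (holds (\<tau> (assign_counted d e c)) F)) =
      (\<Sum>c\<in>solutions d F (\<chi> i. e (Inl i)). (1::rat))" for e
    using \<tau> by (intro sum.cong) (auto simp: solutions_def)
  then have "constructible (\<lambda>e :: 'a + nat \<Rightarrow> nat. of_nat (card (solutions d F (\<chi> i. e (Inl i)))))"
    using constructible_sum_counted[OF f, of d, unfolded sol, OF fin] by simp
  moreover have "(\<chi> i. param_env p (Inl i)) = p" for p :: "nat ^ 'a"
    by (simp add: param_env_def)
  ultimately show ?thesis
    unfolding vec_constructible_def using g by metis
qed

section \<open>Rational generating functions and constructible coefficients\<close>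

text \<open>Linear substitutions with subtractions are admissible as long as their values stay natural numbers.\<close>

lemma admissible_guarded_linear:
  fixes \<tau> :: "('a \<Rightarrow> nat) \<Rightarrow> 'b \<Rightarrow> nat"
  assumes Q: "definable Q" and \<sigma>: "\<And>v. \<sigma> v \<in> linear_forms"
    and \<tau>: "\<And>e v. Q e \<Longrightarrow> int (\<tau> e v) = \<sigma> v e"
  shows "admissible (\<lambda>e. if Q e then \<tau> e else (\<lambda>_. 0))"
proof -
  have *: "\<exists>l'\<in>linear_forms. \<forall>e. Q e \<longrightarrow> l (\<tau> e) = l' e" if "l \<in> linear_forms" for l
    using that
  proof induction
    case (linear_const c)
    then show ?case by (intro bexI[of _ "\<lambda>_. c"]) (auto intro: linear_intros)
  next
    case (linear_var v)
    then show ?case by (intro bexI[of _ "\<sigma> v"]) (auto intro: \<sigma> \<tau>)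
  next
    case (linear_add l k)
    then obtain l' k' where "l' \<in> linear_forms" "\<forall>e. Q e \<longrightarrow> l (\<tau> e) = l' e"
      "k' \<in> linear_forms" "\<forall>e. Q e \<longrightarrow> k (\<tau> e) = k' e" by blast
    then show ?case by (intro bexI[of _ "\<lambda>e. l' e + k' e"]) (auto intro: linear_intros)
  next
    case (linear_scale l c)
    then obtain l' where "l' \<in> linear_forms" "\<forall>e. Q e \<longrightarrow> l (\<tau> e) = l' e" by blast
    then show ?case by (intro bexI[of _ "\<lambda>e. c * l' e"]) (auto intro: linear_intros)
  qed
  show ?thesis
    unfolding admissible_def
  proof (intro ballI conjI allI impI)
    fix l :: "('b \<Rightarrow> nat) \<Rightarrow> int" and m :: int
    assume "l \<in> linear_forms"
    then obtain l' where l': "l' \<in> linear_forms" "\<And>e. Q e \<Longrightarrow> l (\<tau> e) = l' e"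
      using * by blast
    have eq: "l (if Q e then \<tau> e else (\<lambda>_. 0)) = (if Q e then l' e else l (\<lambda>_. 0))" for e
      using l'(2) by simp
    have "(\<lambda>e. 0 \<le> (if Q e then l' e else l (\<lambda>_. 0))) = (\<lambda>e. if Q e then 0 \<le> l' e else 0 \<le> l (\<lambda>_. 0))"
      by auto
    then show "definable (\<lambda>e. 0 \<le> l (if Q e then \<tau> e else (\<lambda>_. 0)))"
      using definable_If[OF Q definable_nonneg[OF l'(1)] definable_const] unfolding eq by simp
    have "(\<lambda>e. rat_of_int (if Q e then l' e else l (\<lambda>_. 0))) =
        (\<lambda>e. if Q e then of_int (l' e) else of_int (l (\<lambda>_. 0)))"
      by auto
    then show "constructible (\<lambda>e. of_int (l (if Q e then \<tau> e else (\<lambda>_. 0))))"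
      using constructible_If[OF Q constructible_linear[OF l'(1)] constructible_const] unfolding eq by simp
    assume "0 < m"
    moreover have "(\<lambda>e. m dvd (if Q e then l' e else l (\<lambda>_. 0))) = (\<lambda>e. if Q e then m dvd l' e else m dvd l (\<lambda>_. 0))"
      by auto
    ultimately show "definable (\<lambda>e. m dvd l (if Q e then \<tau> e else (\<lambda>_. 0)))"
      using definable_If[OF Q definable_dvd[OF l'(1)] definable_const] unfolding eq by simp
  qed
qed

text \<open>The coefficient at \<open>p\<close> is the sum of the coefficients at \<open>p - k b\<close> over all \<open>k\<close> with \<open>k b \<le> p\<close>; the
  variable \<open>Inr 0\<close> is used for \<open>k\<close>.\<close>

lemma vec_constructible_geom_mult:
  assumes b: "b \<noteq> 0" and g: "vec_constructible g"
  shows "vec_constructible (geom_mult b g)"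
proof -
  obtain f where f: "constructible f" "\<And>p. g p = f (param_env p)"
    using g unfolding vec_constructible_def by blast
  define Q :: "('a + nat \<Rightarrow> nat) \<Rightarrow> bool"
    where "Q e \<longleftrightarrow> (\<forall>i\<in>UNIV. int (e (Inr 0)) * int (b $ i) \<le> int (e (Inl i)))" for e
  define \<tau> :: "('a + nat \<Rightarrow> nat) \<Rightarrow> 'a + nat \<Rightarrow> nat"
    where "\<tau> e = case_sum (\<lambda>i. e (Inl i) - e (Inr 0) * b $ i) (\<lambda>_. 0)" for e
  define \<sigma> :: "'a + nat \<Rightarrow> ('a + nat \<Rightarrow> nat) \<Rightarrow> int"
    where "\<sigma> = case_sum (\<lambda>i e. int (e (Inl i)) - int (e (Inr 0)) * int (b $ i)) (\<lambda>_ _. 0)"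
  have Q: "definable Q"
    unfolding Q_def by (intro definable_Ball definable_le linear_intros finite)
  have "admissible (\<lambda>e. if Q e then \<tau> e else (\<lambda>_. 0))"
  proof (rule admissible_guarded_linear[OF Q])
    show "\<sigma> v \<in> linear_forms" for v
      by (cases v) (simp_all add: \<sigma>_def linear_const linear_diff linear_scale_right linear_var)
    show "int (\<tau> e v) = \<sigma> v e" if "Q e" for e v
      using that by (auto simp: \<tau>_def \<sigma>_def Q_def of_nat_diff simp flip: of_nat_mult split: sum.split)
  qed
  then have h: "constructible (\<lambda>e. of_bool (Q e) * f (if Q e then \<tau> e else (\<lambda>_. 0)))" (is "constructible ?h")
    by (intro constructible_mult constructible_of_bool Q constructible_subst[OF f(1)])
  have Q': "Q (e(Inr 0 := k)) \<longleftrightarrow> k *s b \<le> (\<chi> i. e (Inl i))" for e k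
    by (simp add: Q_def vec_le_iff flip: of_nat_mult)
  then have supp: "{k. ?h (e(Inr 0 := k)) \<noteq> 0} \<subseteq> {k. k *s b \<le> (\<chi> i. e (Inl i))}" for e
    by (auto simp del: fun_upd_apply)
  have "finite {k. ?h (e(Inr 0 := k)) \<noteq> 0}" for e
    using supp finite_multiples_le[OF b] by (rule finite_subset)
  from constructible_Sum_any[OF h this]
  have "constructible (\<lambda>e. Sum_any (\<lambda>k. ?h (e(Inr 0 := k))))" .
  moreover have "geom_mult b g p = Sum_any (\<lambda>k. ?h ((param_env p)(Inr 0 := k)))" for p
  proof -
    have p: "(\<chi> i. param_env p (Inl i)) = p" by (simp add: param_env_def)
    have \<tau>: "\<tau> ((param_env p)(Inr 0 := k)) = param_env (p - k *s b)" for k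
      by (auto simp: \<tau>_def param_env_def fun_eq_iff split: sum.split)
    have "Sum_any (\<lambda>k. ?h ((param_env p)(Inr 0 := k))) =
        (\<Sum>k | k *s b \<le> p. ?h ((param_env p)(Inr 0 := k)))"
      using supp[of "param_env p"] finite_multiples_le[OF b, of p] unfolding p
      by (intro Sum_any.expand_superset) auto
    also have "\<dots> = (\<Sum>k | k *s b \<le> p. g (p - k *s b))"
      using Q'[of "param_env p"] unfolding p
      by (intro sum.cong) (simp_all add: \<tau> f(2) del: fun_upd_apply)
    finally show ?thesis by (simp add: geom_mult_eq_sum[OF b])
  qed
  ultimately show ?thesis
    unfolding vec_constructible_def by blast
qed

lemma rgf_vec_constructible:
  assumes "rational_generating_function g"
  shows "vec_constructible g"
proof -
  obtain bs q where *: "0 \<notin> set bs" "finite {p. q p \<noteq> 0}" "g = geom_mults bs q"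
    using assms unfolding rgf_iff by blast
  have "vec_constructible (\<lambda>p. of_bool (p = m))" for m :: "nat ^ 'a"
    by (rule vec_constructible_of_bool[where P = "\<lambda>e. \<forall>i\<in>UNIV. int (e (Inl i)) = int (m $ i)"])
      (intro definable_Ball definable_eq linear_intros finite, simp add: param_env_def vec_eq_iff)
  then have "vec_constructible (\<lambda>p. \<Sum>m | q m \<noteq> 0. q m * of_bool (p = m))"
    by (intro vec_constructible_sum vec_constructible_mult vec_constructible_const)
  moreover have "(\<Sum>m | q m \<noteq> 0. q m * of_bool (p = m)) = q p" for p
    using *(2) by (rule finite_support_expand)
  ultimately have "vec_constructible q" by (simp only:)
  with *(1) show ?thesis
    unfolding *(3) by (induction bs) (auto intro: vec_constructible_geom_mult)
qed

lemma linear_param_env: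
  assumes "l \<in> linear_forms"
  obtains c w where "additive_form w" "\<And>p. l (param_env p) = c + w p"
proof -
  have "\<exists>c w. additive_form w \<and> (\<forall>p. l (param_env p) = c + w p)"
    using assms
  proof induction
    case (linear_const c)
    then show ?case by (intro exI[of _ c] exI[of _ "\<lambda>_. 0"]) (simp add: additive_form_def)
  next
    case (linear_var v)
    show ?case
    proof (cases v)
      case (Inl i)
      then show ?thesis
        by (intro exI[of _ 0] exI[of _ "\<lambda>p. int (p $ i)"]) (simp add: additive_form_def param_env_def)
    next
      case (Inr j)
      then show ?thesis
        by (intro exI[of _ 0] exI[of _ "\<lambda>p. 0"]) (simp add: additive_form_def param_env_def)
    qed
  next
    case (linear_add l k)
    then obtain c w c' w' where "additive_form w" "\<forall>p. l (param_env p) = c + w p"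
      "additive_form w'" "\<forall>p. k (param_env p) = c' + w' p" by blast
    then show ?case
      by (intro exI[of _ "c + c'"] exI[of _ "\<lambda>p. w p + w' p"]) (simp add: additive_form_def)
  next
    case (linear_scale l a)
    then obtain c w where "additive_form w" "\<forall>p. l (param_env p) = c + w p" by blast
    then show ?case
      by (intro exI[of _ "a * c"] exI[of _ "\<lambda>p. a * w p"]) (simp add: additive_form_def algebra_simps)
  qed
  then show ?thesis using that by blast
qed

lemma rgf_mult_linear:
  assumes "l \<in> linear_forms" "rational_generating_function g"
  shows "rational_generating_function (\<lambda>p. of_int (l (param_env p)) * g p)"
  using assms(1)
proof induction
  case (linear_const c)
  show ?case by (rule rgf_scale[OF assms(2)])
next
  case (linear_var v)
  show ?case
    by (cases v) (simp_all add: param_env_def rgf_mult_coordinate[OF assms(2)] rgf_zero)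
next
  case (linear_add l k)
  from rgf_add[OF linear_add.IH] show ?case by (simp add: distrib_right)
next
  case (linear_scale l c)
  from rgf_scale[OF linear_scale.IH, of "of_int c"] show ?case by (simp add: mult.assoc)
qed

lemma rgf_mult_definable:
  "definable P \<Longrightarrow> rational_generating_function g \<Longrightarrow>
    rational_generating_function (\<lambda>p. of_bool (P (param_env p)) * g p)"
proof (induction arbitrary: g rule: definable.induct)
  case (definable_nonneg l)
  obtain c w where w: "additive_form w" "\<And>p. l (param_env p) = c + w p"
    using linear_param_env[OF definable_nonneg(1)] by metis
  have "0 \<le> l (param_env p) \<longleftrightarrow> - c \<le> w p" for p
    using w(2)[of p] by linarith
  then show ?case
    using rgf_mult_by_cone_series[OF rgf_half_space_cone_series[OF w(1), of _ "- c"] definable_nonneg(2)]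
    by simp
next
  case (definable_dvd l m)
  obtain c w where w: "additive_form w" "\<And>p. l (param_env p) = c + w p"
    using linear_param_env[OF definable_dvd(1)] by metis
  show ?case
    using rgf_mult_by_cone_series[OF rgf_dvd_cone_series[OF w(1) definable_dvd(2), of _ c] definable_dvd(3)]
    by (simp add: w(2))
next
  case (definable_not P)
  from rgf_diff[OF definable_not.prems definable_not.IH[OF definable_not.prems]]
  show ?case by (simp add: of_bool_not_iff left_diff_distrib)
next
  case (definable_conj P Q)
  from definable_conj.IH(1)[OF definable_conj.IH(2)[OF definable_conj.prems]]
  show ?case by (simp add: of_bool_conj mult.assoc)
qed

lemma rgf_mult_constructible:
  "constructible f \<Longrightarrow> rational_generating_function g \<Longrightarrow>
    rational_generating_function (\<lambda>p. f (param_env p) * g p)"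
proof (induction arbitrary: g rule: constructible.induct)
  case (constructible_const c)
  then show ?case by (rule rgf_scale)
next
  case (constructible_linear l)
  then show ?case by (rule rgf_mult_linear)
next
  case (constructible_of_bool P)
  then show ?case by (rule rgf_mult_definable)
next
  case (constructible_add f f')
  from rgf_add[OF constructible_add.IH(1)[OF constructible_add.prems]
    constructible_add.IH(2)[OF constructible_add.prems]]
  show ?case by (simp add: distrib_right)
next
  case (constructible_mult f f')
  from constructible_mult.IH(1)[OF constructible_mult.IH(2)[OF constructible_mult.prems]]
  show ?case by (simp add: mult.assoc)
qed

lemma vec_constructible_rgf:
  assumes "vec_constructible g"
  shows "rational_generating_function g"
proof -
  obtain f where "constructible f" "\<And>p. g p = f (param_env p)"
    using assms unfolding vec_constructible_def by blast
  moreover from this have "g = (\<lambda>p. f (param_env p))" by blast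
  ultimately show ?thesis using rgf_mult_constructible[OF _ rgf_one, of f] by simp
qed

section \<open>Polynomial functions of a vector\<close>

abbreviation eval_nat :: "(rat, 'n::finite) mpoly \<Rightarrow> nat ^ 'n \<Rightarrow> rat" where
  "eval_nat q p \<equiv> mpoly_eval q (map_vec of_nat p)"

lemma eval_nat_superset:
  assumes "finite A" "Poly_Mapping.keys q \<subseteq> A"
  shows "eval_nat q p = (\<Sum>m\<in>A. Poly_Mapping.lookup q m * (\<Prod>i\<in>UNIV. of_nat (p $ i) ^ (m $ i)))"
  unfolding mpoly_eval_def using assms
  by (intro sum.mono_neutral_cong_left) (auto simp: map_vec_def in_keys_iff)

lemma eval_nat_add: "eval_nat (q + r) p = eval_nat q p + eval_nat r p"
proof -
  let ?A = "Poly_Mapping.keys q \<union> Poly_Mapping.keys r"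
  have "eval_nat (q + r) p =
      (\<Sum>m\<in>?A. Poly_Mapping.lookup (q + r) m * (\<Prod>i\<in>UNIV. of_nat (p $ i) ^ (m $ i)))"
    by (rule eval_nat_superset) (auto simp: Poly_Mapping.keys_add)
  also have "\<dots> = eval_nat q p + eval_nat r p"
    by (simp add: lookup_add distrib_right sum.distrib eval_nat_superset[of ?A])
  finally show ?thesis .
qed

lemma eval_nat_single:
  "eval_nat (Poly_Mapping.single m c) p = c * (\<Prod>i\<in>UNIV. of_nat (p $ i) ^ (m $ i))"
  by (subst eval_nat_superset[of "{m}"]) auto

text \<open>The functions on \<open>\<nat>\<^sup>n\<close> induced by formal polynomials, for which closure under sums and products is easier
  to state than for the formal polynomials.\<close>

definition polynomial_function :: "(nat ^ 'n::finite \<Rightarrow> rat) \<Rightarrow> bool" where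
  "polynomial_function f \<longleftrightarrow> (\<exists>q. \<forall>p. f p = eval_nat q p)"

lemma polynomial_function_add:
  assumes "polynomial_function f" "polynomial_function g"
  shows "polynomial_function (\<lambda>p. f p + g p)"
  using assms unfolding polynomial_function_def by (metis eval_nat_add)

lemma polynomial_function_monomial:
  "polynomial_function (\<lambda>p. c * (\<Prod>i\<in>UNIV. of_nat (p $ i) ^ (m $ i)))"
  unfolding polynomial_function_def using eval_nat_single by metis

lemma polynomial_function_const: "polynomial_function (\<lambda>p. c)"
  using polynomial_function_monomial[of c 0] by simp

lemma polynomial_function_sum:
  "(\<And>i. i \<in> I \<Longrightarrow> polynomial_function (f i)) \<Longrightarrow> polynomial_function (\<lambda>p. \<Sum>i\<in>I. f i p)"
  by (induction I rule: infinite_finite_induct)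
    (auto intro: polynomial_function_const polynomial_function_add)

lemma polynomial_function_mult:
  assumes "polynomial_function f" "polynomial_function g"
  shows "polynomial_function (\<lambda>p. f p * g p)"
proof -
  obtain q r where q: "\<And>p. f p = eval_nat q p" "\<And>p. g p = eval_nat r p"
    using assms unfolding polynomial_function_def by blast
  have "f p * g p = (\<Sum>m\<in>Poly_Mapping.keys q. \<Sum>n\<in>Poly_Mapping.keys r.
      (Poly_Mapping.lookup q m * Poly_Mapping.lookup r n) * (\<Prod>i\<in>UNIV. of_nat (p $ i) ^ ((m + n) $ i)))" for p
    unfolding q mpoly_eval_def sum_product
    by (intro sum.cong) (simp_all add: map_vec_def power_add prod.distrib ac_simps)
  then show ?thesis
    by (simp only:) (intro polynomial_function_sum polynomial_function_monomial)
qed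

lemma polynomial_function_coordinate: "polynomial_function (\<lambda>p. of_nat (p $ i))"
proof -
  have "(\<Prod>j\<in>UNIV. of_nat (p $ j) ^ (axis i 1 $ j)) = (of_nat (p $ i) :: rat)" for p :: "nat ^ 'a"
  proof -
    have "(\<Prod>j\<in>UNIV. of_nat (p $ j) ^ (axis i 1 $ j)) =
        (\<Prod>j\<in>UNIV. if j = i then of_nat (p $ j) else (1 :: rat))"
      by (intro prod.cong) (auto simp: axis_def)
    then show ?thesis by simp
  qed
  with polynomial_function_monomial[of 1 "axis i 1"] show ?thesis by simp
qed

section \<open>Constructible functions are piecewise quasi-polynomials\<close>

definition affine_form :: "(int ^ 'n::finite) \<times> int \<Rightarrow> nat ^ 'n \<Rightarrow> int" where
  "affine_form = (\<lambda>(a, c) p. (\<Sum>i\<in>UNIV. a $ i * int (p $ i)) + c)"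

text \<open>For suitable \<open>A\<close> and \<open>M\<close>, a constructible function agrees with one polynomial on each of these cells.\<close>

definition same_cell :: "((int ^ 'n::finite) \<times> int) set \<Rightarrow> nat \<Rightarrow> nat ^ 'n \<Rightarrow> nat ^ 'n \<Rightarrow> bool" where
  "same_cell A M p p' \<longleftrightarrow> (\<forall>l\<in>A. 0 \<le> affine_form l p \<longleftrightarrow> 0 \<le> affine_form l p') \<and>
     (\<forall>i. p $ i mod M = p' $ i mod M)"

lemma linear_param_env_affine:
  assumes "l \<in> linear_forms"
  shows "\<exists>a. \<forall>p. l (param_env p) = affine_form a p"
  using assms
proof induction
  case (linear_const c)
  then show ?case by (intro exI[of _ "(0, c)"]) (simp add: affine_form_def)
next
  case (linear_var v)
  show ?case
  proof (cases v)
    case (Inl i)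
    have "(\<Sum>j\<in>UNIV. axis i 1 $ j * int (p $ j)) = int (p $ i)" for p :: "nat ^ 'a"
    proof -
      have "(\<Sum>j\<in>UNIV. axis i 1 $ j * int (p $ j)) = (\<Sum>j\<in>UNIV. if j = i then int (p $ j) else 0)"
        by (intro sum.cong) (auto simp: axis_def)
      then show ?thesis by simp
    qed
    with Inl show ?thesis by (intro exI[of _ "(axis i 1, 0)"]) (simp add: affine_form_def param_env_def)
  next
    case (Inr j)
    then show ?thesis by (intro exI[of _ "(0, 0)"]) (simp add: affine_form_def param_env_def)
  qed
next
  case (linear_add l k)
  then obtain a b where "\<forall>p. l (param_env p) = affine_form a p" "\<forall>p. k (param_env p) = affine_form b p"
    by blast
  then show ?case
    by (intro exI[of _ "a + b"])
      (simp add: affine_form_def case_prod_unfold distrib_right sum.distrib)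
next
  case (linear_scale l c)
  then obtain a where "\<forall>p. l (param_env p) = affine_form a p" by blast
  then show ?case
    by (intro exI[of _ "(c *s fst a, c * snd a)"])
      (simp add: affine_form_def case_prod_unfold distrib_left sum_distrib_left mult.assoc)
qed

lemma same_cell_mono: "same_cell (A \<union> B) (M * N) p p' \<Longrightarrow> same_cell A M p p' \<and> same_cell B N p p'"
  unfolding same_cell_def by (metis Un_iff dvd_triv_left dvd_triv_right mod_mod_cancel)

lemma definable_cells:
  assumes "definable P"
  shows "\<exists>A M. finite A \<and> M > 0 \<and>
    (\<forall>p p'. same_cell A M p p' \<longrightarrow> P (param_env p) = P (param_env p'))"
  using assms
proof induction
  case (definable_nonneg l)
  then obtain a where "\<And>p. l (param_env p) = affine_form a p"
    using linear_param_env_affine by blast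
  then show ?case
    by (intro exI[of _ "{a}"] exI[of _ 1]) (simp add: same_cell_def)
next
  case (definable_dvd l m)
  then obtain a where a: "\<And>p. l (param_env p) = affine_form a p"
    using linear_param_env_affine by blast
  have "m dvd affine_form a p \<longleftrightarrow> m dvd affine_form a p'" if "same_cell {} (nat m) p p'" for p p'
  proof -
    have "int (p $ i) mod m = int (p' $ i) mod m" for i
    proof -
      have "p $ i mod nat m = p' $ i mod nat m" using that by (simp add: same_cell_def)
      from arg_cong[OF this, of int] show ?thesis using definable_dvd(2) by (simp add: zmod_int)
    qed
    then have d: "m dvd (\<Sum>i\<in>UNIV. fst a $ i * (int (p $ i) - int (p' $ i)))"
      by (intro dvd_sum) (simp add: mod_eq_dvd_iff)
    have eq: "affine_form a p = affine_form a p' + (\<Sum>i\<in>UNIV. fst a $ i * (int (p $ i) - int (p' $ i)))"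
      by (simp add: affine_form_def case_prod_unfold right_diff_distrib sum_subtractf)
    show ?thesis by (simp only: eq dvd_add_left_iff[OF d])
  qed
  with definable_dvd(2) show ?case
    unfolding a by (intro exI[of _ "{}"] exI[of _ "nat m"] conjI) (auto simp only: finite.emptyI zero_less_nat_eq)
next
  case (definable_not P)
  then show ?case by simp
next
  case (definable_conj P Q)
  from definable_conj.IH(1) obtain A M where A: "finite A" "M > 0"
    "\<And>p p'. same_cell A M p p' \<Longrightarrow> P (param_env p) = P (param_env p')" by blast
  from definable_conj.IH(2) obtain B N where B: "finite B" "N > 0"
    "\<And>p p'. same_cell B N p p' \<Longrightarrow> Q (param_env p) = Q (param_env p')" by blast
  have "(P (param_env p) \<and> Q (param_env p)) = (P (param_env p') \<and> Q (param_env p'))"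
    if "same_cell (A \<union> B) (M * N) p p'" for p p'
    using same_cell_mono[OF that] A(3) B(3) by blast
  with A B show ?case
    by (intro exI[of _ "A \<union> B"] exI[of _ "M * N"] conjI) (blast | simp)+
qed

lemma constructible_cells:
  assumes "constructible f"
  shows "\<exists>A M. finite A \<and> M > 0 \<and> (\<forall>p0. \<exists>h. polynomial_function h \<and>
    (\<forall>p. same_cell A M p p0 \<longrightarrow> f (param_env p) = h p))"
  using assms
proof induction
  case (constructible_const c)
  then show ?case
    by (intro exI[of _ "{}"] exI[of _ 1] conjI allI exI[of _ "\<lambda>p. c"]) (auto intro: polynomial_function_const)
next
  case (constructible_linear l)
  then obtain a where a: "\<And>p. l (param_env p) = affine_form a p"
    using linear_param_env_affine by blast
  have "polynomial_function (\<lambda>p. (\<Sum>i\<in>UNIV. of_int (fst a $ i) * of_nat (p $ i)) + of_int (snd a))"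
    by (intro polynomial_function_add polynomial_function_sum polynomial_function_mult
        polynomial_function_const polynomial_function_coordinate)
  then show ?case
    by (intro exI[of _ "{}"] exI[of _ 1] conjI allI
        exI[of _ "\<lambda>p. (\<Sum>i\<in>UNIV. of_int (fst a $ i) * of_nat (p $ i)) + of_int (snd a)"])
      (auto simp: a affine_form_def case_prod_unfold)
next
  case (constructible_of_bool P)
  then obtain A M where A: "finite A" "M > 0"
    "\<And>p p'. same_cell A M p p' \<Longrightarrow> P (param_env p) = P (param_env p')"
    using definable_cells[OF constructible_of_bool] by blast
  have "\<exists>h. polynomial_function h \<and> (\<forall>p. same_cell A M p p0 \<longrightarrow> of_bool (P (param_env p)) = h p)" for p0
    by (intro exI[of _ "\<lambda>p. of_bool (P (param_env p0))"] conjI allI impI polynomial_function_const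
        arg_cong[of _ _ of_bool] A(3))
  with A show ?case by blast
next
  case (constructible_add f g)
  from constructible_add.IH(1) obtain A M where A: "finite A" "M > 0"
    "\<And>p0. \<exists>h. polynomial_function h \<and> (\<forall>p. same_cell A M p p0 \<longrightarrow> f (param_env p) = h p)" by blast
  from constructible_add.IH(2) obtain B N where B: "finite B" "N > 0"
    "\<And>p0. \<exists>h. polynomial_function h \<and> (\<forall>p. same_cell B N p p0 \<longrightarrow> g (param_env p) = h p)" by blast
  have "\<exists>h. polynomial_function h \<and> (\<forall>p. same_cell (A \<union> B) (M * N) p p0 \<longrightarrow>
      f (param_env p) + g (param_env p) = h p)" for p0
  proof -
    obtain h h' where
      "polynomial_function h" "\<And>p. same_cell A M p p0 \<Longrightarrow> f (param_env p) = h p"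
      "polynomial_function h'" "\<And>p. same_cell B N p p0 \<Longrightarrow> g (param_env p) = h' p"
      using A(3)[of p0] B(3)[of p0] by blast
    then show ?thesis
      by (intro exI[of _ "\<lambda>p. h p + h' p"] conjI polynomial_function_add) (auto dest: same_cell_mono)
  qed
  with A B show ?case
    by (intro exI[of _ "A \<union> B"] exI[of _ "M * N"] conjI) (blast | simp)+
next
  case (constructible_mult f g)
  from constructible_mult.IH(1) obtain A M where A: "finite A" "M > 0"
    "\<And>p0. \<exists>h. polynomial_function h \<and> (\<forall>p. same_cell A M p p0 \<longrightarrow> f (param_env p) = h p)" by blast
  from constructible_mult.IH(2) obtain B N where B: "finite B" "N > 0"
    "\<And>p0. \<exists>h. polynomial_function h \<and> (\<forall>p. same_cell B N p p0 \<longrightarrow> g (param_env p) = h p)" by blast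
  have "\<exists>h. polynomial_function h \<and> (\<forall>p. same_cell (A \<union> B) (M * N) p p0 \<longrightarrow>
      f (param_env p) * g (param_env p) = h p)" for p0
  proof -
    obtain h h' where
      "polynomial_function h" "\<And>p. same_cell A M p p0 \<Longrightarrow> f (param_env p) = h p"
      "polynomial_function h'" "\<And>p. same_cell B N p p0 \<Longrightarrow> g (param_env p) = h' p"
      using A(3)[of p0] B(3)[of p0] by blast
    then show ?thesis
      by (intro exI[of _ "\<lambda>p. h p * h' p"] conjI polynomial_function_mult) (auto dest: same_cell_mono)
  qed
  with A B show ?case
    by (intro exI[of _ "A \<union> B"] exI[of _ "M * N"] conjI) (blast | simp)+
qed

text \<open>The multiples of \<open>M\<close> contain \<open>M\<close> times the standard basis.\<close>

lemma multiples_lattice: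
  assumes "M > 0"
  shows "full_rank_lattice {v :: int ^ 'n. \<forall>i. int M dvd v $ i}"
proof -
  let ?R = "map_vec real_of_int ` {v :: int ^ 'n. \<forall>i. int M dvd v $ i}"
  have "axis i 1 \<in> span ?R" for i :: 'n
  proof -
    have "map_vec real_of_int (axis i (int M)) \<in> span ?R"
      by (intro span_base imageI) (simp add: axis_def)
    moreover have "(1 / real M) *\<^sub>R map_vec real_of_int (axis i (int M)) = axis i 1"
      using assms by (simp add: map_vec_def axis_def vec_eq_iff)
    ultimately show ?thesis by (metis span_scale)
  qed
  then have "Basis \<subseteq> span ?R"
    by (auto simp: Basis_vec_def)
  then have "span ?R = UNIV"
    by (metis span_Basis span_mono span_span top.extremum_uniqueI)
  then have "dim ?R = CARD('n)"
    by (metis dim_UNIV dim_span DIM_cart DIM_real mult.right_neutral)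
  then show ?thesis
    by (auto simp: full_rank_lattice_def)
qed

text \<open>A coset of \<open>M \<int>\<^sup>n\<close> determines the residues of its points, which can be read off from any of its elements.\<close>

lemma quasi_polynomial_residues:
  assumes "M > 0"
  shows "quasi_polynomial (\<lambda>p. eval_nat (q (\<chi> i. p $ i mod M)) p)"
proof -
  let ?L = "{v :: int ^ 'a. \<forall>i. int M dvd v $ i}"
  \<comment> \<open>The choice of the element of \<open>C\<close> is irrelevant, because all of them have the same residues.\<close>
  define Q where "Q C = q (\<chi> i. nat ((SOME v. v \<in> C) $ i mod int M))" for C :: "(int ^ 'a) set"
  have "Q C = q (\<chi> i. p $ i mod M)" if coset: "C \<in> cosets ?L" and p: "map_vec int p \<in> C" for C p
  proof -
    obtain u where C: "C = (+) u ` ?L" using coset by (auto simp: cosets_def)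
    define v where "v = (SOME v. v \<in> C)"
    have "v \<in> C" unfolding v_def using p by (rule someI)
    then obtain x y where "v = u + x" "map_vec int p = u + y" "x \<in> ?L" "y \<in> ?L"
      using p unfolding C by blast
    then have "int M dvd v $ i - int (p $ i)" for i
    proof -
      have "int (p $ i) = u $ i + y $ i"
        using \<open>map_vec int p = u + y\<close> by (metis map_vec_def vec_lambda_beta vector_add_component)
      then have "v $ i - int (p $ i) = x $ i - y $ i" using \<open>v = u + x\<close> by simp
      then show ?thesis using \<open>x \<in> ?L\<close> \<open>y \<in> ?L\<close> by simp
    qed
    then have "v $ i mod int M = int (p $ i mod M)" for i
      by (metis mod_eq_dvd_iff of_nat_mod)
    then show ?thesis by (simp add: Q_def flip: v_def)
  qed
  then show ?thesis
    unfolding quasi_polynomial_def using multiples_lattice[OF assms]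
    by (intro exI[of _ ?L] exI[of _ Q] conjI ballI allI impI) simp_all
qed

lemma inner_of_int_vec:
  "map_vec of_rat (map_vec of_int a) \<bullet> map_vec real p = of_int (\<Sum>i\<in>UNIV. a $ i * int (p $ i))"
  by (simp add: inner_vec_def map_vec_def)

lemma Collect_restrict_eq_iff:
  "S \<subseteq> A \<Longrightarrow> {l\<in>A. N l} = S \<longleftrightarrow> (\<forall>l\<in>S. N l) \<and> (\<forall>l\<in>A - S. \<not> N l)"
  by auto

text \<open>At integer points, the strict inequality \<open>l < 0\<close> for an integral form is the non-strict inequality
  \<open>l \<le> -1\<close>.\<close>

lemma sign_cell_polyhedron:
  assumes "finite A" "S \<subseteq> A"
  shows "\<exists>P. rational_polyhedron P \<and> nat_points P = {p. {l\<in>A. 0 \<le> affine_form l p} = S}"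
proof -
  define T :: "((rat ^ 'a) \<times> rat) set" where
    "T = (\<lambda>(a, c). (map_vec of_int (- a), of_int c)) ` S \<union>
         (\<lambda>(a, c). (map_vec of_int a, of_int (- c - 1))) ` (A - S)"
  define P :: "(real ^ 'a) set" where "P = {x. \<forall>(a, b)\<in>T. map_vec of_rat a \<bullet> x \<le> of_rat b}"
  have "finite T" using assms finite_subset[OF assms(2,1)] by (simp add: T_def)
  then have "rational_polyhedron P" unfolding rational_polyhedron_def P_def by blast
  moreover have "p \<in> nat_points P \<longleftrightarrow> {l\<in>A. 0 \<le> affine_form l p} = S" for p
  proof -
    have "p \<in> nat_points P \<longleftrightarrow> (\<forall>l\<in>S. 0 \<le> affine_form l p) \<and> (\<forall>l\<in>A - S. affine_form l p < 0)"
    proof -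
      have 1: "map_vec of_rat (map_vec of_int (- a) :: rat ^ 'a) \<bullet> map_vec real p \<le> of_rat (of_int c) \<longleftrightarrow>
          0 \<le> affine_form (a, c) p" for a c
      proof -
        have "map_vec of_rat (map_vec of_int (- a) :: rat ^ 'a) \<bullet> map_vec real p \<le> of_rat (of_int c) \<longleftrightarrow>
            (\<Sum>i\<in>UNIV. (- a) $ i * int (p $ i)) \<le> c"
          unfolding inner_of_int_vec of_rat_of_int_eq of_int_le_iff ..
        also have "\<dots> \<longleftrightarrow> 0 \<le> affine_form (a, c) p"
          by (simp add: affine_form_def sum_negf) linarith
        finally show ?thesis .
      qed
      have 2: "map_vec of_rat (map_vec of_int a :: rat ^ 'a) \<bullet> map_vec real p \<le> of_rat (of_int (- c - 1)) \<longleftrightarrow>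
          affine_form (a, c) p < 0" for a c
        unfolding inner_of_int_vec of_rat_of_int_eq of_int_le_iff by (auto simp: affine_form_def)
      show ?thesis
        unfolding nat_points_def P_def T_def
        by (simp only: mem_Collect_eq ball_Un ball_simps split_beta fst_conv snd_conv 1 2 prod.collapse)
    qed
    also have "\<dots> \<longleftrightarrow> {l\<in>A. 0 \<le> affine_form l p} = S"
      unfolding not_le[symmetric] Collect_restrict_eq_iff[OF assms(2)] ..
    finally show ?thesis .
  qed
  ultimately show ?thesis by blast
qed

text \<open>The pieces are the sign cells, one for each set \<open>S\<close> of forms that are nonnegative. On each piece the
  polynomial belonging to a residue vector is the one attached to some point of that cell.\<close>

lemma vec_constructible_piecewise_quasi_polynomial:
  assumes "vec_constructible g"
  shows "piecewise_quasi_polynomial g"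
proof -
  obtain f where f: "constructible f" "\<And>p. g p = f (param_env p)"
    using assms unfolding vec_constructible_def by blast
  obtain A M where A: "finite A" "M > 0" and
    "\<And>p0. \<exists>h. polynomial_function h \<and> (\<forall>p. same_cell A M p p0 \<longrightarrow> f (param_env p) = h p)"
    using constructible_cells[OF f(1)] by blast
  then have "\<forall>p0. \<exists>q. \<forall>p. same_cell A M p p0 \<longrightarrow> f (param_env p) = eval_nat q p"
    unfolding polynomial_function_def by metis
  then obtain q where q: "\<And>p p0. same_cell A M p p0 \<Longrightarrow> g p = eval_nat (q p0) p"
    unfolding f(2) by metis
  define sgns where "sgns p = {l\<in>A. 0 \<le> affine_form l p}" for p
  define res where "res p = (\<chi> i. p $ i mod M)" for p :: "nat ^ 'a"
  define rep where "rep S r = (SOME p. sgns p = S \<and> res p = r)" for S r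
  have rep: "g p = eval_nat (q (rep (sgns p) (res p))) p" for p
  proof -
    define p' where "p' = rep (sgns p) (res p)"
    have "sgns p' = sgns p \<and> res p' = res p"
      unfolding p'_def rep_def by (rule someI_ex) blast
    then have "sgns p = sgns p'" "res p = res p'" by simp_all
    then have "same_cell A M p p'"
      unfolding same_cell_def sgns_def res_def vec_eq_iff set_eq_iff mem_Collect_eq vec_lambda_beta
      by blast
    from q[OF this] show ?thesis unfolding p'_def .
  qed
  have "\<forall>S\<in>Pow A. \<exists>P. rational_polyhedron P \<and> nat_points P = {p. sgns p = S}"
    unfolding sgns_def by (intro ballI sign_cell_polyhedron A(1)) (rule PowD)
  then obtain P where P: "\<And>S. S \<in> Pow A \<Longrightarrow> rational_polyhedron (P S)"
    "\<And>S. S \<in> Pow A \<Longrightarrow> nat_points (P S) = {p. sgns p = S}"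
    by metis
  obtain e where e: "bij_betw e {0..<card (Pow A)} (Pow A)"
    using ex_bij_betw_nat_finite[of "Pow A"] A(1) by auto
  let ?k = "card (Pow A)"
  have e_in: "e i \<in> Pow A" if "i < ?k" for i
    using e that by (auto simp: bij_betw_def)
  have pts: "nat_points (P (e i)) = {p. sgns p = e i}" if "i < ?k" for i
    using P(2)[OF e_in[OF that]] .
  have "disjoint_family_on (\<lambda>i. nat_points (P (e i))) {..<?k}"
    unfolding disjoint_family_on_def
  proof (intro ballI impI)
    fix i j assume "i \<in> {..<?k}" "j \<in> {..<?k}" "i \<noteq> j"
    moreover from this have "e i \<noteq> e j"
      using e by (auto simp: bij_betw_def inj_on_def)
    ultimately show "nat_points (P (e i)) \<inter> nat_points (P (e j)) = {}"
      using pts by auto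
  qed
  moreover have "(\<Union>i<?k. nat_points (P (e i))) = UNIV"
  proof -
    have "p \<in> (\<Union>i<?k. nat_points (P (e i)))" for p
    proof -
      have "sgns p \<in> e ` {0..<?k}"
        using bij_betw_imp_surj_on[OF e] by (auto simp: sgns_def)
      then obtain i where "i < ?k" "sgns p = e i" by auto
      then show ?thesis using pts by auto
    qed
    then show ?thesis by blast
  qed
  moreover have "quasi_polynomial (\<lambda>p. eval_nat (q (rep (e i) (res p))) p)" for i
    unfolding res_def using quasi_polynomial_residues[OF A(2), of "\<lambda>r. q (rep (e i) r)"] by simp
  moreover have "g p = eval_nat (q (rep (e i) (res p))) p" if "i < ?k" "p \<in> nat_points (P (e i))" for i p
    using rep[of p] pts[OF that(1)] that(2) by simp
  ultimately show ?thesis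
    unfolding piecewise_quasi_polynomial_def using P(1) e_in
    by (intro exI[of _ ?k] exI[of _ "\<lambda>i. P (e i)"] exI[of _ "\<lambda>i p. eval_nat (q (rep (e i) (res p))) p"])
      blast
qed

section \<open>Piecewise quasi-polynomials are constructible\<close>

lemma common_denominator:
  fixes A :: "rat set"
  assumes "finite A"
  shows "\<exists>D>0. \<forall>a\<in>A. \<exists>z. of_int D * a = of_int z"
  using assms
proof induction
  case (insert x A)
  then obtain D where D: "D > 0" "\<forall>a\<in>A. \<exists>z. of_int D * a = of_int z" by blast
  obtain n d where x: "x = of_int n / of_int d" "d > 0"
    using quotient_of_div[of x] quotient_of_denom_pos[of x] by (cases "quotient_of x") blast
  have "\<exists>z. of_int (D * d) * a = of_int z" if "a \<in> insert x A" for a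
  proof (cases "a = x")
    case True
    then show ?thesis using x by (intro exI[of _ "D * n"]) simp
  next
    case False
    with that have "a \<in> A" by simp
    with D(2) obtain z where "of_int D * a = of_int z" by blast
    moreover have "of_int (D * d) * a = of_int d * (of_int D * a)" by simp
    ultimately show ?thesis by (intro exI[of _ "d * z"]) simp
  qed
  then show ?case using D(1) x(2) by (intro exI[of _ "D * d"]) simp
qed (auto intro: exI[of _ 1])

lemma rational_inequality_linear:
  fixes a :: "rat ^ 'n"
  shows "\<exists>l\<in>linear_forms. \<forall>p. map_vec of_rat a \<bullet> map_vec real p \<le> of_rat b \<longleftrightarrow> 0 \<le> l (param_env p)"
proof -
  have "finite (insert b (range (($) a)))" by simp
  from common_denominator[OF this] obtain D where
    D: "D > 0" "\<forall>x\<in>insert b (range (($) a)). \<exists>z. of_int D * x = of_int z" by blast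
  then obtain y where y: "of_int D * b = of_int y" by blast
  from D(2) have "\<forall>i. \<exists>z. of_int D * a $ i = of_int z" by blast
  then obtain z where z: "\<And>i. of_int D * a $ i = of_int (z i)" by metis
  let ?l = "\<lambda>e. y - (\<Sum>i\<in>UNIV. z i * int (e (Inl i)))"
  have "map_vec of_rat a \<bullet> map_vec real p \<le> of_rat b \<longleftrightarrow> 0 \<le> ?l (param_env p)" for p
  proof -
    have b: "real_of_int D * of_rat b = of_int y"
      using arg_cong[OF y, of "of_rat :: rat \<Rightarrow> real"] by (simp add: of_rat_mult)
    have a: "real_of_int D * of_rat (a $ i) = of_int (z i)" for i
      using arg_cong[OF z[of i], of "of_rat :: rat \<Rightarrow> real"] by (simp add: of_rat_mult)
    have "map_vec of_rat a \<bullet> map_vec real p \<le> of_rat b \<longleftrightarrow>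
        real_of_int D * (map_vec of_rat a \<bullet> map_vec real p) \<le> real_of_int D * of_rat b"
      using D(1) by simp
    also have "real_of_int D * (map_vec of_rat a \<bullet> map_vec real p) = of_int (\<Sum>i\<in>UNIV. z i * int (p $ i))"
      by (simp add: inner_vec_def map_vec_def sum_distrib_left a flip: mult.assoc)
    also have "\<dots> \<le> real_of_int D * of_rat b \<longleftrightarrow> 0 \<le> ?l (param_env p)"
      unfolding b of_int_le_iff by (simp add: param_env_def)
    finally show ?thesis .
  qed
  moreover have "?l \<in> linear_forms"
    by (intro linear_diff linear_const linear_sum linear_scale linear_var)
  ultimately show ?thesis by (intro bexI[of _ ?l] allI)
qed

lemma rational_polyhedron_constructible:
  fixes P :: "(real ^ 'n) set"
  assumes "rational_polyhedron P"
  shows "vec_constructible (\<lambda>p. of_bool (p \<in> nat_points P))"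
proof -
  obtain S where S: "finite S" "P = {x. \<forall>(a, b)\<in>S. map_vec of_rat a \<bullet> x \<le> of_rat b}"
    using assms unfolding rational_polyhedron_def by blast
  have "\<forall>c. \<exists>l\<in>linear_forms. \<forall>p. map_vec of_rat (fst c) \<bullet> map_vec real p \<le> of_rat (snd c) \<longleftrightarrow>
      0 \<le> l (param_env p)" for c :: "(rat ^ 'n) \<times> rat"
    using rational_inequality_linear by blast
  then obtain l :: "(rat ^ 'n) \<times> rat \<Rightarrow> ('n + nat \<Rightarrow> nat) \<Rightarrow> int" where l: "\<And>c. l c \<in> linear_forms"
    "\<And>c p. map_vec of_rat (fst c) \<bullet> map_vec real p \<le> of_rat (snd c) \<longleftrightarrow> 0 \<le> l c (param_env p)"
    by metis
  show ?thesis
  proof (rule vec_constructible_of_bool)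
    show "definable (\<lambda>e. \<forall>c\<in>S. 0 \<le> l c e)"
      by (intro definable_Ball definable_nonneg S(1) l(1))
    show "p \<in> nat_points P \<longleftrightarrow> (\<forall>c\<in>S. 0 \<le> l c (param_env p))" for p
      by (simp add: nat_points_def S(2) case_prod_unfold l(2))
  qed
qed

text \<open>Let the columns of \<open>A\<close> be linearly independent vectors of \<open>L\<close>. By Cramer's rule, the solution \<open>x\<close> of
  \<open>A x = v\<close> becomes integral when multiplied by \<open>D = det A\<close>; so \<open>D v\<close> is an integral combination of the
  columns, and \<open>D \<int>\<^sup>n \<subseteq> L\<close>.\<close>

lemma full_rank_lattice_multiples:
  fixes L :: "(int ^ 'n) set"
  assumes "full_rank_lattice L"
  obtains M :: nat where "M > 0" "\<And>v. (\<And>i. int M dvd v $ i) \<Longrightarrow> v \<in> L"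
proof -
  let ?R = "map_vec real_of_int"
  have L0: "0 \<in> L" and diff: "\<And>x y. x \<in> L \<Longrightarrow> y \<in> L \<Longrightarrow> x - y \<in> L"
    and dim: "dim (?R ` L) = CARD('n)"
    using assms by (auto simp: full_rank_lattice_def)
  have add: "x + y \<in> L" if "x \<in> L" "y \<in> L" for x y
    using diff[OF that(1) diff[OF L0 that(2)]] by simp
  have scale_nat: "int k *s x \<in> L" if "x \<in> L" for x k
  proof (induction k)
    case 0
    have "int 0 *s x = 0" by (simp add: vec_eq_iff)
    with L0 show ?case by simp
  next
    case (Suc k)
    have "int (Suc k) *s x = x + int k *s x" by (simp add: vec_eq_iff algebra_simps)
    with Suc add that show ?case by simp
  qed
  have scale: "c *s x \<in> L" if "x \<in> L" for x c
  proof (cases "c \<ge> 0")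
    case True
    then show ?thesis using scale_nat[OF that, of "nat c"] by simp
  next
    case False
    then have "c *s x = 0 - int (nat (- c)) *s x" by (simp add: vec_eq_iff)
    then show ?thesis using diff[OF L0 scale_nat[OF that, of "nat (- c)"]] by simp
  qed
  have sum: "(\<Sum>i\<in>I. f i) \<in> L" if "\<And>i. f i \<in> L" for f :: "'n \<Rightarrow> int ^ 'n" and I
    by (induction I rule: infinite_finite_induct) (auto intro: L0 add that)
  obtain B where B: "B \<subseteq> ?R ` L" "independent B" "card B = CARD('n)"
    using basis_exists[of "?R ` L"] dim by metis
  then have "finite B" by (simp add: finiteI_independent)
  then obtain \<phi> :: "'n \<Rightarrow> real ^ 'n" where \<phi>: "bij_betw \<phi> UNIV B"
    using finite_same_card_bij[of "UNIV :: 'n set" B] B(3) by auto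
  have "\<forall>j. \<exists>u\<in>L. \<phi> j = ?R u"
    using \<phi> B(1) by (auto simp: bij_betw_def)
  then obtain u where u: "\<And>j. u j \<in> L" "\<And>j. \<phi> j = ?R (u j)" by metis
  define A :: "real ^ 'n ^ 'n" where "A = (\<chi> i j. of_int (u j $ i))"
  have of_int_det: "det (\<chi> i j. real_of_int (F i j)) = of_int (det (\<chi> i j. F i j))" for F :: "'n \<Rightarrow> 'n \<Rightarrow> int"
    by (simp add: det_def)
  have "columns A = B"
  proof -
    have "column j A = \<phi> j" for j
      by (simp add: column_def A_def u(2) map_vec_def)
    then show ?thesis
      using \<phi> by (auto simp: columns_def bij_betw_def)
  qed
  then have "rank A = CARD('n)"
    using B(2,3) by (simp add: column_rank_def dim_eq_card_independent)
  then have d: "det A \<noteq> 0" by (simp add: det_eq_0_rank)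
  define D where "D = det (\<chi> i j. u j $ i)"
  have D: "det A = of_int D" unfolding A_def D_def by (rule of_int_det)
  have D_mult: "D *s v \<in> L" for v
  proof -
    define y where "y k = det (\<chi> i j. if j = k then v $ i else u j $ i)" for k
    define x where "x = (\<chi> k. of_int (y k) / det A)"
    have "of_int (y k) = det (\<chi> i j. if j = k then ?R v $ i else A $ i $ j)" for k
      unfolding y_def of_int_det[symmetric]
      by (intro arg_cong[of _ _ det]) (simp add: A_def map_vec_def vec_eq_iff)
    then have "A *v x = ?R v"
      unfolding cramer[OF d] x_def by (simp add: vec_eq_iff)
    then have *: "(\<Sum>j\<in>UNIV. A $ i $ j * (of_int (y j) / det A)) = of_int (v $ i)" for i
      by (auto simp: matrix_vector_mult_def x_def map_vec_def vec_eq_iff)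
    have "D * v $ i = (\<Sum>j\<in>UNIV. y j * u j $ i)" for i
    proof -
      have "real_of_int (D * v $ i) = det A * (\<Sum>j\<in>UNIV. A $ i $ j * (of_int (y j) / det A))"
        by (simp only: *) (simp add: D)
      also have "\<dots> = of_int (\<Sum>j\<in>UNIV. y j * u j $ i)"
        using d by (simp add: sum_distrib_left A_def mult.commute)
      finally show ?thesis by (simp only: of_int_eq_iff)
    qed
    then have "D *s v = (\<Sum>j\<in>UNIV. y j *s u j)"
      by (simp add: vec_eq_iff)
    then show ?thesis using sum scale u(1) by simp
  qed
  have "D \<noteq> 0" using d D by simp
  moreover have "v \<in> L" if v: "\<And>i. int (nat \<bar>D\<bar>) dvd v $ i" for v
  proof -
    have "D *s (\<chi> i. v $ i div D) = v"
      using v by (simp add: vec_eq_iff)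
    then show ?thesis using D_mult by metis
  qed
  ultimately show ?thesis using that[of "nat \<bar>D\<bar>"] by simp
qed

lemma finite_vec_bounded: "finite {r :: nat ^ 'n. \<forall>i. r $ i < M}"
proof (rule finite_subset)
  let ?p = "\<chi> i. M :: nat ^ 'n"
  show "{r :: nat ^ 'n. \<forall>i. r $ i < M} \<subseteq> fst ` {(a, b). a + b = ?p}"
  proof
    fix r :: "nat ^ 'n" assume "r \<in> {r. \<forall>i. r $ i < M}"
    then have "(r, ?p - r) \<in> {(a, b). a + b = ?p}"
      by (auto simp: vec_eq_iff less_imp_le)
    then show "r \<in> fst ` {(a, b). a + b = ?p}" by force
  qed
  show "finite (fst ` {(a, b). a + b = ?p})"
    by (intro finite_imageI finite_mfps_mult_index)
qed

lemma eval_nat_constructible: "vec_constructible (eval_nat q)"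
proof -
  have "eval_nat q = (\<lambda>p. \<Sum>m\<in>Poly_Mapping.keys q.
      Poly_Mapping.lookup q m * (\<Prod>i\<in>UNIV. of_nat (p $ i) ^ (m $ i)))"
    by (simp add: fun_eq_iff mpoly_eval_def map_vec_def)
  then show ?thesis
    by (simp only:) (intro vec_constructible_sum vec_constructible_mult vec_constructible_const
      vec_constructible_prod vec_constructible_power vec_constructible_coordinate)
qed

text \<open>On each residue class modulo \<open>M\<close> the function is a polynomial, since \<open>M \<int>\<^sup>n\<close> is contained in the lattice.\<close>

lemma quasi_polynomial_constructible:
  fixes h :: "nat ^ 'n \<Rightarrow> rat"
  assumes "quasi_polynomial h"
  shows "vec_constructible h"
proof -
  obtain L q where L: "full_rank_lattice L" and
    q: "\<And>C p. C \<in> cosets L \<Longrightarrow> map_vec int p \<in> C \<Longrightarrow> h p = eval_nat (q C) p"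
    using assms unfolding quasi_polynomial_def by blast
  obtain M where M: "M > 0" "\<And>v. (\<And>i. int M dvd v $ i) \<Longrightarrow> v \<in> L"
    using full_rank_lattice_multiples[OF L] by metis
  let ?C = "\<lambda>r. (+) (map_vec int r) ` L" and ?I = "{r :: nat ^ 'n. \<forall>i. r $ i < M}"
  have "h = (\<lambda>p. \<Sum>r\<in>?I. of_bool (\<forall>i. p $ i mod M = r $ i) * eval_nat (q (?C r)) p)"
  proof
    fix p :: "nat ^ 'n"
    define r where "r = (\<chi> i. p $ i mod M)"
    have "map_vec int p - map_vec int r \<in> L"
    proof (rule M(2))
      show "int M dvd (map_vec int p - map_vec int r) $ i" for i
        by (simp add: map_vec_def r_def of_nat_mod flip: mod_eq_dvd_iff)
    qed
    then have "map_vec int r + (map_vec int p - map_vec int r) \<in> ?C r" by blast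
    then have h: "h p = eval_nat (q (?C r)) p"
      by (intro q) (auto simp: cosets_def)
    have "(\<forall>i. p $ i mod M = s $ i) \<longleftrightarrow> s = r" for s
      unfolding r_def vec_eq_iff by (metis vec_lambda_beta)
    then have "(\<Sum>s\<in>?I. of_bool (\<forall>i. p $ i mod M = s $ i) * eval_nat (q (?C s)) p) =
        (\<Sum>s\<in>?I. if s = r then eval_nat (q (?C s)) p else 0)"
      by (intro sum.cong) auto
    also have "\<dots> = eval_nat (q (?C r)) p"
      using M(1) finite_vec_bounded by (subst sum.delta) (auto simp: r_def)
    finally show "h p = (\<Sum>r\<in>?I. of_bool (\<forall>i. p $ i mod M = r $ i) * eval_nat (q (?C r)) p)"
      using h by simp
  qed
  moreover have "vec_constructible (\<lambda>p :: nat ^ 'n. of_bool (\<forall>i. p $ i mod M = r $ i))" for r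
  proof (rule vec_constructible_of_bool)
    show "definable (\<lambda>e :: 'n + nat \<Rightarrow> nat. \<forall>i\<in>UNIV. int (e (Inl i)) mod int M = int (r $ i))"
      using M(1) by (intro definable_Ball definable_mod_eq linear_var) auto
    show "(\<forall>i. p $ i mod M = r $ i) \<longleftrightarrow> (\<forall>i\<in>UNIV. int (param_env p (Inl i)) mod int M = int (r $ i))" for p
      by (simp add: param_env_def flip: of_nat_mod)
  qed
  ultimately show ?thesis
    by (simp only:) (intro vec_constructible_sum vec_constructible_mult eval_nat_constructible)
qed

lemma piecewise_quasi_polynomial_constructible:
  assumes "piecewise_quasi_polynomial g"
  shows "vec_constructible g"
proof -
  obtain k :: nat and P h where P: "\<And>i. i < k \<Longrightarrow> rational_polyhedron (P i)"
    and h: "\<And>i. i < k \<Longrightarrow> quasi_polynomial (h i)"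
    and dis: "disjoint_family_on (\<lambda>i. nat_points (P i)) {..<k}"
    and cover: "(\<Union>i<k. nat_points (P i)) = UNIV"
    and g: "\<And>i p. i < k \<Longrightarrow> p \<in> nat_points (P i) \<Longrightarrow> g p = h i p"
    using assms unfolding piecewise_quasi_polynomial_def by blast
  have "g p = (\<Sum>i<k. of_bool (p \<in> nat_points (P i)) * h i p)" for p
  proof -
    obtain j where j: "j < k" "p \<in> nat_points (P j)"
      using cover by blast
    have "p \<in> nat_points (P i) \<longleftrightarrow> i = j" if "i < k" for i
      using disjoint_family_onD[OF dis, of i j] that j by blast
    then have "(\<Sum>i<k. of_bool (p \<in> nat_points (P i)) * h i p) = (\<Sum>i<k. if i = j then h i p else 0)"
      by (intro sum.cong) auto
    then show ?thesis using j g by simp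
  qed
  then have "g = (\<lambda>p. \<Sum>i<k. of_bool (p \<in> nat_points (P i)) * h i p)" by blast
  moreover have "vec_constructible (\<lambda>p. \<Sum>i<k. of_bool (p \<in> nat_points (P i)) * h i p)"
    by (intro vec_constructible_sum vec_constructible_mult
      rational_polyhedron_constructible quasi_polynomial_constructible P h) simp_all
  ultimately show ?thesis by simp
qed

section \<open>Relations between the three properties\<close>

theorem theorem1p10:
  fixes g :: "nat ^ 'n \<Rightarrow> rat"
  shows "(presburger_counting_function g \<longrightarrow> piecewise_quasi_polynomial g) \<and>
         (piecewise_quasi_polynomial g \<longleftrightarrow> rational_generating_function g)"
  using presburger_counting_vec_constructible vec_constructible_piecewise_quasi_polynomial
    piecewise_quasi_polynomial_constructible vec_constructible_rgf rgf_vec_constructible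
  by blast

end
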